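(* Let $\Omega$ be a ball or an annulus in $\mathbb{R}^N$, $N\ge2$, centered at the origin, let $a(s)=1+|s|^k$ with $k>1$, let $\frac{k}{2}<p<\frac{(k+1)N+2}{N-2}$ (the upper bound being read as $+\infty$ when $N=2$), and let $u$ be any (smooth) radial solution to $$\begin{cases}-\mathrm{div}(a(u)Du)+\frac{a'(u)}{2}|Du|^2=|u|^{p-1}u&\text{in }\Omega,\\ u=0&\text{on }\partial\Omega.\end{cases}$$ Then $\mathrm{nod}(u)\le1+\frac{m(u,J)}{N+1}$.
   Context: A (smooth) solution is a classical solution $u\in C^2(\Omega)\cap C(\overline{\Omega})$; $Du$ is the gradient. For $u:\Omega\to\mathbb{R}$, $\mathrm{nod}(u)\in\mathbb{N}\cup\{\infty\}$ denotes the number of connected components of $\Omega\setminus u^{-1}(0)$. Morse index: let $g:\mathbb{R}\to\mathbb{R}$ be the unique (globally defined, strictly increasing) solution of the Cauchy problem $g'=1/\sqrt{a\circ g}$, $g(0)=0$. Put $f(s)=|s|^{p-1}s$ and $h(s)=f(g(s))\,a(g(s))^{-1/2}$. Then $u$ is a $C^2$ solution of the quasi-linear problem if and only if $v=g^{-1}(u)$ is a $C^2$ solution of $-\Delta v=h(v)$ in $\Omega$, $v=0$ on $\partial\Omega$. The functional formally associated with the quasi-linear problem is $J(u)=\frac12\int_\Omega a(u)|Du|^2-\int_\Omega F(u)$, with $F(s)=\int_0^sf(\tau)\,d\tau$. The Morse index $m(u,J)$ of a smooth solution $u$ is defined as the supremum of the dimensions of the linear subspaces $V\subset H^1_0(\Omega)$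 on which the quadratic form $\varphi\mapsto\int_\Omega|D\varphi|^2-\int_\Omega h'(v)\varphi^2$, with $v=g^{-1}(u)$, is negative definite. *)

theory Defs
  imports "HOL-Analysis.Analysis" "HOL-Library.Extended_Nat" "HOL-Library.Extended_Real"
begin

definition grad :: "(real^'n \<Rightarrow> real) \<Rightarrow> real^'n \<Rightarrow> real^'n" where
  "grad f x = (\<chi> i. frechet_derivative f (at x) (axis i 1))"

definition divergence :: "(real^'n \<Rightarrow> real^'n) \<Rightarrow> real^'n \<Rightarrow> real" where
  "divergence F x = (\<Sum>i\<in>UNIV. grad (\<lambda>y. F y $ i) x $ i)"

text \<open>\<^term>\<open>Ck_on k S f\<close> says that \<^term>\<open>f\<close> is of class $C^k$ on \<^term>\<open>S\<close>; it is meant for open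
  \<^term>\<open>S\<close> only, since the derivatives are two-sided.\<close>

primrec Ck_on :: "nat \<Rightarrow> (real^'n) set \<Rightarrow> (real^'n \<Rightarrow> real) \<Rightarrow> bool" where
  "Ck_on 0 S f \<longleftrightarrow> continuous_on S f"
| "Ck_on (Suc k) S f \<longleftrightarrow> (\<forall>x\<in>S. f differentiable (at x)) \<and> (\<forall>i. Ck_on k S (\<lambda>x. grad f x $ i))"

definition test_function :: "(real^'n) set \<Rightarrow> (real^'n \<Rightarrow> real) \<Rightarrow> bool" where
  "test_function \<Omega> \<psi> \<longleftrightarrow> (\<forall>k. Ck_on k UNIV \<psi>) \<and>
     compact (closure {x. \<psi> x \<noteq> 0}) \<and> closure {x. \<psi> x \<noteq> 0} \<subseteq> \<Omega>"

quotient_type (overloaded) 'a L0 = "'a::euclidean_space \<Rightarrow> real" /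
  partial: "\<lambda>\<phi> \<psi>. \<phi> \<in> borel_measurable lebesgue \<and> \<psi> \<in> borel_measurable lebesgue \<and>
     (AE x in lebesgue. \<phi> x = \<psi> x)"
proof (rule part_equivpI)
  show "\<exists>\<phi> :: 'a \<Rightarrow> real. \<phi> \<in> borel_measurable lebesgue \<and> \<phi> \<in> borel_measurable lebesgue \<and>
      (AE x in lebesgue. \<phi> x = \<phi> x)"
    by (rule exI[of _ "\<lambda>_. 0"]) simp
qed (auto simp: symp_def transp_def)

instantiation L0 :: (euclidean_space) real_vector
begin

lift_definition zero_L0 :: "'a L0" is "\<lambda>_. 0" by simp

lift_definition plus_L0 :: "'a L0 \<Rightarrow> 'a L0 \<Rightarrow> 'a L0" is "\<lambda>\<phi> \<psi> x. \<phi> x + \<psi> x" by auto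

lift_definition minus_L0 :: "'a L0 \<Rightarrow> 'a L0 \<Rightarrow> 'a L0" is "\<lambda>\<phi> \<psi> x. \<phi> x - \<psi> x" by auto

lift_definition uminus_L0 :: "'a L0 \<Rightarrow> 'a L0" is "\<lambda>\<phi> x. - \<phi> x" by auto

lift_definition scaleR_L0 :: "real \<Rightarrow> 'a L0 \<Rightarrow> 'a L0" is "\<lambda>c \<phi> x. c * \<phi> x" by auto

instance
  by standard (transfer; auto simp: algebra_simps)+

end

definition L2_on :: "(real^'n) set \<Rightarrow> (real^'n \<Rightarrow> 'b::euclidean_space) \<Rightarrow> bool" where
  "L2_on \<Omega> \<phi> \<longleftrightarrow> \<phi> \<in> borel_measurable lebesgue \<and> set_integrable lebesgue \<Omega> (\<lambda>x. (norm (\<phi> x))\<^sup>2)"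

definition has_weak_grad :: "(real^'n) set \<Rightarrow> (real^'n \<Rightarrow> real) \<Rightarrow> (real^'n \<Rightarrow> real^'n) \<Rightarrow> bool" where
  "has_weak_grad \<Omega> \<phi> G \<longleftrightarrow> (\<forall>\<psi> i. test_function \<Omega> \<psi> \<longrightarrow>
     (LINT x:\<Omega>|lebesgue. \<phi> x * grad \<psi> x $ i) = - (LINT x:\<Omega>|lebesgue. G x $ i * \<psi> x))"

definition H1_on :: "(real^'n) set \<Rightarrow> (real^'n \<Rightarrow> real) \<Rightarrow> bool" where
  "H1_on \<Omega> \<phi> \<longleftrightarrow> L2_on \<Omega> \<phi> \<and> (\<exists>G. L2_on \<Omega> G \<and> has_weak_grad \<Omega> \<phi> G)"

text \<open>The weak gradient is unique up to a null set in \<^term>\<open>\<Omega>\<close>; only integrals of it over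
  \<^term>\<open>\<Omega>\<close> are used.\<close>

definition weak_grad :: "(real^'n) set \<Rightarrow> (real^'n \<Rightarrow> real) \<Rightarrow> real^'n \<Rightarrow> real^'n" where
  "weak_grad \<Omega> \<phi> = (SOME G. L2_on \<Omega> G \<and> has_weak_grad \<Omega> \<phi> G)"

text \<open>$H^1_0(\Omega)$ is the closure of the test functions in the norm of $H^1(\Omega)$. Its elements
  are regarded as functions on the whole space, extended by zero outside \<^term>\<open>\<Omega>\<close>.\<close>

definition H10 :: "(real^'n) set \<Rightarrow> (real^'n) L0 set" where
  "H10 \<Omega> = {w. let \<phi> = rep_L0 w in
     H1_on \<Omega> \<phi> \<and> (AE x in lebesgue. x \<notin> \<Omega> \<longrightarrow> \<phi> x = 0) \<and>
     (\<forall>\<epsilon>>0. \<exists>\<psi>. test_function \<Omega> \<psi> \<and>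
        (LINT x:\<Omega>|lebesgue. (\<phi> x - \<psi> x)\<^sup>2) +
        (LINT x:\<Omega>|lebesgue. (norm (weak_grad \<Omega> \<phi> x - grad \<psi> x))\<^sup>2) < \<epsilon>)}"

definition quasilinear_solution ::
  "(real^'n) set \<Rightarrow> (real \<Rightarrow> real) \<Rightarrow> (real \<Rightarrow> real) \<Rightarrow> (real^'n \<Rightarrow> real) \<Rightarrow> bool" where
  "quasilinear_solution \<Omega> a f u \<longleftrightarrow> Ck_on 2 \<Omega> u \<and> continuous_on (closure \<Omega>) u \<and>
     (\<forall>x\<in>\<Omega>. - divergence (\<lambda>y. a (u y) *\<^sub>R grad u y) x + deriv a (u x) / 2 * (norm (grad u x))\<^sup>2
             = f (u x)) \<and>
     (\<forall>x\<in>frontier \<Omega>. u x = 0)"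

definition radial_on :: "(real^'n) set \<Rightarrow> (real^'n \<Rightarrow> real) \<Rightarrow> bool" where
  "radial_on \<Omega> u \<longleftrightarrow> (\<forall>x\<in>\<Omega>. \<forall>y\<in>\<Omega>. norm x = norm y \<longrightarrow> u x = u y)"

definition nod :: "(real^'n) set \<Rightarrow> (real^'n \<Rightarrow> real) \<Rightarrow> enat" where
  "nod \<Omega> u = (let C = components (\<Omega> - u -` {0}) in if finite C then enat (card C) else \<infinity>)"

definition cauchy_g :: "(real \<Rightarrow> real) \<Rightarrow> real \<Rightarrow> real" where
  "cauchy_g a = (THE g. g 0 = 0 \<and> (\<forall>s. (g has_real_derivative 1 / sqrt (a (g s))) (at s)))"

lemma ex1_cauchy_g:
  assumes cont: "continuous_on UNIV a" and ge1: "\<And>s. 1 \<le> a s"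
  shows "\<exists>!g. g 0 = 0 \<and> (\<forall>s. (g has_real_derivative 1 / sqrt (a (g s))) (at s))"
proof -
  have "\<exists>F. \<forall>x::real. -\<infinity> < ereal x \<longrightarrow> ereal x < \<infinity> \<longrightarrow>
      (F has_vector_derivative sqrt (a x)) (at x)"
    by (rule einterval_antiderivative)
       (use cont in \<open>auto intro!: continuous_intros simp: continuous_on_eq_continuous_at\<close>)
  then obtain F where F: "\<And>x. (F has_real_derivative sqrt (a x)) (at x)"
    by (auto simp: has_real_derivative_iff_has_vector_derivative)
  define A where "A x = F x - F 0" for x
  have A: "(A has_real_derivative sqrt (a x)) (at x)" for x
    unfolding A_def by (auto intro!: derivative_eq_intros F)
  have A0: "A 0 = 0" by (simp add: A_def)
  have pos: "sqrt (a x) > 0" for x using ge1[of x] by simp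
  have contA: "isCont A x" for x using A DERIV_isCont by blast
  have lower: "A y - A x \<ge> y - x" if "x \<le> y" for x y
  proof (cases "x = y")
    case False
    then have "x < y" using that by simp
    then obtain z where "A y - A x = (y - x) * sqrt (a z)"
      using MVT2[of x y A "\<lambda>z. sqrt (a z)"] A by blast
    moreover have "sqrt (a z) \<ge> 1" using ge1[of z] by simp
    ultimately show ?thesis
      using that mult_left_mono[of 1 "sqrt (a z)" "y - x"] by simp
  qed simp
  have inj: "inj A"
  proof (rule injI)
    fix x y assume "A x = A y"
    then show "x = y" using lower[of x y] lower[of y x] by linarith
  qed
  have surj: "\<exists>x. A x = y" for y
  proof -
    have "A (- \<bar>y\<bar>) \<le> y" "y \<le> A \<bar>y\<bar>"
      using lower[of "- \<bar>y\<bar>" 0] lower[of 0 "\<bar>y\<bar>"] A0 by linarith+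
    moreover have "- \<bar>y\<bar> \<le> \<bar>y\<bar>" by simp
    ultimately show ?thesis using IVT[of A "- \<bar>y\<bar>" y "\<bar>y\<bar>"] contA by blast
  qed
  define g where "g = inv A"
  have Ag: "A (g y) = y" for y unfolding g_def using surj by (metis f_inv_into_f rangeI)
  have gA: "g (A x) = x" for x unfolding g_def using inj by simp
  have contg: "isCont g y" for y
  proof -
    have "isCont g (A (g y))"
      by (rule isCont_inverse_function[of 1]) (auto simp: gA contA)
    then show ?thesis by (simp add: Ag)
  qed
  have g: "(g has_real_derivative 1 / sqrt (a (g s))) (at s)" for s
  proof -
    have "(g has_real_derivative inverse (sqrt (a (g s)))) (at s)"
      by (rule DERIV_inverse_function[of A _ _ _ "s - 1" "s + 1"])
         (use A[of "g s"] pos[of "g s"] in \<open>simp_all add: Ag contg\<close>)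
    then show ?thesis by (simp add: inverse_eq_divide)
  qed
  show ?thesis
  proof (rule ex1I[of _ g])
    show "g 0 = 0 \<and> (\<forall>s. (g has_real_derivative 1 / sqrt (a (g s))) (at s))"
      using g gA[of 0] A0 by simp
  next
    fix j assume j: "j 0 = 0 \<and> (\<forall>s. (j has_real_derivative 1 / sqrt (a (j s))) (at s))"
    have D: "((\<lambda>s. A (j s) - s) has_real_derivative 0) (at s)" for s
    proof -
      have "((\<lambda>s. A (j s)) has_real_derivative sqrt (a (j s)) * (1 / sqrt (a (j s)))) (at s)"
        by (rule DERIV_chain2[OF A]) (use j in blast)
      then have "((\<lambda>s. A (j s)) has_real_derivative 1) (at s)"
        using pos[of "j s"] by simp
      from DERIV_diff[OF this DERIV_ident] show ?thesis by simp
    qed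
    have "A (j s) - s = A (j 0) - 0" for s
      using DERIV_isconst_all[of "\<lambda>s. A (j s) - s"] D by blast
    then have "A (j s) = s" for s using j A0 by simp
    then have "j s = g s" for s using gA[of "j s"] by simp
    then show "j = g" by (rule ext)
  qed
qed

text \<open>Below, \<^term>\<open>h\<close> and \<^term>\<open>v\<close> are the nonlinearity and the solution of the semi-linear
  problem obtained by the change of variable $u = g(v)$.\<close>

definition second_variation ::
  "(real^'n) set \<Rightarrow> (real \<Rightarrow> real) \<Rightarrow> (real \<Rightarrow> real) \<Rightarrow> (real^'n \<Rightarrow> real) \<Rightarrow> (real^'n) L0 \<Rightarrow> real" where
  "second_variation \<Omega> a f u w =
     (let g = cauchy_g a;
          h = (\<lambda>s. f (g s) / sqrt (a (g s)));
          v = (\<lambda>x. inv g (u x));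
          \<phi> = rep_L0 w
      in (LINT x:\<Omega>|lebesgue. (norm (weak_grad \<Omega> \<phi> x))\<^sup>2)
         - (LINT x:\<Omega>|lebesgue. deriv h (v x) * (\<phi> x)\<^sup>2))"

text \<open>\<^const>\<open>dim\<close> is 0 on infinite-dimensional spaces, hence the case distinction.\<close>

definition edim :: "'v::real_vector set \<Rightarrow> enat" where
  "edim V = (if \<exists>B. finite B \<and> V \<subseteq> span B then enat (dim V) else \<infinity>)"

definition morse_index ::
  "(real^'n) set \<Rightarrow> (real \<Rightarrow> real) \<Rightarrow> (real \<Rightarrow> real) \<Rightarrow> (real^'n \<Rightarrow> real) \<Rightarrow> enat" where
  "morse_index \<Omega> a f u = Sup {edim V | V. subspace V \<and> V \<subseteq> H10 \<Omega> \<and>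
     (\<forall>w\<in>V. w \<noteq> 0 \<longrightarrow> second_variation \<Omega> a f u w < 0)}"

end

theory Submission
  imports Defs "HOL-Real_Asymp.Real_Asymp"
begin

text \<open>
With \<open>u = g v\<close> the function \<open>v\<close> is a radial solution of \<open>- \<Delta>v = h v\<close>, and the second variation is the form
\<open>Q \<phi> = \<integral> \<bar>D\<phi>\<bar>\<^sup>2 - \<integral> h' v * \<phi>\<^sup>2\<close> of the linearized equation. The partial derivatives of \<open>v\<close> solve this equation; they are
\<open>x $ i * w (norm x)\<close> with \<open>w r = v' r / r\<close>. Between two consecutive zeros of \<open>v'\<close> they can be extended by 0, and
these restrictions are \<open>N\<close> functions with \<open>Q = 0\<close>. The radial function \<open>norm x * w (norm x)\<close>, restricted to the same
shell, has \<open>Q < 0\<close>, because it has the same radial energy but no angular energy. So every shell between two consecutive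
zeros of \<open>v'\<close> contributes \<open>N + 1\<close> independent functions, the origin counting as a zero in a ball.

If \<open>u\<close> has \<open>m\<close> nodal domains, their points can be ordered by their norm, since shells are connected, and \<open>v\<close>
vanishes between them (\<open>nodal_zeros\<close>). Rolle's theorem yields enough zeros of \<open>v'\<close> for \<open>m - 1\<close>
shells, which gives \<open>(N + 1) * (m - 1)\<close> functions and hence the estimate.

It remains to make \<open>Q\<close> strictly negative on a space of this dimension that consists of admissible
functions. By symmetry \<open>Q\<close> decouples on functions \<open>norm x * s (norm x) + (\<Sum>i. x $ i * t i (norm x))\<close>, and it is bounded by
values of a single one-dimensional form \<open>q s = \<integral> r ^ (N + 1) * (s'\<^sup>2 - B * s\<^sup>2)\<close> (\<open>energy_bound\<close>), where \<open>B\<close> is the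
radial profile of \<open>h' v\<close>. So it suffices to find \<open>m - 1\<close> profiles on whose span \<open>q\<close> is negative definite.
The restrictions of \<open>w\<close> to the intervals between its zeros make \<open>q\<close> vanish, but they have kinks: moving
the profiles at the kinks decreases \<open>q\<close> to first order (\<open>negative_directions\<close>). The resulting piecewise
smooth profiles are approximated by polynomials times a smooth cutoff (\<open>smooth_approximation\<close>). In this
way all functions in question are test functions, for which the weak gradient in the definition of
the second variation is the classical one (\<open>test_function_L0\<close>).

The potential \<open>h' v\<close> may be unbounded where \<open>v = 0\<close>. An energy argument shows that the zeros of a nontrivial
profile are simple (\<open>energy_zero\<close>); as \<open>h\<close> is nondecreasing, the potential is then locally integrable
(\<open>local_structure\<close>), and the exceptional radii are isolated.
\<close>

section \<open>Elementary smooth functions\<close>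

text \<open>The family is closed under differentiation up to linear combinations, and all its members are flat at 0.
Real exponents are allowed because the factor \<open>t powr (k / 2)\<close> at \<open>t = (norm x)\<^sup>2\<close> turns into \<open>norm x ^ k\<close>; this
makes odd powers of the norm smooth after multiplication with a flat factor.\<close>

definition flat :: "real \<Rightarrow> real \<Rightarrow> real" where
  "flat c t = (if t > 0 then exp (- 1 / t) * t powr c else 0)"

lemma flat_over_self: "((\<lambda>t. flat c t / t) \<longlongrightarrow> 0) (at 0)"
proof -
  have "((\<lambda>t::real. exp (- 1 / t) * t powr (c - 1)) \<longlongrightarrow> 0) (at_right 0)"
    by real_asymp
  then have "((\<lambda>t. flat c t / t) \<longlongrightarrow> 0) (at_right 0)"
    by (rule Lim_transform_eventually)
       (auto simp: eventually_at_right_field flat_def powr_diff intro!: exI[of _ 1])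
  moreover have "((\<lambda>t. flat c t / t) \<longlongrightarrow> 0) (at_left 0)"
    by (rule Lim_transform_eventually[OF tendsto_const])
       (auto simp: eventually_at_left_field flat_def intro!: exI[of _ "-1"])
  ultimately show ?thesis by (simp add: filterlim_at_split)
qed

text \<open>Away from 0 this is the product rule; at 0 the difference quotient \<open>flat c t / t\<close> tends to 0, because
the exponential beats every power.\<close>

lemma flat_has_derivative:
  "(flat c has_real_derivative flat (c - 2) t + c * flat (c - 1) t) (at t)"
proof (cases t "0::real" rule: linorder_cases)
  case equal
  then show ?thesis
    using flat_over_self[of c] by (simp add: has_field_derivative_iff flat_def)
next
  case less
  have "((\<lambda>_. 0) has_real_derivative 0) (at t)" by simp
  then have "(flat c has_real_derivative 0) (at t)"
    by (rule DERIV_cong_ev[THEN iffD1, rotated -1])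
       (use less in \<open>auto simp: flat_def eventually_nhds intro!: exI[of _ "{..<0}"]\<close>)
  then show ?thesis using less by (simp add: flat_def)
next
  case greater
  have "((\<lambda>t. exp (- 1 / t) * t powr c) has_real_derivative
      (exp (- 1 / t) * (1 / t^2)) * t powr c + exp (- 1 / t) * (c * t powr (c - 1))) (at t)"
    using greater by (auto intro!: derivative_eq_intros simp: power2_eq_square)
  also have "(exp (- 1 / t) * (1 / t^2)) * t powr c + exp (- 1 / t) * (c * t powr (c - 1)) =
     flat (c - 2) t + c * flat (c - 1) t"
    using greater by (simp add: flat_def powr_diff field_simps)
  finally have "((\<lambda>t. exp (- 1 / t) * t powr c) has_real_derivative
     flat (c - 2) t + c * flat (c - 1) t) (at t)" .
  then show ?thesis
    by (rule DERIV_cong_ev[THEN iffD1, rotated -1])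
       (use greater in \<open>auto simp: flat_def eventually_nhds intro!: exI[of _ "{0<..}"]\<close>)
qed

text \<open>A class of differentiable functions that is closed under partial derivatives consists of smooth
functions. Generating such a class avoids Leibniz and chain rules for derivatives of higher order.\<close>

inductive elementary :: "(real^'n \<Rightarrow> real) \<Rightarrow> bool" where
  const: "elementary (\<lambda>_. c)"
| coord: "elementary (\<lambda>x. x $ i)"
| add: "elementary \<phi> \<Longrightarrow> elementary \<psi> \<Longrightarrow> elementary (\<lambda>x. \<phi> x + \<psi> x)"
| mult: "elementary \<phi> \<Longrightarrow> elementary \<psi> \<Longrightarrow> elementary (\<lambda>x. \<phi> x * \<psi> x)"
| flat: "elementary \<phi> \<Longrightarrow> elementary (\<lambda>x. flat c (\<phi> x))"

lemma grad_eqI: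
  assumes "(f has_derivative f') (at x)"
  shows "grad f x $ i = f' (axis i 1)"
  using frechet_derivative_at[OF assms] by (simp add: grad_def)

lemma has_derivative_grad:
  fixes f :: "real^'n \<Rightarrow> real"
  assumes "f differentiable (at x)"
  shows "(f has_derivative (\<lambda>h. grad f x \<bullet> h)) (at x)"
proof -
  let ?f' = "frechet_derivative f (at x)"
  have f': "(f has_derivative ?f') (at x)"
    using assms frechet_derivative_works by blast
  then interpret bounded_linear ?f' by (rule has_derivative_bounded_linear)
  have "?f' h = grad f x \<bullet> h" for h
  proof -
    have "h = (\<Sum>i\<in>UNIV. (h $ i) *\<^sub>R axis i 1)"
      by (simp add: basis_expansion scalar_mult_eq_scaleR[symmetric])
    then have "?f' h = ?f' (\<Sum>i\<in>UNIV. (h $ i) *\<^sub>R axis i 1)" by simp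
    also have "\<dots> = grad f x \<bullet> h"
      by (simp add: sum scaleR inner_vec_def grad_def mult.commute)
    finally show ?thesis .
  qed
  then have "?f' = (\<lambda>h. grad f x \<bullet> h)" by auto
  with f' show ?thesis by simp
qed

lemma elementary_deriv:
  fixes \<phi> :: "real^'n \<Rightarrow> real"
  assumes "elementary \<phi>"
  shows "(\<forall>x. \<phi> differentiable (at x)) \<and> (\<forall>i. elementary (\<lambda>x. grad \<phi> x $ i))"
  using assms
proof induction
  case (const c)
  have "grad (\<lambda>_. c) x $ i = 0" for x :: "real^'n" and i
    by (rule grad_eqI) (auto intro!: derivative_eq_intros)
  then show ?case by (auto intro: elementary.const)
next
  case (coord j)
  have d: "((\<lambda>x. x $ j) has_derivative (\<lambda>h. h $ j)) (at x)" for x :: "real^'n"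
    by (rule bounded_linear_imp_has_derivative) (rule bounded_linear_vec_nth)
  have "grad (\<lambda>x. x $ j) x $ i = axis i 1 $ j" for x :: "real^'n" and i
    by (rule grad_eqI[OF d])
  with d show ?case by (auto simp: differentiable_def intro: elementary.const)
next
  case (add \<phi> \<psi>)
  have d: "((\<lambda>x. \<phi> x + \<psi> x) has_derivative (\<lambda>h. grad \<phi> x \<bullet> h + grad \<psi> x \<bullet> h)) (at x)" for x
    using add.IH by (auto intro!: has_derivative_add has_derivative_grad)
  have "grad (\<lambda>x. \<phi> x + \<psi> x) x $ i = grad \<phi> x $ i + grad \<psi> x $ i" for x i
    using grad_eqI[OF d] by (simp add: inner_axis)
  with add.IH show ?case by (auto intro: elementary.add)
next
  case (mult \<phi> \<psi>)
  have d: "((\<lambda>x. \<phi> x * \<psi> x) has_derivative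
      (\<lambda>h. \<phi> x * (grad \<psi> x \<bullet> h) + (grad \<phi> x \<bullet> h) * \<psi> x)) (at x)" for x
    using mult.IH by (auto intro!: has_derivative_mult has_derivative_grad)
  have "grad (\<lambda>x. \<phi> x * \<psi> x) x $ i = \<phi> x * grad \<psi> x $ i + grad \<phi> x $ i * \<psi> x" for x i
    using grad_eqI[OF d] by (simp add: inner_axis)
  with mult.IH mult.hyps show ?case by (auto intro!: elementary.add elementary.mult)
next
  case (flat \<phi> c)
  have d: "((\<lambda>x. flat c (\<phi> x)) has_derivative
      (\<lambda>h. (grad \<phi> x \<bullet> h) * (flat (c - 2) (\<phi> x) + c * flat (c - 1) (\<phi> x)))) (at x)" for x
    by (rule DERIV_compose_FDERIV[OF flat_has_derivative])
       (use flat.IH in \<open>auto intro: has_derivative_grad\<close>)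
  have "grad (\<lambda>x. flat c (\<phi> x)) x $ i
      = grad \<phi> x $ i * (flat (c - 2) (\<phi> x) + c * flat (c - 1) (\<phi> x))" for x i
    using grad_eqI[OF d] by (simp add: inner_axis)
  with d flat.IH flat.hyps show ?case
    by (auto simp: differentiable_def
        intro!: elementary.add elementary.mult elementary.const elementary.flat)
qed

lemma elementary_Ck: "elementary \<phi> \<Longrightarrow> Ck_on k UNIV \<phi>"
proof (induction k arbitrary: \<phi>)
  case 0
  then show ?case
    using elementary_deriv by (auto intro!: continuous_at_imp_continuous_on differentiable_imp_continuous_within)
next
  case (Suc k)
  then show ?case using elementary_deriv by auto
qed

lemma elementary_sum: "finite I \<Longrightarrow> (\<And>i. i \<in> I \<Longrightarrow> elementary (\<phi> i)) \<Longrightarrow> elementary (\<lambda>x. \<Sum>i\<in>I. \<phi> i x)"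
  by (induction I rule: finite_induct) (auto intro: elementary.add elementary.const)

lemma elementary_prod: "finite I \<Longrightarrow> (\<And>i. i \<in> I \<Longrightarrow> elementary (\<phi> i)) \<Longrightarrow> elementary (\<lambda>x. \<Prod>i\<in>I. \<phi> i x)"
  by (induction I rule: finite_induct) (auto intro: elementary.mult elementary.const)

lemma elementary_norm2: "elementary (\<lambda>x::real^'n. (norm x)\<^sup>2)"
proof -
  have "(\<lambda>x::real^'n. (norm x)\<^sup>2) = (\<lambda>x. \<Sum>i\<in>UNIV. x $ i * x $ i)"
    by (auto simp: power2_norm_eq_inner inner_vec_def)
  then show ?thesis by (auto intro!: elementary_sum elementary.mult elementary.coord)
qed

lemma elementary_test_function:
  assumes "elementary \<phi>" "compact K" "K \<subseteq> \<Omega>" "\<And>x. x \<notin> K \<Longrightarrow> \<phi> x = 0"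
  shows "test_function \<Omega> \<phi>"
proof -
  have "closure {x. \<phi> x \<noteq> 0} \<subseteq> K"
    using assms(2,4) by (intro closure_minimal compact_imp_closed) auto
  moreover from this assms(2) have "compact (closure {x. \<phi> x \<noteq> 0})"
    by (meson closed_Int_compact closed_closure compact_imp_closed bounded_subset compact_eq_bounded_closed)
  ultimately show ?thesis using assms elementary_Ck unfolding test_function_def by blast
qed

section \<open>Weak gradients of test functions\<close>

lemma test_function_props:
  assumes "test_function \<Omega> \<psi>"
  obtains K where "compact K" "K \<subseteq> \<Omega>" "\<And>x. x \<notin> K \<Longrightarrow> \<psi> x = 0" "\<And>x. x \<notin> K \<Longrightarrow> grad \<psi> x = 0"
    "continuous_on UNIV \<psi>" "\<And>x. \<psi> differentiable (at x)" "\<And>i. continuous_on UNIV (\<lambda>x. grad \<psi> x $ i)"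
proof -
  define K where "K = closure {x. \<psi> x \<noteq> 0}"
  have 0: "\<psi> x = 0" if "x \<notin> K" for x
    using that closure_subset[of "{x. \<psi> x \<noteq> 0}"] unfolding K_def by auto
  have K: "compact K" "K \<subseteq> \<Omega>" using assms by (auto simp: test_function_def K_def)
  have g0: "grad \<psi> x = 0" if "x \<notin> K" for x
  proof -
    have "((\<lambda>_. 0) has_derivative (\<lambda>_. 0)) (at x)" by simp
    then have "(\<psi> has_derivative (\<lambda>_. 0)) (at x)"
      by (rule has_derivative_transform_within_open[where s="- K"])
         (use 0 that K in \<open>auto simp: open_Compl compact_imp_closed\<close>)
    from grad_eqI[OF this] show ?thesis by (simp add: vec_eq_iff)
  qed
  have "Ck_on (Suc 0) UNIV \<psi>" "Ck_on 0 UNIV \<psi>" using assms unfolding test_function_def by blast+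
  then have "continuous_on UNIV \<psi>" "\<And>x. \<psi> differentiable (at x)" "\<And>i. continuous_on UNIV (\<lambda>x. grad \<psi> x $ i)"
    by auto
  with 0 g0 K show ?thesis using that[of K] by blast
qed

lemma continuous_compact_support_bounded:
  fixes f :: "'a::metric_space \<Rightarrow> real"
  assumes "continuous_on UNIV f" "compact K" "\<And>x. x \<notin> K \<Longrightarrow> f x = 0"
  obtains M where "0 < M" "\<And>x. \<bar>f x\<bar> \<le> M"
proof -
  have "compact (f ` K)" by (rule compact_continuous_image[OF continuous_on_subset[OF assms(1)] assms(2)]) auto
  from compact_imp_bounded[OF this] obtain M where M: "0 < M" "\<And>x. x \<in> K \<Longrightarrow> \<bar>f x\<bar> \<le> M"
    by (auto simp: bounded_pos)
  with assms(3) have "\<bar>f x\<bar> \<le> M" for x by (cases "x \<in> K") auto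
  with M that show ?thesis by blast
qed

lemma integrable_bounded_support:
  fixes f :: "'a::euclidean_space \<Rightarrow> real"
  assumes "f \<in> borel_measurable borel" "bounded K" "\<And>x. x \<notin> K \<Longrightarrow> f x = 0" "\<And>x. \<bar>f x\<bar> \<le> M"
  shows "integrable lborel f"
proof -
  obtain a b where ab: "K \<subseteq> cbox a (b::'a)" using bounded_subset_cbox_symmetric[OF assms(2)] by blast
  have "integrable lborel (\<lambda>x. M * indicator (cbox a b) x)"
    by (simp add: emeasure_lborel_cbox_eq)
  then show ?thesis
  proof (rule Bochner_Integration.integrable_bound)
    show "AE x in lborel. norm (f x) \<le> norm (M * indicat_real (cbox a b) x)"
      using assms(3,4) ab by (intro AE_I2) (auto simp: indicator_def intro: order_trans[OF _ abs_ge_self])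
  qed (use assms in auto)
qed

lemma integrable_continuous_compact_support:
  fixes f :: "'a::euclidean_space \<Rightarrow> real"
  assumes "continuous_on UNIV f" "compact K" "\<And>x. x \<notin> K \<Longrightarrow> f x = 0"
  shows "integrable lborel f"
  using continuous_compact_support_bounded[OF assms]
    integrable_bounded_support[of f K] assms
  by (metis borel_measurable_continuous_onI compact_imp_bounded)

text \<open>The integral of a difference quotient of \<open>f\<close> vanishes by translation invariance of Lebesgue measure. The
quotients are bounded by the maximum of the partial derivative and live in a fixed ball, so the limit
may be taken under the integral.\<close>

lemma integral_grad_eq_0:
  fixes f :: "real^'n \<Rightarrow> real"
  assumes d: "\<And>x. f differentiable (at x)" and c: "continuous_on UNIV (\<lambda>x. grad f x $ i)"
    and K: "compact K" and f0: "\<And>x. x \<notin> K \<Longrightarrow> f x = 0" and g0: "\<And>x. x \<notin> K \<Longrightarrow> grad f x $ i = 0"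
  shows "(LINT x|lborel. grad f x $ i) = 0"
proof -
  let ?e = "axis i 1 :: real^'n"
  define t where "t n = inverse (real (Suc n))" for n
  have t: "t n > 0" "t n \<le> 1" for n by (auto simp: t_def inverse_le_1_iff)
  have t0: "t \<longlonglongrightarrow> 0" unfolding t_def by (rule LIMSEQ_inverse_real_of_nat)
  have cf: "continuous_on UNIV f" using d
    by (auto intro!: continuous_at_imp_continuous_on differentiable_imp_continuous_within)
  then have [measurable]: "f \<in> borel_measurable borel" by (rule borel_measurable_continuous_onI)
  have [measurable]: "(\<lambda>x. grad f x $ i) \<in> borel_measurable borel" using c by (rule borel_measurable_continuous_onI)
  have fi: "integrable lborel f" by (rule integrable_continuous_compact_support[OF cf K f0])
  obtain M where M: "0 < M" "\<And>x. \<bar>grad f x $ i\<bar> \<le> M"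
    using continuous_compact_support_bounded[OF c K g0] by blast
  obtain r where r: "\<And>x. x \<in> K \<Longrightarrow> norm x \<le> r" using compact_imp_bounded[OF K] by (auto simp: bounded_iff)
  have dt: "((\<lambda>s. f (x + s *\<^sub>R ?e)) has_real_derivative grad f (x + s *\<^sub>R ?e) $ i) (at s)" for x s
  proof -
    have h: "(f has_derivative (\<lambda>h. grad f (x + s *\<^sub>R ?e) \<bullet> h)) (at (x + s *\<^sub>R ?e))"
      by (rule has_derivative_grad[OF d])
    have "((\<lambda>s. x + s *\<^sub>R ?e) has_derivative (\<lambda>h. h *\<^sub>R ?e)) (at s)"
      by (auto intro!: derivative_eq_intros)
    from has_derivative_compose[OF this h]
    have "((\<lambda>s. f (x + s *\<^sub>R ?e)) has_derivative (\<lambda>h. grad f (x + s *\<^sub>R ?e) \<bullet> (h *\<^sub>R ?e))) (at s)" .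
    then show ?thesis
      unfolding has_field_derivative_def
      by (rule has_derivative_eq_rhs) (auto simp: inner_axis mult.commute)
  qed
  define F where "F n x = (f (x + t n *\<^sub>R ?e) - f x) / t n" for n x
  have Fint: "(LINT x|lborel. F n x) = 0" for n
  proof -
    have *: "integrable lborel (\<lambda>x. f (x + t n *\<^sub>R ?e)) \<and> (LINT x|lborel. f (x + t n *\<^sub>R ?e)) = (LINT x|lborel. f x)"
      using integral_distr[of "(+) (t n *\<^sub>R ?e)" lborel borel f]
        integrable_distr_eq[of "(+) (t n *\<^sub>R ?e)" lborel borel f] fi
      by (simp add: lborel_distr_plus add.commute)
    then show ?thesis unfolding F_def using fi by simp
  qed
  have "(\<lambda>n. LINT x|lborel. F n x) \<longlonglongrightarrow> (LINT x|lborel. grad f x $ i)"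
  proof (rule integral_dominated_convergence[where w="\<lambda>x. M * indicator (cball 0 (r + 1)) x"])
    show "integrable lborel (\<lambda>x. M * indicator (cball 0 (r + 1)) (x::real^'n))"
      by (intro integrable_mult_right integrable_bounded_support[where K="cball 0 (r + 1)" and M=1])
         (auto simp: indicator_def)
    show "AE x in lborel. (\<lambda>n. F n x) \<longlonglongrightarrow> grad f x $ i"
    proof (rule AE_I2)
      fix x
      have "((\<lambda>h. (f (x + h *\<^sub>R ?e) - f x) / h) \<longlongrightarrow> grad f x $ i) (at 0)"
        using dt[of x 0] by (simp add: DERIV_def)
      moreover have "filterlim t (at 0) sequentially"
        using t0 t by (auto simp: filterlim_at less_imp_neq[symmetric] intro!: always_eventually)
      ultimately show "(\<lambda>n. F n x) \<longlonglongrightarrow> grad f x $ i"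
        unfolding F_def by (rule filterlim_compose)
    qed
    show "AE x in lborel. norm (F n x) \<le> M * indicator (cball 0 (r + 1)) x" for n
    proof (rule AE_I2)
      fix x
      show "norm (F n x) \<le> M * indicator (cball 0 (r + 1)) x"
      proof (cases "x \<in> cball 0 (r + 1)")
        case True
        obtain z where "f (x + t n *\<^sub>R ?e) - f (x + 0 *\<^sub>R ?e) = (t n - 0) * grad f (x + z *\<^sub>R ?e) $ i"
          using MVT2[of 0 "t n" "\<lambda>s. f (x + s *\<^sub>R ?e)" "\<lambda>s. grad f (x + s *\<^sub>R ?e) $ i"] dt t(1) by blast
        then have "F n x = grad f (x + z *\<^sub>R ?e) $ i" using t(1)[of n] by (simp add: F_def)
        then show ?thesis using M(2) True by simp
      next
        case False
        have "x \<notin> K" using r[of x] False by auto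
        moreover have "x + t n *\<^sub>R ?e \<notin> K"
        proof
          assume "x + t n *\<^sub>R ?e \<in> K"
          then have "norm (x + t n *\<^sub>R ?e) \<le> r" by (rule r)
          moreover have "norm x \<le> norm (x + t n *\<^sub>R ?e) + norm (t n *\<^sub>R ?e)"
            by (metis add_diff_cancel_right' norm_triangle_ineq4)
          moreover have "norm (t n *\<^sub>R ?e) \<le> 1" using t[of n] by simp
          ultimately show False using False by simp
        qed
        ultimately show ?thesis using False by (simp add: F_def f0)
      qed
    qed
  qed (auto simp: F_def)
  with Fint have "(\<lambda>n. 0) \<longlonglongrightarrow> (LINT x|lborel. grad f x $ i)" by simp
  then show ?thesis by (simp add: LIMSEQ_const_iff)
qed

text \<open>The previous lemma, applied to the product of the two functions.\<close>

lemma integral_by_parts_test: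
  fixes \<phi> \<psi> :: "real^'n \<Rightarrow> real"
  assumes "test_function \<Omega> \<phi>" "test_function \<Omega>' \<psi>"
  shows "(LINT x|lborel. \<phi> x * grad \<psi> x $ i) = - (LINT x|lborel. grad \<phi> x $ i * \<psi> x)"
proof -
  obtain K where K: "compact K" "\<And>x. x \<notin> K \<Longrightarrow> \<phi> x = 0" "\<And>x. x \<notin> K \<Longrightarrow> grad \<phi> x = 0"
    "continuous_on UNIV \<phi>" "\<And>x. \<phi> differentiable (at x)" "\<And>i. continuous_on UNIV (\<lambda>x. grad \<phi> x $ i)"
    using test_function_props[OF assms(1)] by metis
  obtain L where L: "continuous_on UNIV \<psi>" "\<And>x. \<psi> differentiable (at x)" "\<And>i. continuous_on UNIV (\<lambda>x. grad \<psi> x $ i)"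
    using test_function_props[OF assms(2)] by metis
  have d: "((\<lambda>x. \<phi> x * \<psi> x) has_derivative
      (\<lambda>h. \<phi> x * (grad \<psi> x \<bullet> h) + (grad \<phi> x \<bullet> h) * \<psi> x)) (at x)" for x
    using K L by (auto intro!: has_derivative_mult has_derivative_grad)
  have g: "grad (\<lambda>x. \<phi> x * \<psi> x) x $ i = \<phi> x * grad \<psi> x $ i + grad \<phi> x $ i * \<psi> x" for x i
    using grad_eqI[OF d] by (simp add: inner_axis)
  have "(LINT x|lborel. grad (\<lambda>x. \<phi> x * \<psi> x) x $ i) = 0"
  proof (rule integral_grad_eq_0[OF _ _ K(1)])
    show "(\<lambda>x. \<phi> x * \<psi> x) differentiable at x" for x using d by (auto simp: differentiable_def)
    show "continuous_on UNIV (\<lambda>x. grad (\<lambda>x. \<phi> x * \<psi> x) x $ i)"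
      unfolding g by (intro continuous_intros K L)
  qed (auto simp: g K)
  moreover have "integrable lborel (\<lambda>x. \<phi> x * grad \<psi> x $ i)" "integrable lborel (\<lambda>x. grad \<phi> x $ i * \<psi> x)"
    by (auto intro!: integrable_continuous_compact_support[OF _ K(1)] continuous_intros K(4-) L simp: K(2,3))
  ultimately show ?thesis by (simp add: g)
qed

text \<open>The product over all coordinates of \<open>exp (- 1 / (n s))\<close>, where \<open>s\<close> runs through the distances to the faces
of the box, increases to 1 inside the box as \<open>n\<close> grows.\<close>

lemma box_bump:
  fixes a b :: "real^'n"
  assumes "cbox a b \<subseteq> \<Omega>"
  obtains \<psi> where "\<And>n. test_function \<Omega> (\<psi> n)" "\<And>n x. x \<notin> cbox a b \<Longrightarrow> \<psi> n x = 0"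
    "\<And>n x. 0 \<le> \<psi> n x" "\<And>n x. \<psi> n x \<le> 1" "\<And>x. (\<lambda>n::nat. \<psi> n x) \<longlonglongrightarrow> indicat_real (box a b) x"
proof
  define \<psi> where "\<psi> n x = (\<Prod>i\<in>UNIV. flat 0 (real n * (x $ i - a $ i)) * flat 0 (real n * (b $ i - x $ i)))"
    for n and x :: "real^'n"
  have out: "\<psi> n x = 0" if x: "x \<notin> box a b" for n x
  proof -
    obtain i where "x $ i \<le> a $ i \<or> b $ i \<le> x $ i" using x by (auto simp: mem_box_cart not_less)
    then have "flat 0 (real n * (x $ i - a $ i)) * flat 0 (real n * (b $ i - x $ i)) = 0"
      by (auto simp: flat_def zero_less_mult_iff)
    then show ?thesis unfolding \<psi>_def by (intro prod_zero) auto
  qed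
  have bnd: "0 \<le> flat 0 s" "flat 0 s \<le> 1" for s by (auto simp: flat_def)
  show 0: "\<psi> n x = 0" if "x \<notin> cbox a b" for n x using out that box_subset_cbox by blast
  show "0 \<le> \<psi> n x" for n x unfolding \<psi>_def by (intro prod_nonneg ballI mult_nonneg_nonneg bnd)
  show "\<psi> n x \<le> 1" for n x unfolding \<psi>_def by (intro prod_le_1 conjI mult_nonneg_nonneg mult_le_one bnd)
  show "test_function \<Omega> (\<psi> n)" for n
  proof (rule elementary_test_function[OF _ _ assms])
    have aff: "elementary (\<lambda>x. real n * (x $ i - c))" "elementary (\<lambda>x. real n * (c - x $ i))" for i c
    proof -
      have "elementary (\<lambda>x. real n * (x $ i + (- c)))" "elementary (\<lambda>x. real n * (c + (-1) * x $ i))"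
        by (intro elementary.intros)+
      then show "elementary (\<lambda>x. real n * (x $ i - c))" "elementary (\<lambda>x. real n * (c - x $ i))" by simp_all
    qed
    show "elementary (\<psi> n)" unfolding \<psi>_def
      by (intro elementary_prod elementary.mult elementary.flat aff) auto
  qed (auto simp: 0)
  have lim: "(\<lambda>n. flat 0 (real n * c)) \<longlonglongrightarrow> 1" if "c > 0" for c
  proof -
    have "(\<lambda>n. exp (- 1 / (real n * c))) \<longlonglongrightarrow> 1" using that by real_asymp
    then show ?thesis
      by (rule Lim_transform_eventually)
         (use that in \<open>auto simp: flat_def eventually_sequentially intro!: exI[of _ 1]\<close>)
  qed
  show "(\<lambda>n. \<psi> n x) \<longlonglongrightarrow> indicat_real (box a b) x" for x
  proof (cases "x \<in> box a b")
    case True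
    then have "(\<lambda>n. \<psi> n x) \<longlonglongrightarrow> (\<Prod>i\<in>(UNIV::'n set). 1 * 1)"
      unfolding \<psi>_def by (intro tendsto_prod tendsto_mult lim) (auto simp: mem_box_cart)
    then show ?thesis using True by simp
  qed (simp add: out)
qed

lemma set_integral_lebesgue_lborel:
  fixes f :: "'a::euclidean_space \<Rightarrow> real"
  assumes "f \<in> borel_measurable borel" "\<And>x. x \<notin> \<Omega> \<Longrightarrow> f x = 0"
  shows "(LINT x:\<Omega>|lebesgue. f x) = (LINT x|lborel. f x)"
proof -
  have "(LINT x:\<Omega>|lebesgue. f x) = (LINT x|lebesgue. f x)"
    unfolding set_lebesgue_integral_def
    by (rule Bochner_Integration.integral_cong) (use assms(2) in \<open>auto simp: indicator_def\<close>)
  then show ?thesis using assms(1) by (simp add: integral_completion)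
qed

lemma id_measurable_lebesgue: "(\<lambda>x::'a::euclidean_space. x) \<in> borel_measurable lebesgue"
  by (rule measurable_completion) simp

text \<open>The fundamental lemma of the calculus of variations: by dominated convergence with the functions of
\<open>box_bump\<close>, the integral of \<open>D\<close> over every box inside \<open>\<Omega>\<close> vanishes. Boxes generate the Borel sets and are
stable under intersection, hence all integrals over Borel subsets of a box vanish, and \<open>D\<close> is 0
almost everywhere.\<close>

context
  notes [measurable] = id_measurable_lebesgue
begin

lemma fundamental_lemma:
  fixes D :: "real^'n \<Rightarrow> real"
  assumes \<Omega>: "open \<Omega>" and Dm[measurable]: "D \<in> borel_measurable lebesgue"
    and Di: "\<And>a b. cbox a b \<subseteq> \<Omega> \<Longrightarrow> set_integrable lebesgue (cbox a b) D"
    and D0: "\<And>\<psi>. test_function \<Omega> \<psi> \<Longrightarrow> (LINT x:\<Omega>|lebesgue. D x * \<psi> x) = 0"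
  shows "AE x in lebesgue. x \<in> \<Omega> \<longrightarrow> D x = 0"
proof -
  have box0: "(LINT x:box a b|lebesgue. D x) = 0" if ab: "cbox a b \<subseteq> \<Omega>" for a b
  proof -
    obtain \<psi> where \<psi>: "\<And>n. test_function \<Omega> (\<psi> n)" "\<And>n x. x \<notin> cbox a b \<Longrightarrow> \<psi> n x = 0"
      "\<And>n x. 0 \<le> \<psi> n x" "\<And>n x. \<psi> n x \<le> 1" "\<And>x. (\<lambda>n::nat. \<psi> n x) \<longlonglongrightarrow> indicat_real (box a b) x"
      using box_bump[OF ab] by metis
    have m[measurable]: "\<psi> n \<in> borel_measurable borel" for n
      using test_function_props[OF \<psi>(1)[of n]] by (metis borel_measurable_continuous_onI)
    have "(\<lambda>n. LINT x|lebesgue. indicator \<Omega> x *\<^sub>R (D x * \<psi> n x)) \<longlonglongrightarrow> (LINT x|lebesgue. indicator (box a b) x *\<^sub>R D x)"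
    proof (rule integral_dominated_convergence[where w="\<lambda>x. \<bar>indicator (cbox a b) x *\<^sub>R D x\<bar>"])
      show "integrable lebesgue (\<lambda>x. \<bar>indicat_real (cbox a b) x *\<^sub>R D x\<bar>)"
        using Di[OF ab] by (auto simp: set_integrable_def)
      have [measurable]: "\<psi> n \<in> borel_measurable lebesgue" for n
        using measurable_completion[of "\<psi> n" lborel borel] m by simp
      have [measurable]: "\<Omega> \<in> sets lebesgue" using \<Omega> by simp
      show "(\<lambda>x. indicator \<Omega> x *\<^sub>R (D x * \<psi> n x)) \<in> borel_measurable lebesgue" for n
        using Dm by measurable
      show "(\<lambda>x. indicat_real (box a b) x *\<^sub>R D x) \<in> borel_measurable lebesgue"
        using Dm by measurable
      show "AE x in lebesgue. (\<lambda>n. indicat_real \<Omega> x *\<^sub>R (D x * \<psi> n x)) \<longlonglongrightarrow> indicat_real (box a b) x *\<^sub>R D x"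
      proof (rule AE_I2)
        fix x
        have "(\<lambda>n. indicat_real \<Omega> x *\<^sub>R (D x * \<psi> n x)) \<longlonglongrightarrow> indicat_real \<Omega> x *\<^sub>R (D x * indicat_real (box a b) x)"
          by (intro tendsto_intros \<psi>(5))
        moreover have "indicat_real \<Omega> x *\<^sub>R (D x * indicat_real (box a b) x) = indicat_real (box a b) x *\<^sub>R D x"
          using ab box_subset_cbox[of a b] by (auto simp: indicator_def)
        ultimately show "(\<lambda>n. indicat_real \<Omega> x *\<^sub>R (D x * \<psi> n x)) \<longlonglongrightarrow> indicat_real (box a b) x *\<^sub>R D x"
          by (simp only:)
      qed
      show "AE x in lebesgue. norm (indicat_real \<Omega> x *\<^sub>R (D x * \<psi> n x)) \<le> \<bar>indicat_real (cbox a b) x *\<^sub>R D x\<bar>" for n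
      proof (rule AE_I2)
        fix x
        show "norm (indicat_real \<Omega> x *\<^sub>R (D x * \<psi> n x)) \<le> \<bar>indicat_real (cbox a b) x *\<^sub>R D x\<bar>"
          using \<psi>(2)[of x n] \<psi>(3,4)[of n x] mult_left_le[of "\<psi> n x" "\<bar>D x\<bar>"]
          by (auto simp: indicator_def abs_mult)
      qed
    qed
    with D0[OF \<psi>(1)] show ?thesis by (simp add: set_lebesgue_integral_def LIMSEQ_const_iff)
  qed
  have box_ae: "AE x in lebesgue. x \<in> box a b \<longrightarrow> D x = 0" if ab: "cbox a b \<subseteq> \<Omega>" for a b
  proof -
    have "(\<lambda>x. indicator (box a b) x *\<^sub>R D x) \<in> borel_measurable lebesgue" using Dm by measurable
    then obtain f where f[measurable]: "f \<in> borel_measurable lborel"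
      and fae: "AE x in lborel. indicator (box a b) x *\<^sub>R D x = f x"
      using completion_ex_borel_measurable_real by blast
    have fae': "AE x in lebesgue. indicator (box a b) x *\<^sub>R D x = f x" using fae by (rule AE_completion)
    have Dbox: "set_integrable lebesgue (box a b) D"
      by (rule set_integrable_subset[OF Di[OF ab]]) (auto simp: box_subset_cbox)
    have mf: "f \<in> borel_measurable lebesgue" by (rule measurable_completion[OF f])
    have "integrable lebesgue f"
      using Dbox fae' mf Dm unfolding set_integrable_def by (subst integrable_cong_AE[symmetric]) auto
    then have fint: "integrable lborel f" using f by (simp add: integrable_completion)
    have fbox: "(LINT x:box c d|lborel. f x) = 0" for c d
    proof -
      have "(LINT x:box c d|lborel. f x) = (LINT x:box c d|lebesgue. f x)"
        unfolding set_lebesgue_integral_def by (subst integral_completion) auto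
      also have "\<dots> = (LINT x:(box c d \<inter> box a b)|lebesgue. D x)"
        unfolding set_lebesgue_integral_def
      proof (rule integral_cong_AE)
        show "(\<lambda>x. indicat_real (box c d) x *\<^sub>R f x) \<in> borel_measurable lebesgue" using mf by measurable
        show "(\<lambda>x. indicat_real (box c d \<inter> box a b) x *\<^sub>R D x) \<in> borel_measurable lebesgue" using Dm by measurable
        show "AE x in lebesgue. indicat_real (box c d) x *\<^sub>R f x = indicat_real (box c d \<inter> box a b) x *\<^sub>R D x"
          using fae' by eventually_elim (auto simp: indicator_def split: if_splits)
      qed
      also have "\<dots> = 0"
      proof (cases "box c d \<inter> box a b = {}")
        case False
        obtain l u where lu: "box c d \<inter> box a b = box l u" by (auto simp: box_Int_box)
        with False have "box l u \<noteq> {}" by simp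
        then have "cbox l u = closure (box l u)" by (simp add: closure_box)
        also have "\<dots> \<subseteq> closure (box a b)" by (rule closure_mono) (use lu in auto)
        also have "\<dots> \<subseteq> cbox a b" by (rule closure_minimal) (auto simp: box_subset_cbox)
        finally show ?thesis using box0[of l u] ab lu by simp
      qed (simp add: set_lebesgue_integral_def)
      finally show ?thesis .
    qed
    have tot: "(LINT x|lborel. f x) = 0"
    proof -
      have "(LINT x|lborel. f x) = (LINT x|lebesgue. f x)" by (simp add: integral_completion)
      also have "\<dots> = (LINT x:box a b|lebesgue. D x)"
        unfolding set_lebesgue_integral_def using fae' Dm mf by (intro integral_cong_AE) auto
      also have "\<dots> = 0" by (rule box0[OF ab])
      finally show ?thesis .
    qed
    have "(LINT x:A|lborel. f x) = 0" if "A \<in> sets borel" for A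
    proof -
      have "Int_stable (range (\<lambda>(a, b). box a b :: (real^'n) set))"
        by (auto simp: Int_stable_def box_Int_box)
      moreover have "(range (\<lambda>(a, b). box a b :: (real^'n) set)) \<subseteq> Pow UNIV" by auto
      moreover have "A \<in> sigma_sets UNIV (range (\<lambda>(a, b). box a b))"
        using that unfolding borel_eq_box by simp
      ultimately show ?thesis
      proof (induction rule: sigma_sets_induct_disjoint)
        case (basic A) then show ?case using fbox by auto
      next
        case empty then show ?case by (simp add: set_lebesgue_integral_def)
      next
        case (compl A)
        then have A: "A \<in> sets lborel" by (simp add: borel_eq_box)
        have "(LINT x:(UNIV - A)|lborel. f x) = (LINT x|lborel. f x - indicator A x *\<^sub>R f x)"
          unfolding set_lebesgue_integral_def
          by (rule Bochner_Integration.integral_cong) (auto simp: indicator_def)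
        also have "\<dots> = 0" using compl.IH fint A tot integrable_mult_indicator[OF A fint]
          by (simp add: set_lebesgue_integral_def)
        finally show ?case .
      next
        case (union A)
        then have A: "A i \<in> sets lborel" for i by (auto simp: borel_eq_box)
        then have "set_integrable lborel (\<Union>i. A i) f"
          unfolding set_integrable_def by (intro integrable_mult_indicator fint) auto
        then have "(LINT x:(\<Union>i. A i)|lborel. f x) = (\<Sum>i. (LINT x:(A i)|lborel. f x))"
          using A union.hyps by (intro lebesgue_integral_countable_add) (auto simp: disjoint_family_on_def)
        then show ?case using union.IH by simp
      qed
    qed
    then have "AE x in lborel. f x = 0"
      by (intro density_unique_real[OF fint]) (auto simp: set_lebesgue_integral_def)
    then have "AE x in lebesgue. f x = 0" by (rule AE_completion)
    with fae' show ?thesis by eventually_elim (auto simp: indicator_def split: if_splits)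
  qed
  have cbox_ae: "AE x in lebesgue. x \<in> cbox a b \<longrightarrow> D x = 0" if ab: "cbox a b \<subseteq> \<Omega>" for a b
  proof -
    have "cbox a b - box a b \<in> null_sets lebesgue"
      using negligible_frontier_interval negligible_iff_null_sets by blast
    from AE_not_in[OF this] box_ae[OF ab] show ?thesis by eventually_elim auto
  qed
  obtain \<D> where \<D>: "countable \<D>" "\<D> \<subseteq> Pow \<Omega>" "\<And>X. X \<in> \<D> \<Longrightarrow> \<exists>a b. X = cbox a b" "\<Union>\<D> = \<Omega>"
    using open_countable_Union_open_cbox[OF \<Omega>] by metis
  have "\<forall>X\<in>\<D>. AE x in lebesgue. x \<in> X \<longrightarrow> D x = 0"
    using \<D>(2,3) cbox_ae by blast
  then have "AE x in lebesgue. \<forall>X\<in>\<D>. x \<in> X \<longrightarrow> D x = 0"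
    by (subst AE_ball_countable[OF \<D>(1)])
  then show ?thesis by eventually_elim (use \<D>(4) in auto)
qed

section \<open>Classes of functions and the Morse index\<close>

lemma rep_abs_L0:
  fixes \<phi> :: "'a::euclidean_space \<Rightarrow> real"
  assumes "\<phi> \<in> borel_measurable lebesgue"
  shows "rep_L0 (abs_L0 \<phi>) \<in> borel_measurable lebesgue"
    "AE x in lebesgue. rep_L0 (abs_L0 \<phi>) x = \<phi> x"
  using Quotient3_rep_abs[OF Quotient3_L0, of \<phi>] assms by auto

text \<open>A square integrable function is integrable on bounded sets, so the fundamental lemma applies to the
components of the difference.\<close>

lemma weak_grad_unique:
  fixes \<Omega> :: "(real^'n) set"
  assumes \<Omega>: "open \<Omega>" and F: "L2_on \<Omega> F" "has_weak_grad \<Omega> \<phi> F"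
    and G: "L2_on \<Omega> G" "has_weak_grad \<Omega> \<phi> G"
  shows "AE x in lebesgue. x \<in> \<Omega> \<longrightarrow> F x = G x"
proof -
  have [measurable]: "F \<in> borel_measurable lebesgue" "G \<in> borel_measurable lebesgue"
    using F G by (auto simp: L2_on_def)
  have comp[measurable]: "(\<lambda>x. F x $ i) \<in> borel_measurable lebesgue" "(\<lambda>x. G x $ i) \<in> borel_measurable lebesgue" for i
    by (rule measurable_compose[of _ lebesgue borel "\<lambda>x. x $ i"],
        simp, intro borel_measurable_continuous_onI continuous_intros)+
  have loc: "set_integrable lebesgue (cbox a b) (\<lambda>x. H x $ i)"
    if H: "L2_on \<Omega> H" and ab: "cbox a b \<subseteq> \<Omega>" and [measurable]: "(\<lambda>x. H x $ i) \<in> borel_measurable lebesgue"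
    for H :: "real^'n \<Rightarrow> real^'n" and a b i
  proof -
    have "set_integrable lebesgue (cbox a b) (\<lambda>x. (norm (H x))\<^sup>2)"
      by (rule set_integrable_subset[of _ \<Omega>]) (use H ab in \<open>auto simp: L2_on_def\<close>)
    moreover have "integrable lebesgue (indicat_real (cbox a b))"
      by (simp add: integrable_completion emeasure_lborel_cbox_eq)
    ultimately have "integrable lebesgue (\<lambda>x. indicat_real (cbox a b) x + indicator (cbox a b) x *\<^sub>R (norm (H x))\<^sup>2)"
      unfolding set_integrable_def by (rule Bochner_Integration.integrable_add[rotated])
    then show ?thesis unfolding set_integrable_def
    proof (rule Bochner_Integration.integrable_bound)
      have "\<bar>H x $ i\<bar> \<le> 1 + (norm (H x))\<^sup>2" for x
      proof -
        have "\<bar>H x $ i\<bar> \<le> norm (H x)" by (rule component_le_norm_cart)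
        also have "\<dots> \<le> 1 + (norm (H x))\<^sup>2"
          using sum_squares_bound[of 1 "norm (H x)"] norm_ge_zero[of "H x"] unfolding one_power2 by linarith
        finally show ?thesis .
      qed
      then show "AE x in lebesgue. norm (indicat_real (cbox a b) x *\<^sub>R H x $ i)
          \<le> norm (indicat_real (cbox a b) x + indicator (cbox a b) x *\<^sub>R (norm (H x))\<^sup>2)"
        by (intro AE_I2) (auto simp: indicator_def)
    qed measurable
  qed
  have "AE x in lebesgue. x \<in> \<Omega> \<longrightarrow> F x $ i - G x $ i = 0" for i
  proof (rule fundamental_lemma[OF \<Omega>])
    show "(\<lambda>x. F x $ i - G x $ i) \<in> borel_measurable lebesgue" by measurable
    show "set_integrable lebesgue (cbox a b) (\<lambda>x. F x $ i - G x $ i)" if "cbox a b \<subseteq> \<Omega>" for a b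
      using loc[OF F(1) that comp(1)] loc[OF G(1) that comp(2)] by (rule set_integral_diff)
    fix \<psi> assume \<psi>: "test_function \<Omega> \<psi>"
    obtain K where K: "compact K" "K \<subseteq> \<Omega>" "\<And>x. x \<notin> K \<Longrightarrow> \<psi> x = 0" "continuous_on UNIV \<psi>"
      using test_function_props[OF \<psi>] by metis
    have [measurable]: "\<psi> \<in> borel_measurable lebesgue"
      by (rule measurable_completion) (use K(4) in \<open>simp add: borel_measurable_continuous_onI\<close>)
    obtain M where M: "0 < M" "\<And>x. \<bar>\<psi> x\<bar> \<le> M" using continuous_compact_support_bounded[OF K(4,1,3)] by metis
    have int: "set_integrable lebesgue \<Omega> (\<lambda>x. H x $ i * \<psi> x)"
      if H: "L2_on \<Omega> H" and [measurable]: "(\<lambda>x. H x $ i) \<in> borel_measurable lebesgue"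
      for H :: "real^'n \<Rightarrow> real^'n"
    proof -
      have "continuous_on UNIV (\<lambda>x. (\<psi> x)\<^sup>2)" by (intro continuous_intros K(4))
      from integrable_continuous_compact_support[OF this K(1)] K(3)
      have "integrable lborel (\<lambda>x. (\<psi> x)\<^sup>2)" by auto
      then have "integrable lebesgue (\<lambda>x. (\<psi> x)\<^sup>2)"
        by (subst integrable_completion) auto
      moreover have "integrable lebesgue (\<lambda>x. indicator \<Omega> x *\<^sub>R (norm (H x))\<^sup>2)"
        using H by (simp add: L2_on_def set_integrable_def)
      ultimately have "integrable lebesgue (\<lambda>x. (\<psi> x)\<^sup>2 + indicator \<Omega> x *\<^sub>R (norm (H x))\<^sup>2)"
        by (rule Bochner_Integration.integrable_add)
      then show ?thesis unfolding set_integrable_def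
      proof (rule Bochner_Integration.integrable_bound)
        have "\<bar>H x $ i * \<psi> x\<bar> \<le> (\<psi> x)\<^sup>2 + (norm (H x))\<^sup>2" for x
        proof -
          have "\<bar>H x $ i * \<psi> x\<bar> \<le> norm (H x) * \<bar>\<psi> x\<bar>"
            unfolding abs_mult by (intro mult_right_mono component_le_norm_cart) auto
          also have "\<dots> \<le> 2 * (norm (H x) * \<bar>\<psi> x\<bar>)" by simp
          also have "\<dots> \<le> (norm (H x))\<^sup>2 + (\<psi> x)\<^sup>2"
            using sum_squares_bound[of "norm (H x)" "\<bar>\<psi> x\<bar>"] by simp
          finally show ?thesis by simp
        qed
        then show "AE x in lebesgue. norm (indicat_real \<Omega> x *\<^sub>R (H x $ i * \<psi> x))
          \<le> norm ((\<psi> x)\<^sup>2 + indicator \<Omega> x *\<^sub>R (norm (H x))\<^sup>2)"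
          by (intro AE_I2) (auto simp: indicator_def)
        have [measurable]: "\<Omega> \<in> sets lebesgue" using \<Omega> by simp
        show "(\<lambda>x. indicat_real \<Omega> x *\<^sub>R (H x $ i * \<psi> x)) \<in> borel_measurable lebesgue" by measurable
      qed
    qed
    have "(LINT x:\<Omega>|lebesgue. (F x $ i - G x $ i) * \<psi> x) =
        (LINT x:\<Omega>|lebesgue. F x $ i * \<psi> x) - (LINT x:\<Omega>|lebesgue. G x $ i * \<psi> x)"
      using set_integral_diff(2)[OF int[OF F(1) comp(1)] int[OF G(1) comp(2)]]
      by (simp add: left_diff_distrib)
    also have "\<dots> = 0"
    proof -
      have "(LINT x:\<Omega>|lebesgue. \<phi> x * grad \<psi> x $ i) = - (LINT x:\<Omega>|lebesgue. F x $ i * \<psi> x)"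
        "(LINT x:\<Omega>|lebesgue. \<phi> x * grad \<psi> x $ i) = - (LINT x:\<Omega>|lebesgue. G x $ i * \<psi> x)"
        using F(2) G(2) \<psi> unfolding has_weak_grad_def by blast+
      then show ?thesis by linarith
    qed
    finally show "(LINT x:\<Omega>|lebesgue. (F x $ i - G x $ i) * \<psi> x) = 0" .
  qed
  then have "AE x in lebesgue. \<forall>i\<in>UNIV. x \<in> \<Omega> \<longrightarrow> F x $ i - G x $ i = 0"
    by (intro AE_finite_allI) auto
  then show ?thesis by eventually_elim (auto simp: vec_eq_iff)
qed

text \<open>The definition of \<open>weak_grad\<close> selects some weak gradient. By uniqueness the selected one agrees almost
everywhere with the classical gradient, so on classes of test functions all integrals are classical.
Membership in \<open>H10\<close> is immediate, since a test function approximates itself.\<close>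

lemma test_function_L0:
  fixes \<Omega> :: "(real^'n) set"
  assumes \<Omega>: "open \<Omega>" and \<phi>: "test_function \<Omega> \<phi>"
  shows test_function_H10: "abs_L0 \<phi> \<in> H10 \<Omega>"
    and weak_grad_test_function:
      "(LINT x:\<Omega>|lebesgue. (norm (weak_grad \<Omega> (rep_L0 (abs_L0 \<phi>)) x))\<^sup>2) = (LINT x|lborel. (norm (grad \<phi> x))\<^sup>2)"
proof -
  define \<rho> where "\<rho> = rep_L0 (abs_L0 \<phi>)"
  obtain K where K: "compact K" "K \<subseteq> \<Omega>" "\<And>x. x \<notin> K \<Longrightarrow> \<phi> x = 0" "\<And>x. x \<notin> K \<Longrightarrow> grad \<phi> x = 0"
    "continuous_on UNIV \<phi>" "\<And>i. continuous_on UNIV (\<lambda>x. grad \<phi> x $ i)"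
    using test_function_props[OF \<phi>] by metis
  have cg: "continuous_on UNIV (grad \<phi>)"
    using K(6) continuous_on_vec_lambda[of UNIV "\<lambda>i x. grad \<phi> x $ i"] by (simp add: vec_nth_inverse)
  have b\<phi>: "\<phi> \<in> borel_measurable borel" "grad \<phi> \<in> borel_measurable borel"
    using K(5) cg by (auto intro: borel_measurable_continuous_onI)
  have m\<phi>[measurable]: "\<phi> \<in> borel_measurable lebesgue" "grad \<phi> \<in> borel_measurable lebesgue"
    by (rule measurable_completion, use b\<phi> in simp)+
  have \<rho>: "\<rho> \<in> borel_measurable lebesgue" and ae: "AE x in lebesgue. \<rho> x = \<phi> x"
    using rep_abs_L0[OF m\<phi>(1)] by (auto simp: \<rho>_def)
  note [measurable] = \<rho>
  have [measurable]: "\<Omega> \<in> sets lebesgue" using \<Omega> by simp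
  have int: "integrable lebesgue (\<lambda>x. (\<phi> x)\<^sup>2)" "integrable lebesgue (\<lambda>x. (norm (grad \<phi> x))\<^sup>2)"
  proof -
    have "integrable lborel (\<lambda>x. (\<phi> x)\<^sup>2)" "integrable lborel (\<lambda>x. (norm (grad \<phi> x))\<^sup>2)"
      using K by (auto intro!: integrable_continuous_compact_support[OF _ K(1)] continuous_intros cg)
    then show "integrable lebesgue (\<lambda>x. (\<phi> x)\<^sup>2)" "integrable lebesgue (\<lambda>x. (norm (grad \<phi> x))\<^sup>2)"
      using b\<phi> by (auto simp: integrable_completion)
  qed
  have L2: "L2_on \<Omega> \<phi>" "L2_on \<Omega> (grad \<phi>)"
    unfolding L2_on_def set_integrable_def
    using integrable_mult_indicator[OF \<open>\<Omega> \<in> sets lebesgue\<close> int(1)]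
      integrable_mult_indicator[OF \<open>\<Omega> \<in> sets lebesgue\<close> int(2)] m\<phi> by simp_all
  have L2\<rho>: "L2_on \<Omega> \<rho>"
  proof -
    have "integrable lebesgue (\<lambda>x. indicator \<Omega> x *\<^sub>R (norm (\<phi> x))\<^sup>2)"
      using L2(1) by (simp add: L2_on_def set_integrable_def)
    then have "integrable lebesgue (\<lambda>x. indicator \<Omega> x *\<^sub>R (norm (\<rho> x))\<^sup>2)"
      by (rule integrable_cong_AE_imp) (use ae in auto)
    then show ?thesis by (simp add: L2_on_def set_integrable_def \<rho>)
  qed
  have wg: "has_weak_grad \<Omega> \<rho> (grad \<phi>)"
    unfolding has_weak_grad_def
  proof (intro allI impI)
    fix \<psi> i assume \<psi>: "test_function \<Omega> \<psi>"
    obtain L where L: "continuous_on UNIV \<psi>" "\<And>i. continuous_on UNIV (\<lambda>x. grad \<psi> x $ i)"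
      using test_function_props[OF \<psi>] by metis
    have b\<psi>[measurable]: "\<psi> \<in> borel_measurable borel" "(\<lambda>x. grad \<psi> x $ i) \<in> borel_measurable borel"
      using L by (auto intro: borel_measurable_continuous_onI)
    have [measurable]: "(\<lambda>x. grad \<psi> x $ i) \<in> borel_measurable lebesgue"
      by (rule measurable_completion) (use b\<psi>(2) in simp)
    have bg[measurable]: "(\<lambda>x. grad \<phi> x $ i) \<in> borel_measurable borel"
      using K by (auto intro: borel_measurable_continuous_onI)
    note b\<phi>[measurable]
    have "(LINT x:\<Omega>|lebesgue. \<rho> x * grad \<psi> x $ i) = (LINT x:\<Omega>|lebesgue. \<phi> x * grad \<psi> x $ i)"
      unfolding set_lebesgue_integral_def using ae by (intro integral_cong_AE) auto
    also have "\<dots> = (LINT x|lborel. \<phi> x * grad \<psi> x $ i)"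
      using K(2,3) by (intro set_integral_lebesgue_lborel) auto
    also have "\<dots> = - (LINT x|lborel. grad \<phi> x $ i * \<psi> x)" by (rule integral_by_parts_test[OF \<phi> \<psi>])
    also have "(LINT x|lborel. grad \<phi> x $ i * \<psi> x) = (LINT x:\<Omega>|lebesgue. grad \<phi> x $ i * \<psi> x)"
    proof (rule set_integral_lebesgue_lborel[symmetric])
      show "grad \<phi> x $ i * \<psi> x = 0" if "x \<notin> \<Omega>" for x
      proof -
        have "x \<notin> K" using that K(2) by blast
        then show ?thesis by (simp add: K(4))
      qed
    qed measurable
    finally show "(LINT x:\<Omega>|lebesgue. \<rho> x * grad \<psi> x $ i) = - (LINT x:\<Omega>|lebesgue. grad \<phi> x $ i * \<psi> x)" .
  qed
  have ex: "\<exists>G. L2_on \<Omega> G \<and> has_weak_grad \<Omega> \<rho> G" using wg L2(2) by blast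
  have W: "L2_on \<Omega> (weak_grad \<Omega> \<rho>)" "has_weak_grad \<Omega> \<rho> (weak_grad \<Omega> \<rho>)"
    using someI_ex[OF ex] unfolding weak_grad_def by auto
  have Wae: "AE x in lebesgue. x \<in> \<Omega> \<longrightarrow> weak_grad \<Omega> \<rho> x = grad \<phi> x"
    by (rule weak_grad_unique[OF \<Omega> W L2(2) wg])
  have Wm[measurable]: "weak_grad \<Omega> \<rho> \<in> borel_measurable lebesgue" using W by (simp add: L2_on_def)
  have "(LINT x:\<Omega>|lebesgue. (norm (weak_grad \<Omega> \<rho> x))\<^sup>2) = (LINT x:\<Omega>|lebesgue. (norm (grad \<phi> x))\<^sup>2)"
    unfolding set_lebesgue_integral_def using Wae by (intro integral_cong_AE) (auto simp: indicator_def)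
  also have "\<dots> = (LINT x|lborel. (norm (grad \<phi> x))\<^sup>2)"
  proof (rule set_integral_lebesgue_lborel)
    show "(norm (grad \<phi> x))\<^sup>2 = 0" if "x \<notin> \<Omega>" for x
      using that K(2) K(4)[of x] by auto
  qed (use b\<phi> in measurable)
  finally show "(LINT x:\<Omega>|lebesgue. (norm (weak_grad \<Omega> (rep_L0 (abs_L0 \<phi>)) x))\<^sup>2) = (LINT x|lborel. (norm (grad \<phi> x))\<^sup>2)"
    unfolding \<rho>_def .
  have z1: "(LINT x:\<Omega>|lebesgue. (\<rho> x - \<phi> x)\<^sup>2) = 0"
    unfolding set_lebesgue_integral_def using ae by (intro integral_eq_zero_AE) auto
  have z2: "(LINT x:\<Omega>|lebesgue. (norm (weak_grad \<Omega> \<rho> x - grad \<phi> x))\<^sup>2) = 0"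
    unfolding set_lebesgue_integral_def using Wae by (intro integral_eq_zero_AE) (auto simp: indicator_def)
  have "AE x in lebesgue. x \<notin> \<Omega> \<longrightarrow> \<rho> x = 0"
    using ae by eventually_elim (use K(2,3) in auto)
  then show "abs_L0 \<phi> \<in> H10 \<Omega>"
    using L2\<rho> ex \<phi> z1 z2 unfolding H10_def H1_on_def Let_def mem_Collect_eq \<rho>_def[symmetric]
    by (auto intro!: exI[of _ \<phi>])
qed

end

lemma set_integral_rep_abs_L0:
  fixes \<Omega> :: "'a::euclidean_space set" and c :: "'a \<Rightarrow> real"
  assumes "(\<lambda>x. indicator \<Omega> x * c x) \<in> borel_measurable lebesgue" "\<phi> \<in> borel_measurable lebesgue"
  shows "(LINT x:\<Omega>|lebesgue. c x * (rep_L0 (abs_L0 \<phi>) x)\<^sup>2) = (LINT x:\<Omega>|lebesgue. c x * (\<phi> x)\<^sup>2)"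
proof -
  note [measurable] = assms rep_abs_L0(1)[OF assms(2)]
  have "(LINT x|lebesgue. (indicator \<Omega> x * c x) * (rep_L0 (abs_L0 \<phi>) x)\<^sup>2) = (LINT x|lebesgue. (indicator \<Omega> x * c x) * (\<phi> x)\<^sup>2)"
    using rep_abs_L0(2)[OF assms(2)] by (intro integral_cong_AE) auto
  then show ?thesis by (simp add: set_lebesgue_integral_def mult.assoc)
qed

lemma abs_L0_sum:
  fixes \<phi> :: "'i \<Rightarrow> 'a::euclidean_space \<Rightarrow> real"
  assumes "finite I" "\<And>i. i \<in> I \<Longrightarrow> \<phi> i \<in> borel_measurable lebesgue"
  shows "(\<Sum>i\<in>I. c i *\<^sub>R abs_L0 (\<phi> i)) = abs_L0 (\<lambda>x. \<Sum>i\<in>I. c i * \<phi> i x)"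
  using assms
proof (induction I rule: finite_induct)
  case empty
  then show ?case by (simp add: zero_L0_def)
next
  case (insert i I)
  have "c i *\<^sub>R abs_L0 (\<phi> i) = abs_L0 (\<lambda>x. c i * \<phi> i x)"
    by (rule scaleR_L0.abs_eq) (use insert in auto)
  moreover have "abs_L0 (\<lambda>x. c i * \<phi> i x) + abs_L0 (\<lambda>x. \<Sum>i\<in>I. c i * \<phi> i x) = abs_L0 (\<lambda>x. c i * \<phi> i x + (\<Sum>i\<in>I. c i * \<phi> i x))"
    by (rule plus_L0.abs_eq) (use insert in auto)
  ultimately show ?case using insert by simp
qed

text \<open>Negativity of the form on all nontrivial combinations also yields linear independence of the
classes: a combination that is almost everywhere 0 has second variation 0.\<close>

lemma morse_index_ge:
  fixes \<Omega> :: "(real^'n) set" and \<phi> :: "'i \<Rightarrow> real^'n \<Rightarrow> real"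
  assumes I: "finite I" and T: "\<And>c. test_function \<Omega> (\<lambda>x. \<Sum>i\<in>I. c i * \<phi> i x)"
    and Ti: "\<And>i. i \<in> I \<Longrightarrow> test_function \<Omega> (\<phi> i)" and \<Omega>: "open \<Omega>"
    and neg: "\<And>c. (\<exists>i\<in>I. c i \<noteq> 0) \<Longrightarrow> second_variation \<Omega> a f u (abs_L0 (\<lambda>x. \<Sum>i\<in>I. c i * \<phi> i x)) < 0"
  shows "enat (card I) \<le> morse_index \<Omega> a f u"
proof -
  have m: "\<phi> i \<in> borel_measurable lebesgue" if "i \<in> I" for i
  proof -
    have "continuous_on UNIV (\<phi> i)" using test_function_props[OF Ti[OF that]] by metis
    then show ?thesis by (intro measurable_completion) (simp add: borel_measurable_continuous_onI)
  qed
  define b where "b i = abs_L0 (\<phi> i)" for i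
  have comb: "(\<Sum>i\<in>I. c i *\<^sub>R b i) = abs_L0 (\<lambda>x. \<Sum>i\<in>I. c i * \<phi> i x)" for c
    unfolding b_def by (rule abs_L0_sum[OF I m])
  have T0: "test_function \<Omega> (\<lambda>x::real^'n. 0::real)" using T[of "\<lambda>_. 0"] by simp
  have g0: "grad (\<lambda>x::real^'n. 0::real) = (\<lambda>x. 0)"
  proof
    fix x :: "real^'n"
    have "((\<lambda>x::real^'n. 0::real) has_derivative (\<lambda>_. 0)) (at x)" by simp
    from grad_eqI[OF this] show "grad (\<lambda>x::real^'n. 0::real) x = 0" by (simp add: vec_eq_iff)
  qed
  have sv0: "second_variation \<Omega> a f u (abs_L0 (\<lambda>x. 0)) = 0"
  proof -
    have ae: "AE x in lebesgue. rep_L0 (abs_L0 (\<lambda>x::real^'n. 0::real)) x = 0"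
      using rep_abs_L0(2)[of "\<lambda>x::real^'n. 0::real"] by simp
    have "(LINT x:\<Omega>|lebesgue. C x * (rep_L0 (abs_L0 (\<lambda>x::real^'n. 0::real)) x)\<^sup>2) = 0" for C
      unfolding set_lebesgue_integral_def
      by (rule integral_eq_zero_AE) (use ae in auto)
    then show ?thesis
      by (simp add: second_variation_def Let_def weak_grad_test_function[OF \<Omega> T0] g0)
  qed
  have nz: "c i = 0" if c: "(\<Sum>i\<in>I. c i *\<^sub>R b i) = 0" and i: "i \<in> I" for c i
  proof (rule ccontr)
    assume "c i \<noteq> 0"
    then have "second_variation \<Omega> a f u (\<Sum>i\<in>I. c i *\<^sub>R b i) < 0" using neg[of c] i unfolding comb by blast
    moreover have "(0::(real^'n) L0) = abs_L0 (\<lambda>x. 0)" by (simp add: zero_L0_def)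
    ultimately show False using c sv0 by simp
  qed
  have inj: "inj_on b I"
  proof (rule inj_onI, rule ccontr)
    fix i j assume ij: "i \<in> I" "j \<in> I" "b i = b j" "i \<noteq> j"
    define c where "c l = (if l = i then 1 else 0) - (if l = j then 1 else (0::real))" for l
    have "(\<Sum>l\<in>I. c l *\<^sub>R b l) = b i - b j"
      using ij I by (simp add: c_def scaleR_left_diff_distrib sum_subtractf if_distrib[of "\<lambda>r. r *\<^sub>R _"] cong: if_cong)
    then have "c i = 0" using nz[of c i] ij by simp
    then show False using ij by (simp add: c_def)
  qed
  have indep: "independent (b ` I)"
  proof (rule independent_if_scalars_zero)
    show "finite (b ` I)" using I by simp
    fix h x assume h: "(\<Sum>x\<in>b ` I. h x *\<^sub>R x) = 0" and "x \<in> b ` I"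
    then obtain i where i: "i \<in> I" "x = b i" by auto
    have "(\<Sum>i\<in>I. h (b i) *\<^sub>R b i) = 0" using h by (simp add: sum.reindex[OF inj])
    from nz[OF this i(1)] i show "h x = 0" by simp
  qed
  define V where "V = span (b ` I)"
  have Vc: "\<exists>c. w = (\<Sum>i\<in>I. c i *\<^sub>R b i)" if w: "w \<in> V" for w
  proof -
    obtain h where "w = (\<Sum>x\<in>b ` I. h x *\<^sub>R x)" using w I unfolding V_def by (auto simp: span_finite)
    then have "w = (\<Sum>i\<in>I. h (b i) *\<^sub>R b i)" by (simp add: sum.reindex[OF inj])
    then show ?thesis by (intro exI[of _ "\<lambda>i. h (b i)"])
  qed
  have "edim V = enat (card I)"
  proof -
    have "dim V = card I"
      using dim_span_eq_card_independent[OF indep] card_image[OF inj] by (simp add: V_def)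
    moreover have "finite (b ` I)" "V \<subseteq> span (b ` I)" using I by (auto simp: V_def)
    ultimately show ?thesis unfolding edim_def by metis
  qed
  moreover have "subspace V" unfolding V_def by (rule subspace_span)
  moreover have "V \<subseteq> H10 \<Omega>"
  proof
    fix w assume "w \<in> V"
    from Vc[OF this] obtain c where "w = (\<Sum>i\<in>I. c i *\<^sub>R b i)" ..
    then show "w \<in> H10 \<Omega>" unfolding comb using test_function_H10[OF \<Omega> T] by simp
  qed
  moreover have "second_variation \<Omega> a f u w < 0" if "w \<in> V" "w \<noteq> 0" for w
  proof -
    from Vc[OF \<open>w \<in> V\<close>] obtain c where c: "w = (\<Sum>i\<in>I. c i *\<^sub>R b i)" ..
    have "\<exists>i\<in>I. c i \<noteq> 0"
    proof (rule ccontr)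
      assume "\<not> ?thesis"
      then have "w = 0" using c by simp
      with \<open>w \<noteq> 0\<close> show False by simp
    qed
    from neg[OF this] c comb show ?thesis by simp
  qed
  ultimately show ?thesis unfolding morse_index_def by (intro Sup_upper) (auto intro!: exI[of _ V])
qed

section \<open>Integration in the radial variable\<close>

text \<open>The area of the sphere of radius \<open>r\<close> in dimension \<open>N\<close>.\<close>

definition radial_weight :: "nat \<Rightarrow> real \<Rightarrow> real" where
  "radial_weight N r = (if 0 < r then unit_ball_vol (real N) * real N * r ^ (N - 1) else 0)"

lemma radial_weight_nonneg: "0 \<le> radial_weight N r"
  by (auto simp: radial_weight_def intro!: mult_nonneg_nonneg)

lemma radial_weight_measurable[measurable]: "radial_weight N \<in> borel_measurable borel"
  unfolding radial_weight_def[abs_def] by measurable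

text \<open>The half-lines up to \<open>a\<close> generate the Borel sets, and on them both measures equal the volume of the
ball of radius \<open>a\<close>.\<close>

lemma distr_norm_lborel:
  "distr lborel borel (norm :: 'a::euclidean_space \<Rightarrow> real) =
     density lborel (\<lambda>r. ennreal (radial_weight DIM('a) r))" (is "?M = ?D")
proof (rule measure_eqI_generator_eq[where E="range (\<lambda>a. {..a})" and \<Omega>=UNIV and A="\<lambda>n. {..real n}"])
  let ?N = "DIM('a)"
  have N: "?N > 0" by simp
  have M: "emeasure ?M {..a} = (if a < 0 then 0 else ennreal (unit_ball_vol ?N * a ^ ?N))" for a
  proof -
    have "emeasure ?M {..a} = emeasure lborel (cball (0::'a) a)"
      by (subst emeasure_distr) (auto intro!: arg_cong2[where f=emeasure])
    then show ?thesis by (auto simp: emeasure_cball)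
  qed
  have D: "emeasure ?D {..a} = (if a < 0 then 0 else ennreal (unit_ball_vol ?N * a ^ ?N))" for a
  proof (cases "a < 0")
    case True
    have "emeasure ?D {..a} = (\<integral>\<^sup>+r. ennreal (radial_weight ?N r) * indicator {..a} r \<partial>lborel)"
      by (rule emeasure_density) auto
    also have "\<dots> = (\<integral>\<^sup>+r. 0 \<partial>(lborel::real measure))"
      by (rule nn_integral_cong) (use True in \<open>auto simp: radial_weight_def indicator_def\<close>)
    finally show ?thesis using True by simp
  next
    case False
    let ?f = "\<lambda>r::real. unit_ball_vol ?N * ?N * r ^ (?N - 1)"
    have "emeasure ?D {..a} = (\<integral>\<^sup>+r. ennreal (radial_weight ?N r) * indicator {..a} r \<partial>lborel)"
      by (rule emeasure_density) auto
    also have "\<dots> = (\<integral>\<^sup>+r. ennreal (?f r) * indicator {0..a} r \<partial>lborel)"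
    proof (rule nn_integral_cong_AE)
      have "AE r in lborel. r \<noteq> (0::real)" by (rule AE_lborel_singleton)
      then show "AE r in lborel. ennreal (radial_weight ?N r) * indicator {..a} r = ennreal (?f r) * indicator {0..a} r"
        by eventually_elim (auto simp: radial_weight_def indicator_def)
    qed
    also have "\<dots> = ennreal (unit_ball_vol ?N * a ^ ?N - unit_ball_vol ?N * 0 ^ ?N)"
    proof (rule nn_integral_FTC_Icc)
      show "((\<lambda>r. unit_ball_vol ?N * r ^ ?N) has_real_derivative ?f r) (at r)" for r
        by (auto intro!: derivative_eq_intros)
    qed (use False in \<open>auto intro!: mult_nonneg_nonneg\<close>)
    also have "\<dots> = ennreal (unit_ball_vol ?N * a ^ ?N)" by (simp add: zero_power[OF N])
    finally show ?thesis using False by simp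
  qed
  show "emeasure ?M X = emeasure ?D X" if "X \<in> range (\<lambda>a. {..a})" for X
    using that M D by auto
  show "Int_stable (range (\<lambda>a::real. {..a}))" by (auto simp: Int_stable_def)
  show "sets ?M = sigma_sets UNIV (range (\<lambda>a. {..a}))" "sets ?D = sigma_sets UNIV (range (\<lambda>a. {..a}))"
    by (simp_all add: borel_eq_atMost)
  show "(\<Union>n. {..real n}) = UNIV" using real_arch_simple by auto
  show "emeasure ?M {..real n} \<noteq> \<infinity>" for n by (simp add: M)
qed auto

lemma
  fixes F :: "real \<Rightarrow> real"
  assumes [measurable]: "F \<in> borel_measurable borel"
  shows integrable_radial: "integrable lborel (\<lambda>x::'a::euclidean_space. F (norm x))
      \<longleftrightarrow> integrable lborel (\<lambda>r. radial_weight DIM('a) r * F r)"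
    and integral_radial: "(LINT x|lborel. F (norm (x::'a))) = (LINT r|lborel. radial_weight DIM('a) r * F r)"
proof -
  have "integrable lborel (\<lambda>x::'a. F (norm x)) \<longleftrightarrow> integrable (distr lborel borel (norm::'a \<Rightarrow> real)) F"
    by (rule integrable_distr_eq[symmetric]) auto
  also have "\<dots> \<longleftrightarrow> integrable lborel (\<lambda>r. radial_weight DIM('a) r * F r)"
    unfolding distr_norm_lborel by (subst integrable_density) (auto simp: radial_weight_nonneg)
  finally show "integrable lborel (\<lambda>x::'a. F (norm x)) \<longleftrightarrow> integrable lborel (\<lambda>r. radial_weight DIM('a) r * F r)" .
  have "(LINT x|lborel. F (norm (x::'a))) = integral\<^sup>L (distr lborel borel (norm::'a \<Rightarrow> real)) F"
    by (rule integral_distr[symmetric]) auto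
  also have "\<dots> = (LINT r|lborel. radial_weight DIM('a) r * F r)"
    unfolding distr_norm_lborel by (subst integral_density) (auto simp: radial_weight_nonneg)
  finally show "(LINT x|lborel. F (norm (x::'a))) = (LINT r|lborel. radial_weight DIM('a) r * F r)" .
qed

text \<open>Invariance of Lebesgue measure under changes of the sign of one coordinate and under exchange of two
coordinates is all the rotational symmetry that is required: it makes integrals of \<open>x $ i\<close> and
\<open>x $ i * x $ j\<close> against radial functions vanish and those of \<open>(x $ i)\<^sup>2\<close> independent of \<open>i\<close>.\<close>

definition reflect :: "'n \<Rightarrow> real^'n \<Rightarrow> real^'n" where
  "reflect i x = (\<chi> k. (if k = i then -1 else 1) * x $ k)"

definition swap_coords :: "'n \<Rightarrow> 'n \<Rightarrow> real^'n \<Rightarrow> real^'n" where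
  "swap_coords i j x = (\<chi> k. x $ Transposition.transpose i j k)"

lemma norm_reflect: "norm (reflect i x) = norm x"
proof -
  have "((if k = i then -1 else 1) * x $ k)\<^sup>2 = (x $ k)\<^sup>2" for k by auto
  then show ?thesis by (simp add: norm_vec_def L2_set_def reflect_def)
qed

lemma norm_swap: "norm (swap_coords i j x) = norm x"
proof -
  have "(\<Sum>k\<in>UNIV. (x $ Transposition.transpose i j k)\<^sup>2) = (\<Sum>k\<in>UNIV. (x $ k)\<^sup>2)"
    by (rule sum.reindex_bij_betw[of _ _ _ "\<lambda>k. (x $ k)\<^sup>2"]) simp
  then show ?thesis by (simp add: norm_vec_def L2_set_def swap_coords_def)
qed

lemma prod_Basis_cart: "(\<Prod>b\<in>(Basis::(real^'n) set). F (x \<bullet> b)) = (\<Prod>i\<in>UNIV. F (x $ i))"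
proof -
  have B: "(Basis::(real^'n) set) = range (\<lambda>i. axis i 1)" by (auto simp: Basis_vec_def)
  have "inj (\<lambda>i::'n. axis i (1::real))" by (auto simp: inj_def axis_eq_axis)
  then show ?thesis by (simp add: B prod.reindex inner_axis)
qed

lemma lborel_cart_eqI:
  fixes T :: "real^'n \<Rightarrow> real^'n" and U :: "real^'n \<Rightarrow> real^'n \<Rightarrow> (real^'n) \<times> (real^'n)"
  assumes T[measurable]: "T \<in> borel_measurable borel"
    and v: "\<And>l u. (\<And>i. l $ i \<le> u $ i) \<Longrightarrow> \<exists>l' u'. (\<forall>i. l' $ i \<le> u' $ i) \<and> T -` box l u = box l' u' \<and>
              (\<Prod>i\<in>UNIV. (u' - l') $ i) = (\<Prod>i\<in>UNIV. (u - l) $ i)"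
  shows "distr lborel borel T = lborel"
proof (rule lborel_eqI[symmetric])
  fix l u :: "real^'n" assume le: "\<And>b. b \<in> Basis \<Longrightarrow> l \<bullet> b \<le> u \<bullet> b"
  have "l $ i \<le> u $ i" for i using le[of "axis i 1"] by (simp add: inner_axis axis_in_Basis_iff)
  from v[OF this] obtain l' u' where h: "\<And>i. l' $ i \<le> u' $ i" "T -` box l u = box l' u'"
    "(\<Prod>i\<in>UNIV. (u' - l') $ i) = (\<Prod>i\<in>UNIV. (u - l) $ i)" by metis
  have le': "l' \<bullet> b \<le> u' \<bullet> b" if "b \<in> Basis" for b
    using that h(1) by (auto simp: Basis_vec_def inner_axis)
  have "emeasure (distr lborel borel T) (box l u) = emeasure lborel (box l' u')"
    using h(2) by (subst emeasure_distr) auto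
  also have "\<dots> = (\<Prod>b\<in>Basis. (u' - l') \<bullet> b)" by (rule emeasure_lborel_box[OF le'])
  also have "\<dots> = (\<Prod>b\<in>Basis. (u - l) \<bullet> b)"
    using h(3) prod_Basis_cart[of "\<lambda>t. t" "u' - l'"] prod_Basis_cart[of "\<lambda>t. t" "u - l"] by simp
  finally show "emeasure (distr lborel borel T) (box l u) = (\<Prod>b\<in>Basis. (u - l) \<bullet> b)" .
qed simp

lemma reflect_measurable[measurable]: "reflect i \<in> borel_measurable borel"
  by (rule borel_measurable_continuous_onI)
     (auto simp: reflect_def[abs_def] intro!: continuous_intros)

lemma swap_measurable[measurable]: "swap_coords i j \<in> borel_measurable borel"
  by (rule borel_measurable_continuous_onI)
     (auto simp: swap_coords_def[abs_def] intro!: continuous_intros)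

lemma lborel_reflect: "distr lborel borel (reflect i) = (lborel :: (real^'n) measure)"
proof (rule lborel_cart_eqI[OF reflect_measurable])
  fix l u :: "real^'n" assume le: "\<And>i. l $ i \<le> u $ i"
  let ?l = "\<chi> k. if k = i then - u $ k else l $ k" and ?u = "\<chi> k. if k = i then - l $ k else u $ k"
  have eq: "(- (x $ i) < u $ i) = (- (u $ i) < x $ i)" "(l $ i < - (x $ i)) = (x $ i < - (l $ i))" for x :: "real^'n" by linarith+
  have "reflect i -` box l u = box ?l ?u"
  proof (intro set_eqI iffI)
    fix x assume "x \<in> reflect i -` box l u"
    then have "\<forall>k. l $ k < (if k = i then -1 else 1) * x $ k \<and> (if k = i then -1 else 1) * x $ k < u $ k"
      by (simp add: mem_box_cart reflect_def)
    then show "x \<in> box ?l ?u" using eq by (auto simp: mem_box_cart split: if_splits)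
  next
    fix x assume "x \<in> box ?l ?u"
    then show "x \<in> reflect i -` box l u" using eq by (auto simp: mem_box_cart reflect_def split: if_splits)
  qed
  moreover have "(\<Prod>k\<in>UNIV. (?u - ?l) $ k) = (\<Prod>k\<in>UNIV. (u - l) $ k)"
    by (rule prod.cong) auto
  ultimately show "\<exists>l' u'. (\<forall>i. l' $ i \<le> u' $ i) \<and> reflect i -` box l u = box l' u' \<and>
              (\<Prod>i\<in>UNIV. (u' - l') $ i) = (\<Prod>i\<in>UNIV. (u - l) $ i)"
    using le by (intro exI[of _ ?l] exI[of _ ?u]) auto
qed

lemma lborel_swap: "distr lborel borel (swap_coords i j) = (lborel :: (real^'n) measure)"
proof (rule lborel_cart_eqI[OF swap_measurable])
  fix l u :: "real^'n" assume le: "\<And>i. l $ i \<le> u $ i"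
  let ?p = "Transposition.transpose i j"
  have "swap_coords i j -` box l u = box (swap_coords i j l) (swap_coords i j u)"
  proof (intro set_eqI)
    fix x
    have "(\<forall>k. l $ k < x $ ?p k \<and> x $ ?p k < u $ k) \<longleftrightarrow> (\<forall>k. l $ ?p k < x $ k \<and> x $ k < u $ ?p k)"
      by (metis transpose_involutory)
    then show "x \<in> swap_coords i j -` box l u \<longleftrightarrow> x \<in> box (swap_coords i j l) (swap_coords i j u)"
      by (simp add: mem_box_cart swap_coords_def)
  qed
  moreover have "(\<Prod>k\<in>UNIV. (u - l) $ ?p k) = (\<Prod>k\<in>UNIV. (u - l) $ k)"
    by (rule prod.reindex_bij_betw[of _ _ _ "\<lambda>k. (u - l) $ k"]) simp
  ultimately show "\<exists>l' u'. (\<forall>i. l' $ i \<le> u' $ i) \<and> swap_coords i j -` box l u = box l' u' \<and>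
              (\<Prod>i\<in>UNIV. (u' - l') $ i) = (\<Prod>i\<in>UNIV. (u - l) $ i)"
    using le by (intro exI[of _ "swap_coords i j l"] exI[of _ "swap_coords i j u"]) (auto simp: swap_coords_def)
qed

lemma vec_nth_measurable[measurable]: "(\<lambda>x::real^'n. x $ i) \<in> borel_measurable borel"
  by (rule borel_measurable_continuous_onI) (auto intro!: continuous_intros)

lemma integral_odd_coord:
  assumes [measurable]: "F \<in> borel_measurable borel"
  shows "(LINT x|lborel. F (norm (x::real^'n)) * x $ i) = 0"
proof -
  have "(LINT x|lborel. F (norm (x::real^'n)) * x $ i) = (LINT x|distr lborel borel (reflect i). F (norm x) * x $ i)"
    by (simp add: lborel_reflect)
  also have "\<dots> = (LINT x|lborel. F (norm (reflect i x)) * reflect i x $ i)" by (rule integral_distr) auto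
  also have "\<dots> = - (LINT x|lborel. F (norm x) * x $ i)" by (simp add: norm_reflect, simp add: reflect_def)
  finally show ?thesis by simp
qed

lemma integral_odd_coord2:
  assumes [measurable]: "F \<in> borel_measurable borel" and "i \<noteq> j"
  shows "(LINT x|lborel. F (norm (x::real^'n)) * (x $ i * x $ j)) = 0"
proof -
  have "(LINT x|lborel. F (norm (x::real^'n)) * (x $ i * x $ j)) = (LINT x|distr lborel borel (reflect i). F (norm x) * (x $ i * x $ j))"
    by (simp add: lborel_reflect)
  also have "\<dots> = (LINT x|lborel. F (norm (reflect i x)) * (reflect i x $ i * reflect i x $ j))" by (rule integral_distr) auto
  also have "\<dots> = - (LINT x|lborel. F (norm x) * (x $ i * x $ j))" using assms(2) by (simp add: norm_reflect, simp add: reflect_def)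
  finally show ?thesis by simp
qed

lemma integral_swap_coord2:
  assumes [measurable]: "F \<in> borel_measurable borel"
  shows "(LINT x|lborel. F (norm (x::real^'n)) * (x $ i * x $ i)) = (LINT x|lborel. F (norm (x::real^'n)) * (x $ j * x $ j))"
proof -
  have "(LINT x|lborel. F (norm (x::real^'n)) * (x $ i * x $ i)) = (LINT x|distr lborel borel (swap_coords i j). F (norm x) * (x $ i * x $ i))"
    by (simp add: lborel_swap)
  also have "\<dots> = (LINT x|lborel. F (norm (swap_coords i j x)) * (swap_coords i j x $ i * swap_coords i j x $ i))" by (rule integral_distr) auto
  also have "\<dots> = (LINT x|lborel. F (norm x) * (x $ j * x $ j))" by (simp add: norm_swap, simp add: swap_coords_def)
  finally show ?thesis .
qed

text \<open>Integrable rather than bounded, because the potential of the linearized equation can be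
singular on the spheres where \<open>u\<close> vanishes.\<close>

definition radial_profile :: "real \<Rightarrow> real \<Rightarrow> (real \<Rightarrow> real) \<Rightarrow> bool" where
  "radial_profile \<alpha> \<beta> F \<longleftrightarrow> F \<in> borel_measurable borel \<and> integrable lborel F \<and> (\<forall>r. r \<notin> {\<alpha>..\<beta>} \<longrightarrow> F r = 0)"

lemma radial_profile_mult:
  assumes F: "radial_profile \<alpha> \<beta> F" and [measurable]: "g \<in> borel_measurable borel"
    and g: "\<And>r. r \<in> {\<alpha>..\<beta>} \<Longrightarrow> \<bar>g r\<bar> \<le> M"
  shows "radial_profile \<alpha> \<beta> (\<lambda>r. g r * F r)"
proof -
  have [measurable]: "F \<in> borel_measurable borel" and Fi: "integrable lborel F" and F0: "\<And>r. r \<notin> {\<alpha>..\<beta>} \<Longrightarrow> F r = 0"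
    using F by (auto simp: radial_profile_def)
  have "integrable lborel (\<lambda>r. g r * F r)"
  proof (rule Bochner_Integration.integrable_bound[OF integrable_mult_right[OF Fi, of M]])
    have "\<bar>g r * F r\<bar> \<le> \<bar>M * F r\<bar>" for r
    proof (cases "r \<in> {\<alpha>..\<beta>}")
      case True
      from g[OF this] show ?thesis unfolding abs_mult by (intro mult_right_mono) auto
    qed (simp add: F0)
    then show "AE r in lborel. norm (g r * F r) \<le> norm (M * F r)" by simp
  qed measurable
  then show ?thesis by (simp add: radial_profile_def F0)
qed

lemma radial_profile_add:
  "radial_profile \<alpha> \<beta> F \<Longrightarrow> radial_profile \<alpha> \<beta> G \<Longrightarrow> radial_profile \<alpha> \<beta> (\<lambda>r. F r + G r)"
  by (auto simp: radial_profile_def)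

lemma radial_profile_sum:
  "finite I \<Longrightarrow> (\<And>i. i \<in> I \<Longrightarrow> radial_profile \<alpha> \<beta> (F i)) \<Longrightarrow> radial_profile \<alpha> \<beta> (\<lambda>r. \<Sum>i\<in>I. F i r)"
  by (auto simp: radial_profile_def intro!: borel_measurable_sum Bochner_Integration.integrable_sum sum.neutral)

lemma radial_profile_weight:
  assumes F: "radial_profile \<alpha> \<beta> F" and "0 < \<alpha>"
  shows "radial_profile \<alpha> \<beta> (\<lambda>r. radial_weight N r * F r)"
proof (rule radial_profile_mult[OF F])
  show "\<bar>radial_weight N r\<bar> \<le> unit_ball_vol (real N) * real N * \<beta> ^ (N - 1)" if "r \<in> {\<alpha>..\<beta>}" for r
    using that \<open>0 < \<alpha>\<close> by (auto simp: radial_weight_def abs_mult intro!: mult_left_mono power_mono)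
qed measurable

lemma radial_profile_integrable:
  assumes F: "radial_profile \<alpha> \<beta> F" and "0 < \<alpha>" and [measurable]: "g \<in> borel_measurable borel"
    and g: "\<And>x::'a::euclidean_space. norm x \<in> {\<alpha>..\<beta>} \<Longrightarrow> \<bar>g x\<bar> \<le> M"
  shows "integrable lborel (\<lambda>x. F (norm x) * g x)"
proof -
  have [measurable]: "F \<in> borel_measurable borel" and F0: "\<And>r. r \<notin> {\<alpha>..\<beta>} \<Longrightarrow> F r = 0"
    using F by (auto simp: radial_profile_def)
  have "integrable lborel (\<lambda>r. radial_weight DIM('a) r * F r)"
    using radial_profile_weight[OF F \<open>0 < \<alpha>\<close>] by (auto simp: radial_profile_def)
  then have Fi: "integrable lborel (\<lambda>x::'a. F (norm x))" by (subst integrable_radial) auto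
  show ?thesis
  proof (rule Bochner_Integration.integrable_bound[OF integrable_mult_right[OF Fi, of M]])
    have "\<bar>F (norm x) * g x\<bar> \<le> \<bar>M * F (norm x)\<bar>" for x
    proof (cases "norm x \<in> {\<alpha>..\<beta>}")
      case True
      from g[OF this] have "\<bar>g x\<bar> \<le> \<bar>M\<bar>" by linarith
      then show ?thesis unfolding abs_mult by (subst mult.commute) (intro mult_right_mono, auto)
    qed (simp add: F0)
    then show "AE x in lborel. norm (F (norm x) * g x) \<le> norm (M * F (norm x))" by simp
  qed measurable
qed

text \<open>Only the radial part and the diagonal of the quadratic part survive, and the diagonal entries may be
averaged, \<open>(x $ i)\<^sup>2\<close> being replaced by \<open>r\<^sup>2 / N\<close>.\<close>

lemma radial_average:
  fixes A :: "real \<Rightarrow> real" and b :: "'n::finite \<Rightarrow> real \<Rightarrow> real" and C :: "'n \<Rightarrow> 'n \<Rightarrow> real \<Rightarrow> real"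
  assumes \<alpha>: "0 < \<alpha>" and A: "radial_profile \<alpha> \<beta> A" and b: "\<And>i. radial_profile \<alpha> \<beta> (b i)"
    and C: "\<And>i j. radial_profile \<alpha> \<beta> (C i j)"
  shows "(LINT x|lborel. A (norm (x::real^'n)) + (\<Sum>i\<in>UNIV. b i (norm x) * x $ i) + (\<Sum>i\<in>UNIV. \<Sum>j\<in>UNIV. C i j (norm x) * (x $ i * x $ j)))
    = (LINT r|lborel. radial_weight CARD('n) r * (A r + r\<^sup>2 / CARD('n) * (\<Sum>i\<in>UNIV. C i i r)))"
proof -
  have m[measurable]: "A \<in> borel_measurable borel" "b i \<in> borel_measurable borel" "C i j \<in> borel_measurable borel" for i j
    using A b C by (auto simp: radial_profile_def)
  have iA: "integrable lborel (\<lambda>x::real^'n. A (norm x))"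
    using radial_profile_integrable[OF A \<alpha>, of "\<lambda>_. 1" 1] by simp
  have ib: "integrable lborel (\<lambda>x::real^'n. b i (norm x) * x $ i)" for i
    by (rule radial_profile_integrable[OF b \<alpha>, of _ \<beta>]) (auto intro: order_trans[OF component_le_norm_cart])
  have iC: "integrable lborel (\<lambda>x::real^'n. C i j (norm x) * (x $ k * x $ l))" for i j k l
  proof (rule radial_profile_integrable[OF C \<alpha>, of _ "\<beta> * \<beta>"])
    fix x :: "real^'n" assume x: "norm x \<in> {\<alpha>..\<beta>}"
    show "\<bar>x $ k * x $ l\<bar> \<le> \<beta> * \<beta>"
      unfolding abs_mult using x \<alpha> by (intro mult_mono order_trans[OF component_le_norm_cart]) auto
  qed measurable
  have diag: "(LINT x|lborel. C i i (norm x) * (x $ i * x $ i)) = (LINT x|lborel. (norm (x::real^'n))\<^sup>2 / CARD('n) * C i i (norm x))" for i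
  proof -
    have "(LINT x|lborel. (norm (x::real^'n))\<^sup>2 * C i i (norm x)) = (LINT x|lborel. (\<Sum>k\<in>UNIV. C i i (norm (x::real^'n)) * (x $ k * x $ k)))"
      by (rule Bochner_Integration.integral_cong)
         (auto simp: power2_norm_eq_inner inner_vec_def sum_distrib_left mult.commute)
    also have "\<dots> = (\<Sum>k\<in>UNIV. LINT x|lborel. C i i (norm (x::real^'n)) * (x $ k * x $ k))"
      by (rule Bochner_Integration.integral_sum) (rule iC)
    also have "\<dots> = (\<Sum>k\<in>(UNIV::'n set). LINT x|lborel. C i i (norm (x::real^'n)) * (x $ i * x $ i))"
      by (rule sum.cong) (auto intro: integral_swap_coord2)
    finally show ?thesis by (simp add: field_simps)
  qed
  have "(LINT x|lborel. A (norm (x::real^'n)) + (\<Sum>i\<in>UNIV. b i (norm x) * x $ i) + (\<Sum>i\<in>UNIV. \<Sum>j\<in>UNIV. C i j (norm x) * (x $ i * x $ j)))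
    = (LINT x|lborel. A (norm (x::real^'n))) + (\<Sum>i\<in>UNIV. LINT x|lborel. b i (norm x) * x $ i)
      + (\<Sum>i\<in>UNIV. \<Sum>j\<in>UNIV. LINT x|lborel. C i j (norm x) * (x $ i * x $ j))"
    using iA ib iC by simp
  also have "(\<Sum>i\<in>UNIV. LINT x|lborel. b i (norm (x::real^'n)) * x $ i) = 0" by (simp add: integral_odd_coord)
  also have "(\<Sum>i\<in>UNIV. \<Sum>j\<in>UNIV. LINT x|lborel. C i j (norm (x::real^'n)) * (x $ i * x $ j))
     = (\<Sum>i\<in>UNIV. \<Sum>j\<in>UNIV. if i = j then LINT x|lborel. (norm (x::real^'n))\<^sup>2 / CARD('n) * C i i (norm x) else 0)"
    by (intro sum.cong refl) (auto simp: diag integral_odd_coord2)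
  also have "\<dots> = (\<Sum>i\<in>UNIV. LINT r|lborel. radial_weight CARD('n) r * (r\<^sup>2 / CARD('n) * C i i r))"
    using integral_radial[where 'a="real^'n", of "\<lambda>r. r\<^sup>2 / CARD('n) * C i i r" for i] by simp
  also have "(LINT x|lborel. A (norm (x::real^'n))) = (LINT r|lborel. radial_weight CARD('n) r * A r)"
    using integral_radial[where 'a="real^'n", of A] by simp
  also have "(LINT r|lborel. radial_weight CARD('n) r * A r) + 0 + (\<Sum>i\<in>UNIV. LINT r|lborel. radial_weight CARD('n) r * (r\<^sup>2 / CARD('n) * C i i r))
    = (LINT r|lborel. radial_weight CARD('n) r * A r + (\<Sum>i\<in>UNIV. radial_weight CARD('n) r * (r\<^sup>2 / CARD('n) * C i i r)))"
  proof -
    have "integrable lborel (\<lambda>r. radial_weight CARD('n) r * A r)"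
      using radial_profile_weight[OF A \<alpha>] by (simp add: radial_profile_def)
    moreover have "integrable lborel (\<lambda>r. radial_weight CARD('n) r * (r\<^sup>2 / CARD('n) * C i i r))" for i
    proof -
      have "radial_profile \<alpha> \<beta> (\<lambda>r. r\<^sup>2 / CARD('n) * C i i r)"
        by (rule radial_profile_mult[OF C, of _ "\<beta>\<^sup>2 / CARD('n)"]) (use \<alpha> in \<open>auto intro!: divide_right_mono power_mono\<close>)
      from radial_profile_weight[OF this \<alpha>] show ?thesis by (simp add: radial_profile_def)
    qed
    ultimately show ?thesis by simp
  qed
  also have "\<dots> = (LINT r|lborel. radial_weight CARD('n) r * (A r + r\<^sup>2 / CARD('n) * (\<Sum>i\<in>UNIV. C i i r)))"
    by (rule Bochner_Integration.integral_cong) (auto simp: distrib_left sum_distrib_left)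
  finally show ?thesis .
qed

section \<open>Energy of functions built from radial profiles\<close>

text \<open>The form that belongs to the operator \<open>- (r ^ (N + 1) s')' - r ^ (N + 1) B s\<close>, which is the operator of the
linearized equation on functions \<open>x $ i * s (norm x)\<close>.\<close>

definition qform :: "nat \<Rightarrow> (real \<Rightarrow> real) \<Rightarrow> (real \<Rightarrow> real) \<Rightarrow> (real \<Rightarrow> real) \<Rightarrow> real" where
  "qform N B s s' = (LINT r|lborel. r ^ (N + 1) * ((s' r)\<^sup>2 - B r * (s r)\<^sup>2))"

lemma radial_profile_continuous:
  assumes "continuous_on UNIV F" "\<And>r. r \<notin> {\<alpha>..\<beta>} \<Longrightarrow> F r = 0"
  shows "radial_profile \<alpha> \<beta> F"
  using integrable_continuous_compact_support[OF assms(1), of "{\<alpha>..\<beta>}"] assms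
  by (simp add: radial_profile_def borel_measurable_continuous_onI)

lemma integral_deriv_compact_support:
  fixes F f :: "real \<Rightarrow> real"
  assumes d: "\<And>r. (F has_real_derivative f r) (at r)" and c: "continuous_on UNIV f"
    and F0: "\<And>r. r \<notin> {\<alpha>..\<beta>} \<Longrightarrow> F r = 0" and f0: "\<And>r. r \<notin> {\<alpha>..\<beta>} \<Longrightarrow> f r = 0" and "\<alpha> \<le> \<beta>"
  shows "(LINT r|lborel. f r) = 0"
proof -
  have "(LINT r|lborel. f r) = (LINT r|lborel. f r * indicator {\<alpha> - 1..\<beta> + 1} r)"
  proof (rule Bochner_Integration.integral_cong)
    show "f r = f r * indicator {\<alpha> - 1..\<beta> + 1} r" for r
      by (cases "r \<in> {\<alpha>..\<beta>}") (simp_all add: f0)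
  qed simp
  also have "\<dots> = F (\<beta> + 1) - F (\<alpha> - 1)"
    by (rule integral_FTC_Icc_real) (use d c \<open>\<alpha> \<le> \<beta>\<close> in \<open>auto simp: continuous_on_eq_continuous_at\<close>)
  finally show ?thesis by (simp add: F0)
qed

text \<open>Functions \<open>\<phi> x = norm x * s (norm x) + (\<Sum>i. x $ i * t i (norm x))\<close>: spherical harmonics of degree 0 and 1 with
radial coefficients. Writing the radial part as \<open>norm x * s (norm x)\<close> lets all the coefficients be measured
by the same one-dimensional form.\<close>

locale profiles =
  fixes \<alpha> \<beta> :: real and s s' :: "real \<Rightarrow> real" and t t' :: "'n::finite \<Rightarrow> real \<Rightarrow> real"
    and B :: "real \<Rightarrow> real"
  assumes \<alpha>: "0 < \<alpha>" "\<alpha> \<le> \<beta>"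
    and s: "\<And>r. (s has_real_derivative s' r) (at r)" "continuous_on UNIV s'"
      "\<And>r. r \<notin> {\<alpha>..\<beta>} \<Longrightarrow> s r = 0"  "\<And>r. r \<notin> {\<alpha>..\<beta>} \<Longrightarrow> s' r = 0"
    and t: "\<And>i r. (t i has_real_derivative t' i r) (at r)" "\<And>i. continuous_on UNIV (t' i)"
      "\<And>i r. r \<notin> {\<alpha>..\<beta>} \<Longrightarrow> t i r = 0"  "\<And>i r. r \<notin> {\<alpha>..\<beta>} \<Longrightarrow> t' i r = 0"
    and B: "radial_profile \<alpha> \<beta> B"
begin

definition "\<phi> x = norm x * s (norm x) + (\<Sum>i\<in>UNIV. x $ i * t i (norm (x::real^'n)))"

definition "S1 r = s r + r * s' r"

lemma cont: "continuous_on UNIV s" "continuous_on UNIV (t i)" "continuous_on UNIV S1"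
proof -
  show "continuous_on UNIV s" "continuous_on UNIV (t i)"
    using s(1) t(1) by (meson DERIV_isCont continuous_at_imp_continuous_on)+
  then show "continuous_on UNIV S1" unfolding S1_def[abs_def] using s(2) by (intro continuous_intros)
qed

lemma S10: "r \<notin> {\<alpha>..\<beta>} \<Longrightarrow> S1 r = 0" by (simp add: S1_def s(3,4))

text \<open>The formula also holds at the origin, where \<open>\<phi>\<close> vanishes in a neighbourhood and division by
\<open>norm x = 0\<close> yields 0.\<close>

lemma grad_\<phi>: "grad \<phi> x $ k = (S1 (norm x) + (\<Sum>i\<in>UNIV. x $ i * t' i (norm x))) / norm x * x $ k + t k (norm x)"
proof (cases "x = 0")
  case True
  have z: "\<phi> y = 0" if "y \<in> ball 0 \<alpha>" for y using that by (simp add: \<phi>_def s(3) t(3))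
  have "((\<lambda>_. 0) has_derivative (\<lambda>_. 0)) (at x)" by simp
  then have "(\<phi> has_derivative (\<lambda>_. 0)) (at x)"
    by (rule has_derivative_transform_within_open[where s="ball 0 \<alpha>"]) (use True \<alpha> z in auto)
  from grad_eqI[OF this] show ?thesis using True \<alpha> by (simp add: S10 t(3))
next
  case False
  have n: "(norm has_derivative (\<lambda>h. x \<bullet> h / norm x)) (at x)"
    using has_derivative_norm[OF False] by (simp add: sgn_div_norm inner_commute divide_inverse mult.commute)
  have c: "((\<lambda>x. f (norm x)) has_derivative (\<lambda>h. (x \<bullet> h / norm x) * f' (norm x))) (at x)"
    if "\<And>r. (f has_real_derivative f' r) (at r)" for f f'
    by (rule DERIV_compose_FDERIV[OF that n])
  have v: "((\<lambda>x. x $ i) has_derivative (\<lambda>h. h $ i)) (at x)" for i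
    by (rule bounded_linear_imp_has_derivative) (rule bounded_linear_vec_nth)
  have "(\<phi> has_derivative (\<lambda>h. (norm x * ((x \<bullet> h / norm x) * s' (norm x)) + (x \<bullet> h / norm x) * s (norm x)) +
      (\<Sum>i\<in>UNIV. x $ i * ((x \<bullet> h / norm x) * t' i (norm x)) + h $ i * t i (norm x)))) (at x)"
    unfolding \<phi>_def[abs_def] by (intro has_derivative_add has_derivative_mult has_derivative_sum n v c s(1) t(1))
  from grad_eqI[OF this, of k]
  have "grad \<phi> x $ k = (norm x * ((x $ k / norm x) * s' (norm x)) + (x $ k / norm x) * s (norm x)) +
      (\<Sum>i\<in>UNIV. x $ i * ((x $ k / norm x) * t' i (norm x)) + axis k 1 $ i * t i (norm x))"
    by (simp add: inner_axis)
  also have "(\<Sum>i\<in>UNIV. x $ i * ((x $ k / norm x) * t' i (norm x)) + axis k 1 $ i * t i (norm x)) =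
     (\<Sum>i\<in>UNIV. x $ i * t' i (norm x)) * (x $ k / norm x) + t k (norm x)"
  proof -
    have "(\<Sum>i\<in>UNIV. axis k 1 $ i * t i (norm x)) = (\<Sum>i\<in>UNIV. if i = k then t i (norm x) else 0)"
      by (rule sum.cong) (auto simp: axis_def)
    then show ?thesis by (simp add: sum.distrib sum_distrib_right sum_distrib_left sum_divide_distrib mult_ac)
  qed
  also have "(norm x * ((x $ k / norm x) * s' (norm x)) + (x $ k / norm x) * s (norm x)) +
      ((\<Sum>i\<in>UNIV. x $ i * t' i (norm x)) * (x $ k / norm x) + t k (norm x)) =
      (S1 (norm x) + (\<Sum>i\<in>UNIV. x $ i * t' i (norm x))) * (x $ k / norm x) + t k (norm x)"
    unfolding S1_def by (simp only: algebra_simps)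
  finally show ?thesis by simp
qed

lemma norm_grad_\<phi>:
  "(norm (grad \<phi> x))\<^sup>2 = ((S1 (norm x))\<^sup>2 + (\<Sum>i\<in>UNIV. (t i (norm x))\<^sup>2))
    + (\<Sum>i\<in>UNIV. (2 * S1 (norm x) * t' i (norm x) + 2 / norm x * (S1 (norm x) * t i (norm x))) * x $ i)
    + (\<Sum>i\<in>UNIV. \<Sum>j\<in>UNIV. (t' i (norm x) * t' j (norm x) + 2 / norm x * (t' j (norm x) * t i (norm x))) * (x $ i * x $ j))"
proof (cases "x = 0")
  case True
  have "grad \<phi> x $ k = 0" for k unfolding grad_\<phi> True using \<alpha> by (simp add: t(3))
  then have "grad \<phi> x = 0" by (simp add: vec_eq_iff)
  then show ?thesis using True \<alpha> by (simp add: S10 t(3,4))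
next
  case False
  define r where "r = norm x"
  have r: "r \<noteq> 0" using False by (simp add: r_def)
  define X S where "X = (\<Sum>i\<in>UNIV. x $ i * t' i r)" and "S = (\<Sum>i\<in>UNIV. x $ i * t i r)"
  define a where "a = (S1 r + X) / r"
  have "(norm (grad \<phi> x))\<^sup>2 = (\<Sum>k\<in>UNIV. (a * x $ k + t k r)\<^sup>2)"
    unfolding power2_norm_eq_inner inner_vec_def grad_\<phi>
    by (simp add: a_def X_def r_def power2_eq_square)
  also have "\<dots> = a\<^sup>2 * (\<Sum>k\<in>UNIV. x $ k * x $ k) + 2 * a * S + (\<Sum>k\<in>UNIV. (t k r)\<^sup>2)"
    by (simp add: power2_eq_square algebra_simps sum.distrib sum_distrib_left S_def)
  also have "(\<Sum>k\<in>UNIV. x $ k * x $ k) = r\<^sup>2" by (simp add: r_def power2_norm_eq_inner inner_vec_def)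
  also have "a\<^sup>2 * r\<^sup>2 = (S1 r + X)\<^sup>2" using r by (simp add: a_def power_divide)
  also have "(S1 r + X)\<^sup>2 + 2 * a * S = (S1 r)\<^sup>2 + (2 * S1 r * X + 2 / r * S1 r * S) + (X * X + 2 / r * (X * S))"
    by (simp add: a_def power2_eq_square algebra_simps add_divide_distrib)
  also have "2 * S1 r * X + 2 / r * S1 r * S = (\<Sum>i\<in>UNIV. (2 * S1 r * t' i r + 2 / r * (S1 r * t i r)) * x $ i)"
    by (simp add: X_def S_def sum_distrib_left sum.distrib[symmetric] sum_divide_distrib algebra_simps)
  also have "X * X + 2 / r * (X * S) = (\<Sum>i\<in>UNIV. \<Sum>j\<in>UNIV. (t' i r * t' j r + 2 / r * (t' j r * t i r)) * (x $ i * x $ j))"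
  proof -
    have "X * X = (\<Sum>i\<in>UNIV. \<Sum>j\<in>UNIV. (t' i r * t' j r) * (x $ i * x $ j))"
      unfolding X_def sum_product by (intro sum.cong refl) (simp add: mult_ac)
    moreover have "2 / r * (S * X) = (\<Sum>i\<in>UNIV. \<Sum>j\<in>UNIV. (2 / r * (t' j r * t i r)) * (x $ i * x $ j))"
      unfolding X_def S_def sum_product unfolding sum_distrib_left by (intro sum.cong refl) (simp add: mult_ac)
    ultimately show ?thesis by (simp add: distrib_right distrib_left sum.distrib mult.commute)
  qed
  finally show ?thesis unfolding r_def by (simp add: algebra_simps)
qed

lemma prof_mult:
  assumes "radial_profile \<alpha> \<beta> F" "continuous_on {\<alpha>..\<beta>} g" "g \<in> borel_measurable borel"
  shows "radial_profile \<alpha> \<beta> (\<lambda>r. g r * F r)"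
proof -
  have "compact (g ` {\<alpha>..\<beta>})" by (rule compact_continuous_image[OF assms(2)]) simp
  then obtain M where "\<forall>r\<in>{\<alpha>..\<beta>}. \<bar>g r\<bar> \<le> M"
    by (auto dest!: compact_imp_bounded simp: bounded_iff)
  then show ?thesis by (intro radial_profile_mult[OF assms(1,3)]) auto
qed

lemma meas: "s \<in> borel_measurable borel" "s' \<in> borel_measurable borel"
  "t i \<in> borel_measurable borel" "t' i \<in> borel_measurable borel" "S1 \<in> borel_measurable borel"
  using cont s(2) t(2) by (auto intro: borel_measurable_continuous_onI)

lemma cont_on: "continuous_on A s" "continuous_on A s'" "continuous_on A (t i)" "continuous_on A (t' i)" "continuous_on A S1"
  using cont s(2) t(2) by (auto intro: continuous_on_subset)

lemma grad_integral:
  "(LINT x|lborel. (norm (grad \<phi> x))\<^sup>2) = (LINT r|lborel. radial_weight CARD('n) r *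
     (((S1 r)\<^sup>2 + (\<Sum>i\<in>UNIV. (t i r)\<^sup>2)) + r\<^sup>2 / CARD('n) * (\<Sum>i\<in>UNIV. t' i r * t' i r + 2 / r * (t' i r * t i r))))"
  unfolding norm_grad_\<phi>
proof (rule radial_average[OF \<alpha>(1)])
  note [measurable] = meas
  show "radial_profile \<alpha> \<beta> (\<lambda>r. (S1 r)\<^sup>2 + (\<Sum>i\<in>UNIV. (t i r)\<^sup>2))"
    by (intro radial_profile_continuous continuous_intros cont) (simp add: S10 t(3))
  have inv: "continuous_on {\<alpha>..\<beta>} (\<lambda>r::real. 2 / r)" using \<alpha> by (auto intro!: continuous_intros)
  show "radial_profile \<alpha> \<beta> (\<lambda>r. 2 * S1 r * t' i r + 2 / r * (S1 r * t i r))" for i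
    by (intro radial_profile_add prof_mult[OF _ inv] radial_profile_continuous[of "\<lambda>r. 2 * S1 r * t' i r"]
        radial_profile_continuous[of "\<lambda>r. S1 r * t i r"] continuous_intros cont t) (auto simp: S10)
  show "radial_profile \<alpha> \<beta> (\<lambda>r. t' i r * t' j r + 2 / r * (t' j r * t i r))" for i j
    by (intro radial_profile_add prof_mult[OF _ inv] radial_profile_continuous[of "\<lambda>r. t' i r * t' j r"]
        radial_profile_continuous[of "\<lambda>r. t' j r * t i r"] continuous_intros cont t) (auto simp: t(3,4))
qed

lemma B_integral:
  "(LINT x|lborel. B (norm x) * (\<phi> x)\<^sup>2) = (LINT r|lborel. radial_weight CARD('n) r *
     (r\<^sup>2 * (s r)\<^sup>2 * B r + r\<^sup>2 / CARD('n) * (\<Sum>i\<in>UNIV. (t i r * t i r) * B r)))"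
proof -
  note [measurable] = meas
  have eq: "B (norm x) * (\<phi> x)\<^sup>2 = (norm x)\<^sup>2 * (s (norm x))\<^sup>2 * B (norm x)
     + (\<Sum>i\<in>UNIV. (2 * norm x * s (norm x) * t i (norm x)) * B (norm x) * x $ i)
     + (\<Sum>i\<in>UNIV. \<Sum>j\<in>UNIV. (t i (norm x) * t j (norm x)) * B (norm x) * (x $ i * x $ j))" for x
  proof -
    define S where "S = (\<Sum>i\<in>UNIV. x $ i * t i (norm x))"
    have "B (norm x) * (\<phi> x)\<^sup>2 = (norm x)\<^sup>2 * (s (norm x))\<^sup>2 * B (norm x) + 2 * norm x * s (norm x) * B (norm x) * S + B (norm x) * (S * S)"
      unfolding \<phi>_def S_def[symmetric] by (simp add: power2_eq_square algebra_simps)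
    also have "2 * norm x * s (norm x) * B (norm x) * S = (\<Sum>i\<in>UNIV. (2 * norm x * s (norm x) * t i (norm x)) * B (norm x) * x $ i)"
      unfolding S_def sum_distrib_left by (rule sum.cong) (auto simp: mult_ac)
    also have "B (norm x) * (S * S) = (\<Sum>i\<in>UNIV. \<Sum>j\<in>UNIV. (t i (norm x) * t j (norm x)) * B (norm x) * (x $ i * x $ j))"
      unfolding S_def sum_product unfolding sum_distrib_left by (intro sum.cong refl) (auto simp: mult_ac)
    finally show ?thesis .
  qed
  show ?thesis unfolding eq
    by (rule radial_average[OF \<alpha>(1), where \<beta>=\<beta> and A="\<lambda>r. r\<^sup>2 * (s r)\<^sup>2 * B r"
          and b="\<lambda>i r. (2 * r * s r * t i r) * B r" and C="\<lambda>i j r. (t i r * t j r) * B r"])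
       (intro prof_mult[OF B] continuous_intros cont_on; measurable)+
qed

text \<open>The angular parts decouple by symmetry. For a coefficient \<open>t\<close> of degree 1 the radial integrand equals
that of \<open>qform\<close> up to the total derivative \<open>(r ^ N * t\<^sup>2)'\<close>. The radial coefficient gives the same plus
\<open>- (N - 1) * r ^ (N - 1) * s\<^sup>2\<close>, the missing angular energy, which has the favourable sign and is dropped.\<close>

lemma energy_bound:
  assumes N: "2 \<le> CARD('n)"
  shows "(LINT x|lborel. (norm (grad \<phi> x))\<^sup>2) - (LINT x|lborel. B (norm x) * (\<phi> x)\<^sup>2)
    \<le> unit_ball_vol CARD('n) * CARD('n) * (qform CARD('n) B s s' + (\<Sum>i\<in>UNIV. qform CARD('n) B (t i) (t' i)) / CARD('n))"
proof -
  let ?N = "CARD('n)"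
  let ?c = "unit_ball_vol ?N * ?N"
  note [measurable] = meas
  obtain n where n: "?N = Suc n" "n \<ge> 1" using N by (cases ?N) auto
  define G where "G f f' r = real ?N * r ^ n * (f r)\<^sup>2 + r ^ ?N * (2 * f r * f' r)" for f f' :: "real \<Rightarrow> real" and r
  have Gi: "integrable lborel (G f f') \<and> (LINT r|lborel. G f f' r) = 0"
    if f: "\<And>r. (f has_real_derivative f' r) (at r)" "continuous_on UNIV f'"
      "\<And>r. r \<notin> {\<alpha>..\<beta>} \<Longrightarrow> f r = 0"  "\<And>r. r \<notin> {\<alpha>..\<beta>} \<Longrightarrow> f' r = 0" for f f'
  proof
    have cf: "continuous_on UNIV f" using f(1) by (meson DERIV_isCont continuous_at_imp_continuous_on)
    have cG: "continuous_on UNIV (G f f')" unfolding G_def[abs_def] by (intro continuous_intros cf f)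
    have G0: "G f f' r = 0" if "r \<notin> {\<alpha>..\<beta>}" for r using that by (simp add: G_def f)
    show "integrable lborel (G f f')"
      using radial_profile_continuous[OF cG G0] by (simp add: radial_profile_def)
    show "(LINT r|lborel. G f f' r) = 0"
    proof (rule integral_deriv_compact_support[OF _ cG _ G0 \<alpha>(2), where F="\<lambda>r. r ^ ?N * (f r)\<^sup>2"])
      show "((\<lambda>r. r ^ ?N * (f r)\<^sup>2) has_real_derivative G f f' r) (at r)" for r
        proof -
        have "((\<lambda>r. r ^ ?N * (f r)\<^sup>2) has_real_derivative
            real ?N * r ^ (?N - Suc 0) * (f r)\<^sup>2 + real 2 * (f' r * f r ^ (2 - Suc 0)) * r ^ ?N) (at r)"
          by (rule DERIV_mult[OF DERIV_pow DERIV_power[OF f(1)]])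
        then show ?thesis by (rule DERIV_cong) (simp add: G_def n(1) algebra_simps)
      qed
    qed (simp add: f)
  qed
  define Q where "Q f f' r = r ^ (?N + 1) * ((f' r)\<^sup>2 - B r * (f r)\<^sup>2)" for f f' :: "real \<Rightarrow> real" and r
  have Qi: "integrable lborel (Q f f')"
    if f: "continuous_on UNIV f" "continuous_on UNIV f'"
      "\<And>r. r \<notin> {\<alpha>..\<beta>} \<Longrightarrow> f r = 0"  "\<And>r. r \<notin> {\<alpha>..\<beta>} \<Longrightarrow> f' r = 0" for f f'
  proof -
    have [measurable]: "f \<in> borel_measurable borel" using f(1) by (rule borel_measurable_continuous_onI)
    have "radial_profile \<alpha> \<beta> (\<lambda>r. r ^ (?N + 1) * (f' r)\<^sup>2)"
      by (intro radial_profile_continuous continuous_intros f) (simp add: f)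
    moreover have "radial_profile \<alpha> \<beta> (\<lambda>r. (- (r ^ (?N + 1) * (f r)\<^sup>2)) * B r)"
      by (intro prof_mult[OF B] continuous_intros continuous_on_subset[OF f(1)]) auto
    ultimately have "radial_profile \<alpha> \<beta> (\<lambda>r. r ^ (?N + 1) * (f' r)\<^sup>2 + (- (r ^ (?N + 1) * (f r)\<^sup>2)) * B r)"
      by (rule radial_profile_add)
    moreover have "(\<lambda>r. r ^ (?N + 1) * (f' r)\<^sup>2 + (- (r ^ (?N + 1) * (f r)\<^sup>2)) * B r) = Q f f'"
      by (auto simp: Q_def algebra_simps)
    ultimately show ?thesis by (simp add: radial_profile_def)
  qed
  define E where "E r = r ^ n * (s r)\<^sup>2" for r
  have Ei: "integrable lborel E"
  proof -
    have "radial_profile \<alpha> \<beta> E" unfolding E_def[abs_def]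
      by (intro radial_profile_continuous continuous_intros cont) (simp add: s(3))
    then show ?thesis by (simp add: radial_profile_def)
  qed
  have E_nonneg: "0 \<le> E r" for r
    by (cases "r \<in> {\<alpha>..\<beta>}") (use \<alpha> in \<open>auto simp: E_def s(3)\<close>)
  have i1: "integrable lborel (\<lambda>r. radial_weight ?N r *
     (((S1 r)\<^sup>2 + (\<Sum>i\<in>UNIV. (t i r)\<^sup>2)) + r\<^sup>2 / CARD('n) * (\<Sum>i\<in>UNIV. t' i r * t' i r + 2 / r * (t' i r * t i r))))"
  proof -
    have inv: "continuous_on {\<alpha>..\<beta>} (\<lambda>r::real. 2 / r)" "continuous_on {\<alpha>..\<beta>} (\<lambda>r::real. r\<^sup>2 / CARD('n))" using \<alpha> by (auto intro!: continuous_intros)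
    have "radial_profile \<alpha> \<beta> (\<lambda>r. radial_weight ?N r *
     (((S1 r)\<^sup>2 + (\<Sum>i\<in>UNIV. (t i r)\<^sup>2)) + r\<^sup>2 / CARD('n) * (\<Sum>i\<in>UNIV. t' i r * t' i r + 2 / r * (t' i r * t i r))))"
      by (intro radial_profile_weight[OF _ \<alpha>(1)] radial_profile_add prof_mult[OF _ inv(1)] prof_mult[OF _ inv(2)] radial_profile_sum
          radial_profile_continuous[of "\<lambda>r. (S1 r)\<^sup>2"] radial_profile_continuous[of "\<lambda>r. (t i r)\<^sup>2" for i]
          radial_profile_continuous[of "\<lambda>r. t' i r * t' i r" for i]
          radial_profile_continuous[of "\<lambda>r. t' i r * t i r" for i] continuous_intros cont t) (auto simp: S10 t)
    then show ?thesis by (simp add: radial_profile_def)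
  qed
  have i2: "integrable lborel (\<lambda>r. radial_weight CARD('n) r *
     (r\<^sup>2 * (s r)\<^sup>2 * B r + r\<^sup>2 / CARD('n) * (\<Sum>i\<in>UNIV. (t i r * t i r) * B r)))"
  proof -
    have inv: "continuous_on {\<alpha>..\<beta>} (\<lambda>r::real. r\<^sup>2 / CARD('n))" by (auto intro!: continuous_intros)
    have "radial_profile \<alpha> \<beta> (\<lambda>r. radial_weight CARD('n) r *
     (r\<^sup>2 * (s r)\<^sup>2 * B r + r\<^sup>2 / CARD('n) * (\<Sum>i\<in>UNIV. (t i r * t i r) * B r)))"
      by (intro radial_profile_weight[OF _ \<alpha>(1)] radial_profile_add prof_mult[OF _ inv] radial_profile_sum
          prof_mult[OF B] continuous_intros cont_on) measurable
    then show ?thesis by (simp add: radial_profile_def)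
  qed
  have pw: "radial_weight ?N r * (((S1 r)\<^sup>2 + (\<Sum>i\<in>UNIV. (t i r)\<^sup>2)) + r\<^sup>2 / CARD('n) * (\<Sum>i\<in>UNIV. t' i r * t' i r + 2 / r * (t' i r * t i r)))
      - radial_weight ?N r * (r\<^sup>2 * (s r)\<^sup>2 * B r + r\<^sup>2 / CARD('n) * (\<Sum>i\<in>UNIV. (t i r * t i r) * B r))
    = ?c * ((Q s s' r + G s s' r - real n * E r) + (\<Sum>i\<in>UNIV. Q (t i) (t' i) r + G (t i) (t' i) r) / ?N)" for r
  proof (cases "r \<in> {\<alpha>..\<beta>}")
    case False
    then show ?thesis by (simp add: S10 s t Q_def G_def E_def)
  next
    case True
    then have r: "r > 0" using \<alpha> by auto
    have N0: "real ?N \<noteq> 0" by simp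
    have w: "radial_weight ?N r = ?c * r ^ n" using r n by (simp add: radial_weight_def)
    have p: "r ^ (?N + 1) = r ^ n * r * r" "r ^ ?N = r ^ n * r" using n by simp_all
    have 1: "r ^ n * ((S1 r)\<^sup>2 - r\<^sup>2 * (s r)\<^sup>2 * B r) = Q s s' r + G s s' r - real n * E r"
      unfolding S1_def Q_def G_def E_def p using n(1) by (simp add: power2_eq_square algebra_simps)
    have 2: "r ^ n * ((t i r)\<^sup>2 + r\<^sup>2 / ?N * (t' i r * t' i r + 2 / r * (t' i r * t i r)) - r\<^sup>2 / ?N * (t i r * t i r * B r))
      = (Q (t i) (t' i) r + G (t i) (t' i) r) / ?N" for i
      unfolding Q_def G_def p using r N0 by (simp add: power2_eq_square field_simps)
    have "radial_weight ?N r * (((S1 r)\<^sup>2 + (\<Sum>i\<in>UNIV. (t i r)\<^sup>2)) + r\<^sup>2 / CARD('n) * (\<Sum>i\<in>UNIV. t' i r * t' i r + 2 / r * (t' i r * t i r)))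
      - radial_weight ?N r * (r\<^sup>2 * (s r)\<^sup>2 * B r + r\<^sup>2 / CARD('n) * (\<Sum>i\<in>UNIV. (t i r * t i r) * B r))
      = ?c * (r ^ n * ((S1 r)\<^sup>2 - r\<^sup>2 * (s r)\<^sup>2 * B r) + (\<Sum>i\<in>UNIV. r ^ n * ((t i r)\<^sup>2 + r\<^sup>2 / ?N * (t' i r * t' i r + 2 / r * (t' i r * t i r)) - r\<^sup>2 / ?N * (t i r * t i r * B r))))"
      unfolding w sum_subtractf[symmetric] sum_distrib_left[symmetric] sum.distrib sum_subtractf
      by (simp add: algebra_simps)
    then show ?thesis unfolding 1 2 by (simp add: sum_divide_distrib)
  qed
  have "(LINT x|lborel. (norm (grad \<phi> x))\<^sup>2) - (LINT x|lborel. B (norm x) * (\<phi> x)\<^sup>2)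
     = (LINT r|lborel. ?c * ((Q s s' r + G s s' r - real n * E r) + (\<Sum>i\<in>UNIV. Q (t i) (t' i) r + G (t i) (t' i) r) / ?N))"
    unfolding grad_integral B_integral pw[symmetric] by (rule Bochner_Integration.integral_diff[OF i1 i2, symmetric])
  also have "\<dots> = ?c * (((LINT r|lborel. Q s s' r) + 0 - real n * (LINT r|lborel. E r)) + (\<Sum>i\<in>UNIV. (LINT r|lborel. Q (t i) (t' i) r) + 0) / ?N)"
    using Gi[OF s] Gi[OF t] Qi[OF cont(1) s(2-4)] Qi[OF cont(2) t(2-4)] Ei by simp
  also have "\<dots> \<le> ?c * ((LINT r|lborel. Q s s' r) + (\<Sum>i\<in>UNIV. (LINT r|lborel. Q (t i) (t' i) r)) / ?N)"
  proof -
    have "0 \<le> (LINT r|lborel. E r)" by (rule Bochner_Integration.integral_nonneg) (simp add: E_nonneg)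
    then show ?thesis by (intro mult_left_mono) auto
  qed
  finally show ?thesis by (simp add: qform_def Q_def)
qed

end

section \<open>Smooth approximation of piecewise smooth profiles\<close>

text \<open>Positive exactly between \<open>\<alpha>\<close> and \<open>\<beta>\<close>. The factor \<open>flat 0 (r\<^sup>2)\<close> makes \<open>cutoff \<alpha> \<beta> (norm x) * norm x ^ k\<close> an
elementary function of \<open>x\<close> for every \<open>k\<close>; the case distinction removes the mirror image on the negative
axis.\<close>

definition cutoff :: "real \<Rightarrow> real \<Rightarrow> real \<Rightarrow> real" where
  "cutoff \<alpha> \<beta> r = (if r \<le> 0 then 0 else flat 0 (r\<^sup>2) * flat 0 (r\<^sup>2 - \<alpha>\<^sup>2) * flat 0 (\<beta>\<^sup>2 - r\<^sup>2))"

definition cutoff' :: "real \<Rightarrow> real \<Rightarrow> real \<Rightarrow> real" where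
  "cutoff' \<alpha> \<beta> r = (if r \<le> 0 then 0 else
     2 * r * (flat (-2) (r\<^sup>2) * flat 0 (r\<^sup>2 - \<alpha>\<^sup>2) * flat 0 (\<beta>\<^sup>2 - r\<^sup>2)
      + flat 0 (r\<^sup>2) * flat (-2) (r\<^sup>2 - \<alpha>\<^sup>2) * flat 0 (\<beta>\<^sup>2 - r\<^sup>2)
      - flat 0 (r\<^sup>2) * flat 0 (r\<^sup>2 - \<alpha>\<^sup>2) * flat (-2) (\<beta>\<^sup>2 - r\<^sup>2)))"

lemma flat_eq_0: "t \<le> 0 \<Longrightarrow> flat c t = 0"
  by (simp add: flat_def)

lemma continuous_on_flat: "continuous_on A (flat c)"
  using flat_has_derivative by (meson DERIV_isCont continuous_at_imp_continuous_on)

lemma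
  assumes "0 < \<alpha>" "\<alpha> < \<beta>"
  shows cutoff_pos: "\<alpha> < r \<Longrightarrow> r < \<beta> \<Longrightarrow> 0 < cutoff \<alpha> \<beta> r"
    and cutoff_zero: "r \<notin> {\<alpha><..<\<beta>} \<Longrightarrow> cutoff \<alpha> \<beta> r = 0" "r \<notin> {\<alpha><..<\<beta>} \<Longrightarrow> cutoff' \<alpha> \<beta> r = 0"
    and cutoff_deriv: "(cutoff \<alpha> \<beta> has_real_derivative cutoff' \<alpha> \<beta> r) (at r)"
    and cutoff'_cont: "continuous_on UNIV (cutoff' \<alpha> \<beta>)"
proof -
  show "0 < cutoff \<alpha> \<beta> r" if "\<alpha> < r" "r < \<beta>"
    using that assms by (auto simp: cutoff_def flat_def power_strict_mono)
  have sq: "r\<^sup>2 \<le> \<alpha>\<^sup>2 \<or> \<beta>\<^sup>2 \<le> r\<^sup>2" if "r \<notin> {\<alpha><..<\<beta>}" "0 < r" for r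
  proof (cases "r \<le> \<alpha>")
    case True then show ?thesis using that by (intro disjI1 power_mono) auto
  next
    case False then show ?thesis using that assms by (intro disjI2 power_mono) auto
  qed
  have z: "cutoff \<alpha> \<beta> r = 0 \<and> cutoff' \<alpha> \<beta> r = 0" if "r \<notin> {\<alpha><..<\<beta>}" for r
    using sq[OF that] by (auto simp: cutoff_def cutoff'_def flat_eq_0)
  then show "r \<notin> {\<alpha><..<\<beta>} \<Longrightarrow> cutoff \<alpha> \<beta> r = 0" "r \<notin> {\<alpha><..<\<beta>} \<Longrightarrow> cutoff' \<alpha> \<beta> r = 0" by auto
  have z0: "cutoff \<alpha> \<beta> r = 0" "cutoff' \<alpha> \<beta> r = 0" if "r < \<alpha>" for r using z[of r] that by auto
  let ?g = "\<lambda>r. flat 0 (r\<^sup>2) * flat 0 (r\<^sup>2 - \<alpha>\<^sup>2) * flat 0 (\<beta>\<^sup>2 - r\<^sup>2)"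
  show "(cutoff \<alpha> \<beta> has_real_derivative cutoff' \<alpha> \<beta> r) (at r)"
  proof (cases "r < \<alpha>")
    case True
    have "((\<lambda>_. 0) has_real_derivative 0) (at r)" by simp
    then have "(cutoff \<alpha> \<beta> has_real_derivative 0) (at r)"
      by (rule has_field_derivative_transform_within_open[where S="{..<\<alpha>}"]) (use True z0 in auto)
    then show ?thesis using z0 True by simp
  next
    case False
    have D: "((\<lambda>r. flat 0 (h r)) has_real_derivative flat (-2) (h r) * h') (at r)"
      if "(h has_real_derivative h') (at r)" for h h'
      using DERIV_chain2[OF flat_has_derivative[of 0 "h r"] that] by simp
    have "(?g has_real_derivative cutoff' \<alpha> \<beta> r) (at r)"
    proof (rule DERIV_cong)
      show "(?g has_real_derivative
        ((flat (-2) (r\<^sup>2) * (2 * r)) * flat 0 (r\<^sup>2 - \<alpha>\<^sup>2) + (flat (-2) (r\<^sup>2 - \<alpha>\<^sup>2) * (2 * r)) * flat 0 (r\<^sup>2)) * flat 0 (\<beta>\<^sup>2 - r\<^sup>2)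
        + (flat (-2) (\<beta>\<^sup>2 - r\<^sup>2) * (- 2 * r)) * (flat 0 (r\<^sup>2) * flat 0 (r\<^sup>2 - \<alpha>\<^sup>2))) (at r)"
        by (intro DERIV_mult D) (auto intro!: derivative_eq_intros)
    qed (use False assms in \<open>simp add: cutoff'_def algebra_simps\<close>)
    then show ?thesis
      by (rule has_field_derivative_transform_within_open[where S="{0<..}"]) (use False assms in \<open>auto simp: cutoff_def\<close>)
  qed
  let ?g' = "\<lambda>r. 2 * r * (flat (-2) (r\<^sup>2) * flat 0 (r\<^sup>2 - \<alpha>\<^sup>2) * flat 0 (\<beta>\<^sup>2 - r\<^sup>2)
      + flat 0 (r\<^sup>2) * flat (-2) (r\<^sup>2 - \<alpha>\<^sup>2) * flat 0 (\<beta>\<^sup>2 - r\<^sup>2)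
      - flat 0 (r\<^sup>2) * flat 0 (r\<^sup>2 - \<alpha>\<^sup>2) * flat (-2) (\<beta>\<^sup>2 - r\<^sup>2))"
  have c: "continuous_on A ?g'" for A
    by (intro continuous_intros continuous_on_compose2[OF continuous_on_flat]) auto
  have "continuous_on ({..<\<alpha>} \<union> {0<..}) (cutoff' \<alpha> \<beta>)"
  proof (rule continuous_on_open_Un)
    show "continuous_on {..<\<alpha>} (cutoff' \<alpha> \<beta>)"
      by (rule continuous_on_eq[OF continuous_on_const[of _ 0]]) (use z0 in auto)
    show "continuous_on {0<..} (cutoff' \<alpha> \<beta>)"
      by (rule continuous_on_eq[OF c]) (auto simp: cutoff'_def)
  qed auto
  moreover have "{..<\<alpha>} \<union> {0<..} = UNIV" using assms by auto
  ultimately show "continuous_on UNIV (cutoff' \<alpha> \<beta>)" by simp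
qed

text \<open>Continuous and piecewise continuously differentiable profiles with support in \<open>{\<alpha>..\<beta>}\<close>; \<open>\<gamma>\<close> is the derivative
away from the finite set \<open>S\<close> of kinks.\<close>

definition admissible :: "real \<Rightarrow> real \<Rightarrow> real set \<Rightarrow> (real \<Rightarrow> real) \<Rightarrow> (real \<Rightarrow> real) \<Rightarrow> bool" where
  "admissible \<alpha> \<beta> S \<eta> \<gamma> \<longleftrightarrow> finite S \<and> continuous_on UNIV \<eta> \<and> (\<forall>r. r \<notin> S \<longrightarrow> (\<eta> has_real_derivative \<gamma> r) (at r)) \<and>
     continuous_on (- S) \<gamma> \<and> bounded (range \<gamma>) \<and> (\<forall>r. r \<notin> {\<alpha>..\<beta>} \<longrightarrow> \<eta> r = 0 \<and> \<gamma> r = 0)"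

lemma admissible_mono:
  "admissible \<alpha> \<beta> S \<eta> \<gamma> \<Longrightarrow> \<alpha>' \<le> \<alpha> \<Longrightarrow> \<beta> \<le> \<beta>' \<Longrightarrow> S \<subseteq> S' \<Longrightarrow> finite S' \<Longrightarrow> admissible \<alpha>' \<beta>' S' \<eta> \<gamma>"
  unfolding admissible_def by (auto intro: continuous_on_subset)

lemma Lipschitz_of_bounded_derivative:
  fixes f f' :: "real \<Rightarrow> real"
  assumes S: "finite S" and c: "continuous_on UNIV f" and d: "\<And>r. r \<notin> S \<Longrightarrow> (f has_real_derivative f' r) (at r)"
    and b: "\<And>r. \<bar>f' r\<bar> \<le> L" and xy: "x \<le> y"
  shows "\<bar>f y - f x\<bar> \<le> L * (y - x)"
proof -
  have "(f' has_integral (f y - f x)) {x..y}"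
    by (rule fundamental_theorem_of_calculus_interior_strong[OF S xy])
       (use d in \<open>auto simp: has_real_derivative_iff_has_vector_derivative intro: continuous_on_subset[OF c]\<close>)
  moreover have "0 \<le> L" using b[of 0] by linarith
  ultimately have "norm (f y - f x) \<le> L * measure lborel (cbox x y)"
    using has_integral_bound[of L f' "f y - f x" x y] b by auto
  then show ?thesis using xy by simp
qed

lemma polynomial_antiderivative:
  fixes p :: "real \<Rightarrow> real"
  assumes "real_polynomial_function p"
  obtains q where "real_polynomial_function q" "\<And>r. (q has_real_derivative p r) (at r)" "q a = 0"
proof -
  obtain c n where p: "p = (\<lambda>r. \<Sum>i\<le>n. c i * r ^ i)"
    using assms real_polynomial_function_iff_sum by auto
  define q where "q r = (\<Sum>i\<le>n. c i / real (Suc i) * r ^ Suc i)" for r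
  have "real_polynomial_function (\<lambda>r. q r - q a)"
    unfolding q_def by (intro real_polynomial_function_diff real_polynomial_function_sum real_polynomial_function.intros
        real_polynomial_function_power) auto
  moreover have "((\<lambda>r. q r - q a) has_real_derivative p r) (at r)" for r
  proof -
    have "((\<lambda>r. c i / real (Suc i) * r ^ Suc i) has_real_derivative c i * r ^ i) (at r)" for i
      using DERIV_cmult[OF DERIV_pow[of "Suc i" r], of "c i / real (Suc i)"] by (simp del: power_Suc of_nat_Suc)
    then have "((\<lambda>r. (\<Sum>i\<le>n. c i / real (Suc i) * r ^ Suc i) - q a) has_real_derivative (\<Sum>i\<le>n. c i * r ^ i) - 0) (at r)"
      by (intro DERIV_diff DERIV_sum DERIV_const)
    then show ?thesis by (simp add: q_def p del: power_Suc of_nat_Suc)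
  qed
  ultimately show ?thesis using that[of "\<lambda>r. q r - q a"] by simp
qed

text \<open>Divide \<open>\<eta>\<close> by the cutoff, which is bounded below on the support of \<open>\<eta>\<close>. The difference quotients of the
result are continuous, uniformly bounded and converge to its derivative away from the kinks; by
Weierstrass they may be replaced by polynomials. Antiderivatives of these polynomials, multiplied by
the cutoff, converge boundedly to \<open>\<eta>\<close> together with their derivatives, which suffices for
dominated convergence in quadratic forms.\<close>

lemma smooth_approximation:
  assumes \<alpha>: "0 < \<alpha>" "\<alpha> < \<alpha>'" "\<alpha>' \<le> \<beta>'" "\<beta>' < \<beta>" and adm: "admissible \<alpha>' \<beta>' S \<eta> \<gamma>"
  obtains q p :: "nat \<Rightarrow> real \<Rightarrow> real" and C where
    "\<And>m. real_polynomial_function (q m)" "\<And>m r. (q m has_real_derivative p m r) (at r)"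
    "\<And>m. continuous_on UNIV (p m)"
    "\<And>r. (\<lambda>m. cutoff \<alpha> \<beta> r * q m r) \<longlonglongrightarrow> \<eta> r"
    "\<And>r. r \<notin> S \<Longrightarrow> (\<lambda>m. cutoff' \<alpha> \<beta> r * q m r + cutoff \<alpha> \<beta> r * p m r) \<longlonglongrightarrow> \<gamma> r"
    "\<And>m r. \<bar>cutoff \<alpha> \<beta> r * q m r\<bar> \<le> C" "\<And>m r. \<bar>cutoff' \<alpha> \<beta> r * q m r + cutoff \<alpha> \<beta> r * p m r\<bar> \<le> C"
proof -
  have ab: "\<alpha> < \<beta>" using \<alpha> by linarith
  let ?c = "cutoff \<alpha> \<beta>" and ?c' = "cutoff' \<alpha> \<beta>"
  note cpos = cutoff_pos[OF \<alpha>(1) ab] and cz = cutoff_zero[OF \<alpha>(1) ab] and cd = cutoff_deriv[OF \<alpha>(1) ab]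
  have cc: "continuous_on A ?c" for A using cd by (meson DERIV_isCont continuous_at_imp_continuous_on)
  have cc': "continuous_on UNIV ?c'" by (rule cutoff'_cont[OF \<alpha>(1) ab])
  have S: "finite S" and ce: "continuous_on UNIV \<eta>" and de: "\<And>r. r \<notin> S \<Longrightarrow> (\<eta> has_real_derivative \<gamma> r) (at r)"
    and e0: "\<And>r. r \<notin> {\<alpha>'..\<beta>'} \<Longrightarrow> \<eta> r = 0" "\<And>r. r \<notin> {\<alpha>'..\<beta>'} \<Longrightarrow> \<gamma> r = 0"
    using adm by (auto simp: admissible_def)
  obtain L where L: "\<And>r. \<bar>\<gamma> r\<bar> \<le> L" using adm by (auto simp: admissible_def bounded_iff)
  obtain H where H: "\<And>r. \<bar>\<eta> r\<bar> \<le> H"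
    using continuous_compact_support_bounded[OF ce, of "{\<alpha>'..\<beta>'}"] e0 by (metis compact_Icc)
  obtain K where K: "0 < K" "\<And>r. \<bar>?c r\<bar> \<le> K"
    using continuous_compact_support_bounded[OF cc, of "{\<alpha>..\<beta>}"] cz(1) by (metis compact_Icc greaterThanLessThan_subseteq_atLeastAtMost_iff order_refl subsetD)
  obtain K' where K': "0 < K'" "\<And>r. \<bar>?c' r\<bar> \<le> K'"
    using continuous_compact_support_bounded[OF cc', of "{\<alpha>..\<beta>}"] cz(2) by (metis compact_Icc greaterThanLessThan_subseteq_atLeastAtMost_iff order_refl subsetD)
  obtain \<kappa> where \<kappa>: "0 < \<kappa>" "\<And>r. r \<in> {\<alpha>'..\<beta>'} \<Longrightarrow> \<kappa> \<le> ?c r"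
  proof -
    obtain x where x: "x \<in> {\<alpha>'..\<beta>'}" "\<And>r. r \<in> {\<alpha>'..\<beta>'} \<Longrightarrow> ?c x \<le> ?c r"
      using continuous_attains_inf[OF compact_Icc _ cc, of \<alpha>' \<beta>'] \<alpha> by fastforce
    then show ?thesis using that[of "?c x"] cpos[of x] \<alpha> by auto
  qed
  define \<zeta> where "\<zeta> r = \<eta> r / ?c r" for r
  define \<zeta>' where "\<zeta>' r = \<gamma> r / ?c r - \<eta> r * ?c' r / (?c r)\<^sup>2" for r
  have z0: "\<zeta> r = 0" "\<zeta>' r = 0" if "r \<notin> {\<alpha>'..\<beta>'}" for r using e0[OF that] by (auto simp: \<zeta>_def \<zeta>'_def)
  have dz: "(\<zeta> has_real_derivative \<zeta>' r) (at r)" if "r \<notin> S" for r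
  proof (cases "r \<in> {\<alpha>'..\<beta>'}")
    case True
    then have "?c r > 0" using cpos \<alpha> by auto
    then have "(\<zeta> has_real_derivative (\<gamma> r * ?c r - \<eta> r * ?c' r) / (?c r * ?c r)) (at r)"
      unfolding \<zeta>_def[abs_def] by (intro DERIV_divide de that cd) auto
    then show ?thesis by (rule DERIV_cong) (use \<open>?c r > 0\<close> in \<open>simp add: \<zeta>'_def field_simps power2_eq_square\<close>)
  next
    case False
    have "((\<lambda>_. 0) has_real_derivative 0) (at r)" by simp
    then have "(\<zeta> has_real_derivative 0) (at r)"
      by (rule has_field_derivative_transform_within_open[where S="- {\<alpha>'..\<beta>'}"])
         (use False z0 in \<open>auto simp: open_Compl simp del: atLeastAtMost_iff\<close>)
    then show ?thesis using z0 False by simp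
  qed
  have czeta: "continuous_on UNIV \<zeta>"
  proof -
    have "continuous_on ({\<alpha><..<\<beta>} \<union> - {\<alpha>'..\<beta>'}) \<zeta>"
    proof (rule continuous_on_open_Un)
      show "continuous_on {\<alpha><..<\<beta>} \<zeta>" unfolding \<zeta>_def[abs_def]
        using cpos by (intro continuous_on_divide cc continuous_on_subset[OF ce]) (auto simp: less_imp_neq[symmetric])
      show "continuous_on (- {\<alpha>'..\<beta>'}) \<zeta>"
        by (rule continuous_on_eq[OF continuous_on_const[of _ 0]]) (use z0 in auto)
    qed (auto simp: open_Compl)
    moreover have "{\<alpha><..<\<beta>} \<union> - {\<alpha>'..\<beta>'} = UNIV" using \<alpha> by auto
    ultimately show ?thesis by simp
  qed
  define L' where "L' = L / \<kappa> + H * K' / \<kappa>\<^sup>2"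
  have L0: "0 \<le> L" "0 \<le> H" using L[of 0] H[of 0] by linarith+
  have L': "\<bar>\<zeta>' r\<bar> \<le> L'" for r
  proof (cases "r \<in> {\<alpha>'..\<beta>'}")
    case True
    then have k: "\<kappa> \<le> ?c r" by (rule \<kappa>(2))
    then have kp: "?c r > 0" using \<kappa>(1) by linarith
    have "\<bar>\<zeta>' r\<bar> \<le> \<bar>\<gamma> r\<bar> / ?c r + \<bar>\<eta> r\<bar> * \<bar>?c' r\<bar> / (?c r)\<^sup>2"
      unfolding \<zeta>'_def using kp by (intro order_trans[OF abs_triangle_ineq4]) (simp add: abs_mult)
    also have "\<dots> \<le> L / \<kappa> + H * K' / \<kappa>\<^sup>2"
      using k \<kappa>(1) L[of r] H[of r] K'(2)[of r] L0 K'(1)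
      by (intro add_mono frac_le mult_mono power_mono mult_nonneg_nonneg) auto
    finally show ?thesis by (simp add: L'_def)
  next
    case False
    then show ?thesis using z0[OF False] L0 \<kappa>(1) K'(1) by (simp add: L'_def)
  qed
  define h where "h m = inverse (real (Suc m))" for m
  have h: "h m > 0" "h m \<le> 1" for m by (auto simp: h_def inverse_le_1_iff)
  have h0: "h \<longlonglongrightarrow> 0" unfolding h_def by (rule LIMSEQ_inverse_real_of_nat)
  (* difference quotients of the quotient of the profile by the cutoff *)
  define g where "g m r = (\<zeta> (r + h m) - \<zeta> r) / h m" for m r
  have gb: "\<bar>g m r\<bar> \<le> L'" for m r
  proof -
    have "\<bar>\<zeta> (r + h m) - \<zeta> r\<bar> \<le> L' * (r + h m - r)"
      by (rule Lipschitz_of_bounded_derivative[OF S czeta dz L']) (use h[of m] in auto)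
    then show ?thesis using h(1)[of m] by (simp add: g_def field_simps)
  qed
  have cg: "continuous_on A (g m)" for m A
    unfolding g_def[abs_def] using h(1)[of m]
    by (auto intro!: continuous_intros continuous_on_compose2[OF czeta] continuous_on_subset[OF czeta])
  have glim: "(\<lambda>m. g m r) \<longlonglongrightarrow> \<zeta>' r" if "r \<notin> S" for r
  proof -
    have "((\<lambda>t. (\<zeta> (r + t) - \<zeta> r) / t) \<longlongrightarrow> \<zeta>' r) (at 0)" using dz[OF that] by (simp add: DERIV_def)
    moreover have "filterlim h (at 0) sequentially"
      using h0 h(1) by (auto simp: filterlim_at less_imp_neq[symmetric] intro!: always_eventually)
    ultimately show ?thesis unfolding g_def by (rule filterlim_compose)
  qed
  have "\<exists>p. real_polynomial_function p \<and> (\<forall>r\<in>{\<alpha>..\<beta>}. \<bar>g m r - p r\<bar> < h m)" for m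
  proof (rule Stone_Weierstrass_real_polynomial_function[OF compact_Icc[of \<alpha> \<beta>] cg[of _ m] h(1)[of m]])
    fix p assume p: "real_polynomial_function p" "\<And>r. r \<in> {\<alpha>..\<beta>} \<Longrightarrow> \<bar>g m r - p r\<bar> < h m"
    show ?thesis by (intro exI[of _ p] conjI ballI p)
  qed
  then obtain p where p: "\<And>m. real_polynomial_function (p m)" "\<And>m r. r \<in> {\<alpha>..\<beta>} \<Longrightarrow> \<bar>g m r - p m r\<bar> < h m"
    by metis
  have "\<exists>q. real_polynomial_function q \<and> (\<forall>r. (q has_real_derivative p m r) (at r)) \<and> q \<alpha> = 0" for m
    using polynomial_antiderivative[OF p(1)] by metis
  then obtain q where q: "\<And>m. real_polynomial_function (q m)" "\<And>m r. (q m has_real_derivative p m r) (at r)" "\<And>m. q m \<alpha> = 0"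
    by metis
  have pc: "continuous_on A (p m)" for m A
  proof -
    obtain c n where "p m = (\<lambda>r. \<Sum>i\<le>n. c i * r ^ i)" using p(1) real_polynomial_function_iff_sum by blast
    then show ?thesis by (auto intro!: continuous_intros)
  qed
  have pb: "\<bar>p m r\<bar> \<le> L' + 1" if "r \<in> {\<alpha>..\<beta>}" for m r
    using p(2)[OF that, of m] gb[of m r] h(2)[of m] by linarith
  have plim: "(\<lambda>m. p m r) \<longlonglongrightarrow> \<zeta>' r" if r: "r \<in> {\<alpha>..\<beta>}" "r \<notin> S" for r
  proof -
    have "(\<lambda>m. g m r - p m r) \<longlonglongrightarrow> 0"
      by (rule Lim_null_comparison[OF _ h0]) (use p(2)[OF r(1)] in \<open>auto intro!: always_eventually less_imp_le\<close>)
    from tendsto_diff[OF glim[OF r(2)] this] show ?thesis by simp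
  qed
  have qint: "(p m has_integral q m r) {\<alpha>..r}" if "r \<in> {\<alpha>..\<beta>}" for m r
  proof -
    have "(p m has_integral (q m r - q m \<alpha>)) {\<alpha>..r}"
      by (rule fundamental_theorem_of_calculus)
         (use that q(2)[of m] in \<open>simp_all add: has_real_derivative_iff_has_vector_derivative has_vector_derivative_at_within\<close>)
    then show ?thesis by (simp add: q(3))
  qed
  have qb: "\<bar>q m r\<bar> \<le> (L' + 1) * (\<beta> - \<alpha>)" if r: "r \<in> {\<alpha>..\<beta>}" for m r
  proof -
    have "0 \<le> L' + 1" using L'[of 0] by linarith
    moreover have "norm (q m r) \<le> (L' + 1) * measure lborel (cbox \<alpha> r)"
      using has_integral_bound[of "L' + 1" "p m" "q m r" \<alpha> r] qint[OF r] pb r \<open>0 \<le> L' + 1\<close> by auto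
    ultimately show ?thesis using r mult_left_mono[of "r - \<alpha>" "\<beta> - \<alpha>" "L' + 1"] by auto
  qed
  have qlim: "(\<lambda>m. q m r) \<longlonglongrightarrow> \<zeta> r" if r: "r \<in> {\<alpha>..\<beta>}" for r
  proof -
    define f where "f m x = (if x \<in> S then 0 else p m x)" for m x
    define f' where "f' x = (if x \<in> S then 0 else \<zeta>' x)" for x
    have fq: "(f m has_integral q m r) {\<alpha>..r}" for m
      by (rule has_integral_spike_finite[OF S _ qint[OF r]]) (auto simp: f_def)
    have "(\<zeta>' has_integral (\<zeta> r - \<zeta> \<alpha>)) {\<alpha>..r}"
      by (rule fundamental_theorem_of_calculus_interior_strong[OF S])
         (use dz r in \<open>auto simp: has_real_derivative_iff_has_vector_derivative intro: continuous_on_subset[OF czeta]\<close>)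
    moreover have "\<zeta> \<alpha> = 0" using z0 \<alpha> by simp
    ultimately have fz: "(f' has_integral \<zeta> r) {\<alpha>..r}"
      by (intro has_integral_spike_finite[OF S, of _ f' \<zeta>']) (auto simp: f'_def)
    have "(\<lambda>m. integral {\<alpha>..r} (f m)) \<longlonglongrightarrow> integral {\<alpha>..r} f'"
    proof (rule dominated_convergence(2)[where h="\<lambda>_. L' + 1"])
      show "f m integrable_on {\<alpha>..r}" for m using fq by blast
      show "norm (f m x) \<le> L' + 1" if "x \<in> {\<alpha>..r}" for m x
        using pb[of x m] that r L'[of 0] by (auto simp: f_def)
      show "(\<lambda>m. f m x) \<longlonglongrightarrow> f' x" if "x \<in> {\<alpha>..r}" for x
        using plim[of x] that r by (auto simp: f_def f'_def)
    qed auto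
    then show ?thesis using integral_unique[OF fq] integral_unique[OF fz] by simp
  qed
  define C where "C = (K + K') * ((L' + 1) * (\<beta> - \<alpha>) + (L' + 1))"
  have "0 \<le> L'" using L'[of 0] by linarith
  then have L1: "0 \<le> L' + 1" "0 \<le> (L' + 1) * (\<beta> - \<alpha>)" using ab by (auto intro!: mult_nonneg_nonneg)
  show ?thesis
  proof (rule that[of q p C])
    show "real_polynomial_function (q m)" "(q m has_real_derivative p m r) (at r)" "continuous_on UNIV (p m)" for m r
      using q pc by auto
    show "(\<lambda>m. ?c r * q m r) \<longlonglongrightarrow> \<eta> r" for r
    proof (cases "r \<in> {\<alpha><..<\<beta>}")
      case True
      then have "(\<lambda>m. ?c r * q m r) \<longlonglongrightarrow> ?c r * \<zeta> r" by (intro tendsto_intros qlim) auto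
      then show ?thesis using cpos[of r] True by (simp add: \<zeta>_def)
    next
      case False
      then show ?thesis using cz[OF False] e0[of r] \<alpha> by auto
    qed
    show "(\<lambda>m. ?c' r * q m r + ?c r * p m r) \<longlonglongrightarrow> \<gamma> r" if "r \<notin> S" for r
    proof (cases "r \<in> {\<alpha><..<\<beta>}")
      case True
      then have "(\<lambda>m. ?c' r * q m r + ?c r * p m r) \<longlonglongrightarrow> ?c' r * \<zeta> r + ?c r * \<zeta>' r"
        by (intro tendsto_intros qlim plim that) auto
      moreover have "?c' r * \<zeta> r + ?c r * \<zeta>' r = \<gamma> r"
        using cpos[of r] True by (simp add: \<zeta>_def \<zeta>'_def field_simps power2_eq_square)
      ultimately show ?thesis by simp
    next
      case False
      then show ?thesis using cz[OF False] e0[of r] \<alpha> by auto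
    qed
    have bound: "\<bar>a * q m r + b * p m r\<bar> \<le> C" if "r \<in> {\<alpha><..<\<beta>}" "\<bar>a\<bar> \<le> K + K'" "\<bar>b\<bar> \<le> K + K'" for a b m r
    proof -
      have r: "r \<in> {\<alpha>..\<beta>}" using that by auto
      have "\<bar>a * q m r + b * p m r\<bar> \<le> \<bar>a\<bar> * \<bar>q m r\<bar> + \<bar>b\<bar> * \<bar>p m r\<bar>"
        by (intro order_trans[OF abs_triangle_ineq]) (simp add: abs_mult)
      also have "\<dots> \<le> (K + K') * ((L' + 1) * (\<beta> - \<alpha>)) + (K + K') * (L' + 1)"
        using that qb[OF r, of m] pb[OF r, of m] K(1) K'(1) L1 by (intro add_mono mult_mono) auto
      finally show ?thesis by (simp add: C_def distrib_left)
    qed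
    have C0: "0 \<le> C" unfolding C_def using K(1) K'(1) L1 by (intro mult_nonneg_nonneg[of "K + K'"] add_nonneg_nonneg[of "(L' + 1) * (\<beta> - \<alpha>)"]) auto
    show "\<bar>?c r * q m r\<bar> \<le> C" for m r
    proof (cases "r \<in> {\<alpha><..<\<beta>}")
      case True
      from bound[OF this, of "?c r" 0 m] K(2)[of r] K'(1) K(1) show ?thesis by auto
    qed (simp add: cz C0)
    show "\<bar>?c' r * q m r + ?c r * p m r\<bar> \<le> C" for m r
    proof (cases "r \<in> {\<alpha><..<\<beta>}")
      case True
      from bound[OF this, of "?c' r" "?c r" m] K(2)[of r] K'(2)[of r] K'(1) K(1) show ?thesis by auto
    qed (simp add: cz C0)
  qed
qed

section \<open>Negative directions of the one-dimensional form\<close>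

lemma max0_square_deriv: "((\<lambda>z::real. (max 0 z)\<^sup>2) has_real_derivative 2 * max 0 z) (at z)"
proof (cases z "0::real" rule: linorder_cases)
  case less
  have "((\<lambda>_::real. 0) has_real_derivative (0::real)) (at z)" by simp
  then have "((\<lambda>z::real. (max 0 z)\<^sup>2) has_real_derivative 0) (at z)"
    by (rule has_field_derivative_transform_within_open[where S="{..<0}"]) (use less in auto)
  then show ?thesis using less by simp
next
  case greater
  have "((\<lambda>z::real. z\<^sup>2) has_real_derivative 2 * z) (at z)" by (auto intro!: derivative_eq_intros)
  then have "((\<lambda>z::real. (max 0 z)\<^sup>2) has_real_derivative 2 * z) (at z)"
    by (rule has_field_derivative_transform_within_open[where S="{0<..}"]) (use greater in auto)
  then show ?thesis using greater by simp
next
  case equal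
  have "((\<lambda>h::real. (max 0 h)\<^sup>2 / h) \<longlongrightarrow> 0) (at 0)"
  proof (rule Lim_null_comparison[where g="\<lambda>h. \<bar>h\<bar>"])
    have "\<bar>(max 0 h)\<^sup>2 / h\<bar> \<le> \<bar>h\<bar>" for h :: real
      by (cases "h \<le> 0") (auto simp: power2_eq_square)
    then show "\<forall>\<^sub>F h in at 0. norm ((max 0 h)\<^sup>2 / h) \<le> \<bar>h\<bar>" by simp
    show "((\<lambda>h::real. \<bar>h\<bar>) \<longlongrightarrow> 0) (at 0)" using tendsto_rabs[OF tendsto_ident_at[of "0::real" UNIV]] by simp
  qed
  then show ?thesis using equal by (simp add: has_field_derivative_iff)
qed

definition bump :: "real \<Rightarrow> real \<Rightarrow> real \<Rightarrow> real" where
  "bump c \<delta> r = (max 0 (1 - ((r - c) / \<delta>)\<^sup>2))\<^sup>2"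

definition bump' :: "real \<Rightarrow> real \<Rightarrow> real \<Rightarrow> real" where
  "bump' c \<delta> r = 2 * max 0 (1 - ((r - c) / \<delta>)\<^sup>2) * (- (2 * ((r - c) / \<delta>) / \<delta>))"

lemma bump_deriv: "(bump c \<delta> has_real_derivative bump' c \<delta> r) (at r)"
proof -
  have d: "((\<lambda>r. 1 - ((r - c) / \<delta>)\<^sup>2) has_real_derivative - (2 * ((r - c) / \<delta>) / \<delta>)) (at r)"
  proof (cases "\<delta> = 0")
    case False
    then show ?thesis by (auto intro!: derivative_eq_intros simp: field_simps eval_nat_numeral)
  qed simp
  show ?thesis using DERIV_chain2[OF max0_square_deriv d] by (simp add: bump_def[abs_def] bump'_def)
qed

lemma bump_cont: "continuous_on A (bump c \<delta>)" "continuous_on A (bump' c \<delta>)"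
proof -
  have "continuous_on A (\<lambda>r. (r - c) / \<delta>)"
    by (simp add: divide_inverse) (intro continuous_intros)
  then show "continuous_on A (bump c \<delta>)" "continuous_on A (bump' c \<delta>)"
    unfolding bump_def[abs_def] bump'_def[abs_def] divide_inverse by (auto intro!: continuous_intros simp: divide_inverse)
qed

lemma bump_zero:
  assumes "0 < \<delta>" "\<delta> \<le> \<bar>r - c\<bar>"
  shows "bump c \<delta> r = 0" "bump' c \<delta> r = 0"
proof -
  have "1 \<le> \<bar>(r - c) / \<delta>\<bar>" using assms by simp
  then have "1 \<le> ((r - c) / \<delta>)\<^sup>2" by (metis abs_le_square_iff abs_one one_power2)
  then show "bump c \<delta> r = 0" "bump' c \<delta> r = 0" by (auto simp: bump_def bump'_def)
qed

lemma bump_center: "bump c \<delta> c = 1"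
  by (simp add: bump_def)

lemma admissible_smooth:
  assumes "\<And>r. (f has_real_derivative f' r) (at r)" "continuous_on UNIV f'"
    "\<And>r. r \<notin> {\<alpha>..\<beta>} \<Longrightarrow> f r = 0" "\<And>r. r \<notin> {\<alpha>..\<beta>} \<Longrightarrow> f' r = 0"
  shows "admissible \<alpha> \<beta> {} f f'"
proof -
  have "continuous_on UNIV f" using assms(1) by (meson DERIV_isCont continuous_at_imp_continuous_on)
  moreover obtain M where "\<And>r. \<bar>f' r\<bar> \<le> M"
    using continuous_compact_support_bounded[OF assms(2) compact_Icc[of \<alpha> \<beta>]] assms(4) by metis
  ultimately show ?thesis using assms by (auto simp: admissible_def bounded_iff)
qed

lemma admissible_add:
  assumes "admissible \<alpha> \<beta> S f f'" "admissible \<alpha> \<beta> S g g'"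
  shows "admissible \<alpha> \<beta> S (\<lambda>r. f r + c * g r) (\<lambda>r. f' r + c * g' r)"
proof -
  obtain M M' where M: "\<And>r. \<bar>f' r\<bar> \<le> M" "\<And>r. \<bar>g' r\<bar> \<le> M'"
    using assms by (auto simp: admissible_def bounded_iff)
  have "\<bar>f' r + c * g' r\<bar> \<le> M + \<bar>c\<bar> * M'" for r
    using M(1)[of r] mult_left_mono[OF M(2)[of r], of "\<bar>c\<bar>"] abs_triangle_ineq[of "f' r" "c * g' r"]
    by (simp add: abs_mult)
  then have "bounded (range (\<lambda>r. f' r + c * g' r))" by (auto simp: bounded_iff)
  with assms show ?thesis unfolding admissible_def
    by (auto intro!: continuous_intros derivative_eq_intros)
qed

lemma admissible_props:
  assumes "admissible \<alpha> \<beta> S f f'"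
  obtains M where "f \<in> borel_measurable borel" "f' \<in> borel_measurable borel" "\<And>r. \<bar>f r\<bar> \<le> M" "\<And>r. \<bar>f' r\<bar> \<le> M"
proof -
  have c: "continuous_on UNIV f" and c': "continuous_on (- S) f'" and S: "finite S" and z: "\<And>r. r \<notin> {\<alpha>..\<beta>} \<Longrightarrow> f r = 0"
    using assms by (auto simp: admissible_def)
  obtain M1 where M1: "\<And>r. \<bar>f' r\<bar> \<le> M1" using assms by (auto simp: admissible_def bounded_iff)
  obtain M2 where M2: "\<And>r. \<bar>f r\<bar> \<le> M2"
    using continuous_compact_support_bounded[OF c compact_Icc[of \<alpha> \<beta>] z] by metis
  have "f \<in> borel_measurable borel" using c by (rule borel_measurable_continuous_onI)
  moreover have "f' \<in> borel_measurable borel"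
    by (rule borel_measurable_continuous_countable_exceptions[OF _ c']) (use S in \<open>simp add: countable_finite\<close>)
  moreover have "\<bar>f r\<bar> \<le> max M1 M2" "\<bar>f' r\<bar> \<le> max M1 M2" for r using M1[of r] M2[of r] by auto
  ultimately show ?thesis using that[of "max M1 M2"] by blast
qed

text \<open>The symmetric bilinear form of \<open>qform\<close>, with the derivatives as separate arguments.\<close>

definition bform :: "nat \<Rightarrow> (real \<Rightarrow> real) \<Rightarrow> (real \<Rightarrow> real) \<Rightarrow> (real \<Rightarrow> real) \<Rightarrow> (real \<Rightarrow> real) \<Rightarrow> (real \<Rightarrow> real) \<Rightarrow> real" where
  "bform N B f f' g g' = (LINT r|lborel. r ^ (N + 1) * (f' r * g' r - B r * (f r * g r)))"

lemma bform_commute: "bform N B f f' g g' = bform N B g g' f f'"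
  by (simp add: bform_def mult.commute)

text \<open>A matrix that differs from \<open>- 2 \<epsilon>\<close> times the identity by at most \<open>\<epsilon> / d\<close> in every entry is negative
definite, since \<open>\<bar>c i * c j\<bar> \<le> ((c i)\<^sup>2 + (c j)\<^sup>2) / 2\<close>.\<close>

lemma almost_diagonal_negative:
  fixes M :: "nat \<Rightarrow> nat \<Rightarrow> real" and c :: "nat \<Rightarrow> real"
  assumes \<epsilon>: "0 < \<epsilon>" and M: "\<And>i j. i < d \<Longrightarrow> j < d \<Longrightarrow> \<bar>M i j + (if i = j then 2 * \<epsilon> else 0)\<bar> \<le> \<epsilon> / d"
    and c: "\<exists>i<d. c i \<noteq> 0"
  shows "(\<Sum>i<d. \<Sum>j<d. c i * c j * M i j) < 0"
proof -
  have d: "d > 0" using c by auto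
  define E where "E i j = M i j + (if i = j then 2 * \<epsilon> else 0)" for i j
  have "c i * c j * E i j \<le> (\<epsilon> / d) * (((c i)\<^sup>2 + (c j)\<^sup>2) / 2)" if "i < d" "j < d" for i j
  proof -
    have "c i * c j * E i j \<le> \<bar>c i * c j\<bar> * \<bar>E i j\<bar>" by (metis abs_ge_self abs_mult)
    also have "\<dots> \<le> (((c i)\<^sup>2 + (c j)\<^sup>2) / 2) * (\<epsilon> / d)"
      using sum_squares_bound[of "\<bar>c i\<bar>" "\<bar>c j\<bar>"] M[OF that]
      by (intro mult_mono) (auto simp: E_def abs_mult)
    finally show ?thesis by (simp add: mult.commute)
  qed
  then have "(\<Sum>i<d. \<Sum>j<d. c i * c j * E i j) \<le> (\<Sum>i<d. \<Sum>j<d. (\<epsilon> / d) * (((c i)\<^sup>2 + (c j)\<^sup>2) / 2))"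
    by (intro sum_mono) auto
  also have "\<dots> = \<epsilon> * (\<Sum>i<d. (c i)\<^sup>2)"
  proof -
    have "(\<Sum>i<d. \<Sum>j<d. ((c i)\<^sup>2 + (c j)\<^sup>2) / 2) = d * (\<Sum>i<d. (c i)\<^sup>2)"
      by (simp add: sum.distrib add_divide_distrib sum_divide_distrib[symmetric] sum_distrib_left[symmetric])
    then show ?thesis unfolding sum_distrib_left[symmetric] using d by simp
  qed
  finally have 1: "(\<Sum>i<d. \<Sum>j<d. c i * c j * E i j) \<le> \<epsilon> * (\<Sum>i<d. (c i)\<^sup>2)" .
  have "(\<Sum>i<d. \<Sum>j<d. c i * c j * E i j) = (\<Sum>i<d. \<Sum>j<d. c i * c j * M i j) + (\<Sum>i<d. \<Sum>j<d. if j = i then 2 * \<epsilon> * (c i)\<^sup>2 else 0)"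
    unfolding sum.distrib[symmetric] by (intro sum.cong refl) (auto simp: E_def distrib_left power2_eq_square)
  also have "(\<Sum>i<d. \<Sum>j<d. if j = i then 2 * \<epsilon> * (c i)\<^sup>2 else 0) = 2 * \<epsilon> * (\<Sum>i<d. (c i)\<^sup>2)"
    by (simp add: sum_distrib_left)
  finally have 2: "(\<Sum>i<d. \<Sum>j<d. c i * c j * M i j) = (\<Sum>i<d. \<Sum>j<d. c i * c j * E i j) - 2 * \<epsilon> * (\<Sum>i<d. (c i)\<^sup>2)" by simp
  obtain i where i: "i < d" "c i \<noteq> 0" using c by auto
  have "0 < (c i)\<^sup>2" using i by simp
  also have "\<dots> \<le> (\<Sum>i<d. (c i)\<^sup>2)" by (rule member_le_sum) (use i in auto)
  finally have "0 < \<epsilon> * (\<Sum>i<d. (c i)\<^sup>2)" using \<epsilon> by simp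
  with 1 2 show ?thesis by linarith
qed

text \<open>The function \<open>w\<close> solves \<open>(r ^ (N + 1) w')' = - r ^ (N + 1) B w\<close> off a locally finite set \<open>Z\<close>, near which the potential \<open>B\<close>
may be unbounded, but remains integrable.\<close>

locale sturm =
  fixes lo hi :: real and N :: nat and w w' B :: "real \<Rightarrow> real" and Z :: "real set"
  assumes lo: "0 \<le> lo"
    and w: "\<And>r. lo < r \<Longrightarrow> r < hi \<Longrightarrow> (w has_real_derivative w' r) (at r)"
    and w'c: "continuous_on {lo<..<hi} w'"
    and Bm: "B \<in> borel_measurable borel"
    and Bi: "\<And>\<alpha> \<beta>. lo < \<alpha> \<Longrightarrow> \<beta> < hi \<Longrightarrow> set_integrable lborel {\<alpha>..\<beta>} B"
    and Zf: "\<And>\<alpha> \<beta>. lo < \<alpha> \<Longrightarrow> \<beta> < hi \<Longrightarrow> finite (Z \<inter> {\<alpha>..\<beta>})"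
    and P: "\<And>r. lo < r \<Longrightarrow> r < hi \<Longrightarrow> r \<notin> Z \<Longrightarrow>
      ((\<lambda>r. r ^ (N + 1) * w' r) has_real_derivative - (r ^ (N + 1) * (B r * w r))) (at r)"
begin

abbreviation "b \<equiv> bform N B"

lemma weighted_integrable:
  assumes "lo < \<alpha>" "\<beta> < hi" and [measurable]: "f \<in> borel_measurable borel" "g \<in> borel_measurable borel"
    and z: "\<And>r. r \<notin> {\<alpha>..\<beta>} \<Longrightarrow> f r = 0" "\<And>r. r \<notin> {\<alpha>..\<beta>} \<Longrightarrow> g r = 0"
    and C: "\<And>r. \<bar>f r\<bar> \<le> C" "\<And>r. \<bar>g r\<bar> \<le> C"
  shows "\<bar>r ^ (N + 1) * (g r - B r * f r)\<bar> \<le> \<beta> ^ (N + 1) * (C * indicator {\<alpha>..\<beta>} r + \<bar>indicator {\<alpha>..\<beta>} r *\<^sub>R B r\<bar> * C)" (is "\<bar>?F r\<bar> \<le> ?G r")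
    and "integrable lborel (\<lambda>r. \<beta> ^ (N + 1) * (C * indicator {\<alpha>..\<beta>} r + \<bar>indicator {\<alpha>..\<beta>} r *\<^sub>R B r\<bar> * C))"
    and "integrable lborel (\<lambda>r. r ^ (N + 1) * (g r - B r * f r))"
proof -
  have [measurable]: "B \<in> borel_measurable borel" by (rule Bm)
  have bd: "\<bar>?F r\<bar> \<le> ?G r" for r
  proof (cases "r \<in> {\<alpha>..\<beta>}")
    case True
    then have r: "0 < r" "r \<le> \<beta>" using lo assms by auto
    have "\<bar>g r - B r * f r\<bar> \<le> C + \<bar>B r\<bar> * C"
      using C(2)[of r] mult_left_mono[OF C(1)[of r], of "\<bar>B r\<bar>"] abs_triangle_ineq4[of "g r" "B r * f r"]
      by (simp add: abs_mult)
    then have "\<bar>?F r\<bar> \<le> \<beta> ^ (N + 1) * (C + \<bar>B r\<bar> * C)"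
      unfolding abs_mult using r by (intro mult_mono) (auto simp del: power_Suc simp: power_abs intro!: power_mono)
    then show ?thesis using True by simp
  qed (simp add: z)
  then show "\<bar>?F r\<bar> \<le> ?G r" .
  have "integrable lborel (indicat_real {\<alpha>..\<beta>})" by (simp add: emeasure_lborel_Icc_eq)
  moreover have "integrable lborel (\<lambda>r. indicator {\<alpha>..\<beta>} r *\<^sub>R B r)"
    using Bi[OF assms(1,2)] by (simp add: set_integrable_def)
  ultimately show G: "integrable lborel ?G"
    by (intro integrable_mult_right integrable_mult_left Bochner_Integration.integrable_add integrable_abs)
  show "integrable lborel ?F"
  proof (rule Bochner_Integration.integrable_bound[OF G])
    show "AE r in lborel. norm (?F r) \<le> norm (?G r)"
      using bd by (intro AE_I2) (metis real_norm_def abs_ge_self order_trans)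
  qed measurable
qed

lemma b_integrable:
  assumes ab: "lo < \<alpha>" "\<beta> < hi" and f: "admissible \<alpha> \<beta> S f f'" and g: "admissible \<alpha> \<beta> S' g g'"
  shows "integrable lborel (\<lambda>r. r ^ (N + 1) * (f' r * g' r - B r * (f r * g r)))"
proof -
  obtain M where M: "f \<in> borel_measurable borel" "f' \<in> borel_measurable borel" "\<And>r. \<bar>f r\<bar> \<le> M" "\<And>r. \<bar>f' r\<bar> \<le> M"
    using admissible_props[OF f] by metis
  obtain L where L: "g \<in> borel_measurable borel" "g' \<in> borel_measurable borel" "\<And>r. \<bar>g r\<bar> \<le> L" "\<And>r. \<bar>g' r\<bar> \<le> L"
    using admissible_props[OF g] by metis
  note [measurable] = M(1,2) L(1,2)
  have z: "f r = 0" "f' r = 0" if "r \<notin> {\<alpha>..\<beta>}" for r using f that by (auto simp: admissible_def)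
  have bd: "\<bar>f r * g r\<bar> \<le> M * L" "\<bar>f' r * g' r\<bar> \<le> M * L" for r
    unfolding abs_mult using M(3,4)[of r] L(3,4)[of r] by (auto intro!: mult_mono)
  show ?thesis by (rule weighted_integrable(3)[OF ab, where C="M * L"]) (auto simp: z bd simp del: atLeastAtMost_iff)
qed

lemma b_add:
  assumes ab: "lo < \<alpha>" "\<beta> < hi" and f: "admissible \<alpha> \<beta> S f f'" and g: "admissible \<alpha> \<beta> S g g'"
    and h: "admissible \<alpha> \<beta> S h h'"
  shows "b (\<lambda>r. f r + c * g r) (\<lambda>r. f' r + c * g' r) h h' = b f f' h h' + c * b g g' h h'"
proof -
  have "b (\<lambda>r. f r + c * g r) (\<lambda>r. f' r + c * g' r) h h'
    = (LINT r|lborel. r ^ (N + 1) * (f' r * h' r - B r * (f r * h r)) + c * (r ^ (N + 1) * (g' r * h' r - B r * (g r * h r))))"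
    unfolding bform_def by (rule Bochner_Integration.integral_cong) (auto simp: algebra_simps)
  also have "\<dots> = b f f' h h' + c * b g g' h h'"
    using b_integrable[OF ab f h] b_integrable[OF ab g h] by (simp add: bform_def)
  finally show ?thesis .
qed

text \<open>Integration by parts. Because \<open>w\<close> solves the equation, testing its restriction to an interval with any
admissible \<open>g\<close> leaves only boundary terms.\<close>

lemma b_piece:
  assumes xy: "lo < x" "x \<le> y" "y < hi" and ab: "lo < \<alpha>" "\<beta> < hi" and g: "admissible \<alpha> \<beta> S g g'"
    and f: "\<And>r. f r = (if x < r \<and> r < y then w r else 0) \<or> (g r = 0 \<and> g' r = 0)"
    and f': "\<And>r. f' r = (if x < r \<and> r < y then w' r else 0) \<or> (g r = 0 \<and> g' r = 0)"
  shows "b f f' g g' = y ^ (N + 1) * w' y * g y - x ^ (N + 1) * w' x * g x"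
proof -
  let ?F = "\<lambda>r. r ^ (N + 1) * (w' r * g' r - B r * (w r * g r))"
  have wc: "continuous_on {x..y} w"
    using xy by (intro continuous_at_imp_continuous_on) (auto intro!: DERIV_isCont[OF w])
  have w'c: "continuous_on {x..y} w'" by (rule continuous_on_subset[OF w'c]) (use xy in auto)
  obtain M where M: "g \<in> borel_measurable borel" "g' \<in> borel_measurable borel" "\<And>r. \<bar>g r\<bar> \<le> M" "\<And>r. \<bar>g' r\<bar> \<le> M"
    using admissible_props[OF g] by metis
  obtain K where K: "\<And>r. r \<in> {x..y} \<Longrightarrow> \<bar>w r\<bar> \<le> K" "\<And>r. r \<in> {x..y} \<Longrightarrow> \<bar>w' r\<bar> \<le> K"
  proof -
    obtain K1 K2 where "\<forall>r\<in>{x..y}. \<bar>w r\<bar> \<le> K1" "\<forall>r\<in>{x..y}. \<bar>w' r\<bar> \<le> K2"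
      using compact_imp_bounded[OF compact_continuous_image[OF wc]] compact_imp_bounded[OF compact_continuous_image[OF w'c]]
      by (auto simp: bounded_iff)
    then show ?thesis by (intro that[of "max K1 K2"]) (auto simp: le_max_iff_disj)
  qed
  have K0: "0 \<le> K" using K(1)[of x] xy by auto
  have M0: "0 \<le> M" using M(3)[of 0] by linarith
  define W where "W r = indicator {x..y} r *\<^sub>R w r" for r
  define W' where "W' r = indicator {x..y} r *\<^sub>R w' r" for r
  have [measurable]: "W \<in> borel_measurable borel" "W' \<in> borel_measurable borel"
    unfolding W_def[abs_def] W'_def[abs_def]
    by (intro borel_measurable_continuous_on_indicator wc w'c, simp)+
  note [measurable] = M(1,2)
  have WK: "\<bar>W r\<bar> \<le> K" "\<bar>W' r\<bar> \<le> K" for r using K K0 by (auto simp: W_def W'_def indicator_def)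
  have int: "integrable lborel (\<lambda>r. r ^ (N + 1) * (W' r * g' r - B r * (W r * g r)))"
  proof (rule weighted_integrable(3)[OF xy(1,3), where C="K * M"])
    show "(\<lambda>r. W r * g r) \<in> borel_measurable borel" "(\<lambda>r. W' r * g' r) \<in> borel_measurable borel"
      by measurable
    show "\<bar>W r * g r\<bar> \<le> K * M" "\<bar>W' r * g' r\<bar> \<le> K * M" for r
      unfolding abs_mult using WK[of r] M(3,4)[of r] K0 by (auto intro!: mult_mono)
  qed (auto simp: W_def W'_def)
  define I where "I = (LINT r|lborel. r ^ (N + 1) * (W' r * g' r - B r * (W r * g r)))"
  have "((\<lambda>r. r ^ (N + 1) * (W' r * g' r - B r * (W r * g r))) has_integral I) UNIV"
    unfolding I_def by (rule has_integral_integral_lborel[OF int])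
  also have "(\<lambda>r. r ^ (N + 1) * (W' r * g' r - B r * (W r * g r))) = (\<lambda>r. if r \<in> {x..y} then ?F r else 0)"
    by (auto simp: W_def W'_def)
  finally have 1: "(?F has_integral I) {x..y}"
    by (simp only: has_integral_restrict_UNIV)
  have S: "finite S" "continuous_on UNIV g" "\<And>r. r \<notin> S \<Longrightarrow> (g has_real_derivative g' r) (at r)"
    using g by (auto simp: admissible_def)
  have 2: "(?F has_integral (y ^ (N + 1) * w' y * g y - x ^ (N + 1) * w' x * g x)) {x..y}"
  proof (rule fundamental_theorem_of_calculus_interior_strong[of "S \<union> (Z \<inter> {x..y})"])
    show "finite (S \<union> (Z \<inter> {x..y}))" using S Zf xy by auto
    show "continuous_on {x..y} (\<lambda>r. r ^ (N + 1) * w' r * g r)"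
      by (intro continuous_intros w'c continuous_on_subset[OF S(2)]) auto
    fix r assume r: "r \<in> {x<..<y} - (S \<union> (Z \<inter> {x..y}))"
    have "((\<lambda>r. (r ^ (N + 1) * w' r) * g r) has_real_derivative
      (- (r ^ (N + 1) * (B r * w r))) * g r + g' r * (r ^ (N + 1) * w' r)) (at r)"
      by (rule DERIV_mult[OF P S(3)]) (use r xy in auto)
    then show "((\<lambda>r. r ^ (N + 1) * w' r * g r) has_vector_derivative ?F r) (at r)"
      unfolding has_real_derivative_iff_has_vector_derivative[symmetric] by (rule DERIV_cong) (simp add: algebra_simps)
  qed (use xy in auto)
  have "b f f' g g' = I"
    unfolding bform_def I_def
  proof (rule integral_cong_AE)
    have eq: "r ^ (N + 1) * (f' r * g' r - B r * (f r * g r)) = r ^ (N + 1) * (W' r * g' r - B r * (W r * g r))"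
      if "r \<noteq> x" "r \<noteq> y" for r
      using f[of r] f'[of r] that by (auto simp: W_def W'_def indicator_def)
    show ae: "AE r in lborel. r ^ (N + 1) * (f' r * g' r - B r * (f r * g r)) = r ^ (N + 1) * (W' r * g' r - B r * (W r * g r))"
      using AE_lborel_singleton[of x] AE_lborel_singleton[of y] by eventually_elim (use eq in blast)
    show m: "(\<lambda>r. r ^ (N + 1) * (W' r * g' r - B r * (W r * g r))) \<in> borel_measurable lborel"
      using int by (rule borel_measurable_integrable)
    show "(\<lambda>r. r ^ (N + 1) * (f' r * g' r - B r * (f r * g r))) \<in> borel_measurable lborel"
    proof (rule measurable_discrete_difference[OF m, of "{x, y}"])
      fix r assume "r \<in> space lborel" "r \<notin> {x, y}"
      then show "r ^ (N + 1) * (W' r * g' r - B r * (W r * g r)) = r ^ (N + 1) * (f' r * g' r - B r * (f r * g r))"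
        by (intro eq[of r, symmetric]) auto
    qed auto
  qed
  then show ?thesis using has_integral_unique[OF 1 2] by simp
qed

text \<open>The restriction of \<open>w\<close> to an interval; continuous if \<open>w\<close> vanishes at both ends.\<close>

definition "piece x y r = (if x < r \<and> r < y then w r else 0)"
definition "piece' x y r = (if x < r \<and> r < y then w' r else 0)"

lemma piece_admissible:
  assumes xy: "lo < x" "x < y" "y < hi" and 0: "w x = 0" "w y = 0"
  shows "admissible x y {x, y} (piece x y) (piece' x y)"
proof -
  have wc: "continuous_on {x..y} w"
    using xy by (intro continuous_at_imp_continuous_on) (auto intro!: DERIV_isCont[OF w])
  have w'c1: "continuous_on {x..y} w'" by (rule continuous_on_subset[OF w'c]) (use xy in auto)
  have c: "continuous_on ({x..y} \<union> ({..x} \<union> {y..})) (piece x y)"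
  proof (rule continuous_on_closed_Un)
    show "continuous_on {x..y} (piece x y)"
      by (rule continuous_on_eq[OF wc]) (use 0 in \<open>auto simp: piece_def order_le_less\<close>)
    show "continuous_on ({..x} \<union> {y..}) (piece x y)"
      by (rule continuous_on_eq[OF continuous_on_const[of _ 0]]) (auto simp: piece_def)
  qed auto
  have c': "continuous_on ({x<..<y} \<union> ({..<x} \<union> {y<..})) (piece' x y)"
  proof (rule continuous_on_open_Un)
    show "continuous_on {x<..<y} (piece' x y)"
      by (rule continuous_on_eq[OF continuous_on_subset[OF w'c1]]) (auto simp: piece'_def)
    show "continuous_on ({..<x} \<union> {y<..}) (piece' x y)"
      by (rule continuous_on_eq[OF continuous_on_const[of _ 0]]) (auto simp: piece'_def)
  qed auto
  have U: "{x..y} \<union> ({..x} \<union> {y..}) = UNIV" "{x<..<y} \<union> ({..<x} \<union> {y<..}) = - {x, y}" using xy by auto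
  have d: "(piece x y has_real_derivative piece' x y r) (at r)" if "r \<notin> {x, y}" for r
  proof (cases "x < r \<and> r < y")
    case True
    have "(w has_real_derivative w' r) (at r)" using True xy by (intro w) auto
    then have "(piece x y has_real_derivative w' r) (at r)"
      by (rule has_field_derivative_transform_within_open[where S="{x<..<y}"]) (use True in \<open>auto simp: piece_def\<close>)
    then show ?thesis using True by (simp add: piece'_def)
  next
    case False
    have "((\<lambda>_. 0) has_real_derivative 0) (at r)" by simp
    then have "(piece x y has_real_derivative 0) (at r)"
      by (rule has_field_derivative_transform_within_open[where S="{..<x} \<union> {y<..}"]) (use False that in \<open>auto simp: piece_def\<close>)
    moreover have "piece' x y r = 0" using False by (auto simp: piece'_def)
    ultimately show ?thesis by simp
  qed
  obtain K where "\<forall>r\<in>{x..y}. \<bar>w' r\<bar> \<le> K"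
    using compact_imp_bounded[OF compact_continuous_image[OF w'c1]] by (auto simp: bounded_iff)
  then have K: "\<bar>w' r\<bar> \<le> \<bar>K\<bar>" if "x < r" "r < y" for r
    using that by (meson abs_ge_self atLeastAtMost_iff less_imp_le order_trans)
  have "\<bar>piece' x y r\<bar> \<le> \<bar>K\<bar>" for r using K[of r] by (simp add: piece'_def)
  then have "bounded (range (piece' x y))" by (auto simp: bounded_iff)
  with c c' d show ?thesis unfolding U by (auto simp: admissible_def piece_def piece'_def)
qed

lemma b_piece_self:
  assumes xy: "lo < x" "x < y" "y < hi" and 0: "w x = 0" "w y = 0"
  shows "b (piece x y) (piece' x y) (piece x y) (piece' x y) = 0"
  using b_piece[OF xy(1) less_imp_le[OF xy(2)] xy(3) xy(1,3) piece_admissible[OF assms], of "piece x y" "piece' x y"]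
  by (simp add: piece_def piece'_def)

end

context sturm
begin

text \<open>Let \<open>\<eta> i\<close> be \<open>w\<close> restricted to the interval between the consecutive zeros \<open>t i\<close> and \<open>t (Suc i)\<close>. The form vanishes
on the span of these functions. They have kinks at the zeros, where the flux \<open>r ^ (N + 1) w'\<close> is not
0, so the boundary terms in \<open>b_piece\<close> can be prescribed: there are bumps \<open>\<zeta> j\<close> around the zeros such that
\<open>b (\<eta> i) (\<zeta> j)\<close> is \<open>- 1\<close> for \<open>i = j\<close> and 0 otherwise. Adding \<open>\<epsilon> * \<zeta> j\<close> to \<open>\<eta> j\<close> changes the form by \<open>- 2 \<epsilon>\<close> times the
identity, up to order \<open>\<epsilon>\<^sup>2\<close>.

The first function is only assumed to agree with \<open>w\<close> to the right of \<open>t 0\<close> and to have a small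
form value: near the origin of a ball, \<open>w\<close> has to be cut off instead of being stopped at a zero.\<close>

lemma negative_directions:
  fixes t :: "nat \<Rightarrow> real"
  assumes d: "0 < d" and mono: "\<And>i. i < d \<Longrightarrow> t i < t (Suc i)" and t0: "lo < t 0" and td: "t d < hi"
    and zero: "\<And>i. 1 \<le> i \<Longrightarrow> i \<le> d \<Longrightarrow> w (t i) = 0" "\<And>i. 1 \<le> i \<Longrightarrow> i \<le> d \<Longrightarrow> w' (t i) \<noteq> 0"
    and first: "\<And>\<kappa>. 0 < \<kappa> \<Longrightarrow> \<exists>\<alpha> S \<eta> \<gamma>. lo < \<alpha> \<and> admissible \<alpha> (t 1) S \<eta> \<gamma> \<and>
      (\<forall>r. t 0 < r \<and> r < t 1 \<longrightarrow> \<eta> r = w r \<and> \<gamma> r = w' r) \<and> \<eta> (t 1) = 0 \<and> \<gamma> (t 1) = 0 \<and> \<bar>b \<eta> \<gamma> \<eta> \<gamma>\<bar> \<le> \<kappa>"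
  obtains \<alpha> \<beta> S e e' \<epsilon> where "lo < \<alpha>" "\<alpha> < \<beta>" "\<beta> < hi" "0 < \<epsilon>"
    "\<And>j. j < d \<Longrightarrow> admissible \<alpha> \<beta> S (e j) (e' j)"
    "\<And>i j. i < d \<Longrightarrow> j < d \<Longrightarrow> \<bar>b (e i) (e' i) (e j) (e' j) + (if i = j then 2 * \<epsilon> else 0)\<bar> \<le> \<epsilon> / (2 * real d)"
proof -
  obtain \<delta> where \<delta>: "0 < \<delta>" "\<And>i. i < d \<Longrightarrow> \<delta> \<le> t (Suc i) - t i" "t d + \<delta> < hi"
  proof -
    let ?G = "(\<lambda>i. t (Suc i) - t i) ` {..<d}"
    have G: "finite ?G" "?G \<noteq> {}" "\<And>x. x \<in> ?G \<Longrightarrow> 0 < x" using d mono by auto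
    define \<delta> where "\<delta> = min ((hi - t d) / 2) (Min ?G)"
    have "0 < Min ?G" using G by (simp add: Min_gr_iff)
    then have "0 < \<delta>" using td by (simp add: \<delta>_def)
    moreover have "\<delta> \<le> t (Suc i) - t i" if "i < d" for i
    proof -
      have "Min ?G \<le> t (Suc i) - t i" by (rule Min_le) (use G that in auto)
      then show ?thesis by (simp add: \<delta>_def)
    qed
    moreover have "\<delta> \<le> (hi - t d) / 2" unfolding \<delta>_def by (rule min.cobounded1)
    then have "t d + \<delta> < hi" using td by (simp add: field_simps)
    ultimately show ?thesis using that by blast
  qed
  have gap: "t i + \<delta> \<le> t j" if "i < j" "j \<le> d" for i j
    using that
  proof (induction j)
    case (Suc j)
    have "t j + \<delta> \<le> t (Suc j)" using \<delta>(2)[of j] Suc by simp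
    moreover have "i = j \<or> t i + \<delta> \<le> t j" using Suc by (cases "i = j") auto
    ultimately show ?case using \<delta>(1) by auto
  qed simp
  have le: "t i \<le> t j" if "i \<le> j" "j \<le> d" for i j
    using gap[of i j] that \<delta>(1) by (cases "i = j") auto
  define P where "P i = t i ^ (N + 1) * w' (t i)" for i
  have P0: "P i \<noteq> 0" if "1 \<le> i" "i \<le> d" for i
  proof -
    have "0 < t i" using le[of 0 i] that t0 lo by auto
    then show ?thesis using zero(2)[OF that] by (simp add: P_def)
  qed
  (* the bump at t i contributes - 1 to P times the profile at t i exactly for i > j,
     so the boundary terms at the two ends of an interval cancel unless it is the j-th one *)
  define \<zeta> where "\<zeta> j r = (\<Sum>i\<in>{j<..d}. (- 1 / P i) * bump (t i) \<delta> r)" for j r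
  define \<zeta>' where "\<zeta>' j r = (\<Sum>i\<in>{j<..d}. (- 1 / P i) * bump' (t i) \<delta> r)" for j r
  have bz: "bump (t i) \<delta> r = 0 \<and> bump' (t i) \<delta> r = 0" if "\<delta> \<le> \<bar>r - t i\<bar>" for i r
    using bump_zero[OF \<delta>(1) that] by simp
  have zlow: "\<zeta> j r = 0" "\<zeta>' j r = 0" if "r \<le> t 0" for j r
  proof -
    have "\<delta> \<le> \<bar>r - t i\<bar>" if "i \<in> {j<..d}" for i using gap[of 0 i] that \<open>r \<le> t 0\<close> by auto
    then show "\<zeta> j r = 0" "\<zeta>' j r = 0" using bz by (auto simp: \<zeta>_def \<zeta>'_def intro!: sum.neutral)
  qed
  have zhigh: "\<zeta> j r = 0" "\<zeta>' j r = 0" if "r > t d + \<delta>" for j r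
  proof -
    have "\<delta> \<le> \<bar>r - t i\<bar>" if "i \<in> {j<..d}" for i using le[of i d] that \<open>r > t d + \<delta>\<close> by auto
    then show "\<zeta> j r = 0" "\<zeta>' j r = 0" using bz by (auto simp: \<zeta>_def \<zeta>'_def intro!: sum.neutral)
  qed
  have zadm: "admissible (t 0) (t d + \<delta>) {} (\<zeta> j) (\<zeta>' j)" for j
  proof (rule admissible_smooth)
    show "(\<zeta> j has_real_derivative \<zeta>' j r) (at r)" for r
      unfolding \<zeta>_def[abs_def] \<zeta>'_def by (intro DERIV_sum DERIV_cmult bump_deriv)
    show "continuous_on UNIV (\<zeta>' j)" unfolding \<zeta>'_def[abs_def] by (intro continuous_intros bump_cont)
    show "\<zeta> j r = 0" "\<zeta>' j r = 0" if "r \<notin> {t 0..t d + \<delta>}" for r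
      using that zlow[of r j] zhigh[of r j] by auto
  qed
  have zt: "P k * \<zeta> j (t k) = (if j < k then -1 else 0)" if "k \<le> d" for j k
  proof -
    have "\<zeta> j (t k) = (\<Sum>i\<in>{j<..d}. if i = k then - 1 / P k else 0)"
      unfolding \<zeta>_def
    proof (rule sum.cong)
      fix i assume i: "i \<in> {j<..d}"
      show "(- 1 / P i) * bump (t i) \<delta> (t k) = (if i = k then - 1 / P k else 0)"
      proof (cases "i = k")
        case False
        then have "\<delta> \<le> \<bar>t k - t i\<bar>" using gap[of i k] gap[of k i] i that by (cases i k rule: linorder_cases) auto
        then show ?thesis using False bz by simp
      qed (simp add: bump_center)
    qed simp
    also have "\<dots> = (if j < k then - 1 / P k else 0)" using that by auto
    finally show ?thesis using P0[of k] that by auto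
  qed
  define M where "M = (\<Sum>i<d. \<Sum>j<d. \<bar>b (\<zeta> i) (\<zeta>' i) (\<zeta> j) (\<zeta>' j)\<bar>)"
  have M: "\<bar>b (\<zeta> i) (\<zeta>' i) (\<zeta> j) (\<zeta>' j)\<bar> \<le> M" if "i < d" "j < d" for i j
  proof -
    have "\<bar>b (\<zeta> i) (\<zeta>' i) (\<zeta> j) (\<zeta>' j)\<bar> \<le> (\<Sum>j<d. \<bar>b (\<zeta> i) (\<zeta>' i) (\<zeta> j) (\<zeta>' j)\<bar>)"
      by (rule member_le_sum[of j "{..<d}" "\<lambda>j. \<bar>b (\<zeta> i) (\<zeta>' i) (\<zeta> j) (\<zeta>' j)\<bar>"]) (use that in auto)
    also have "\<dots> \<le> M" unfolding M_def
      by (rule member_le_sum[of i "{..<d}" "\<lambda>i. \<Sum>j<d. \<bar>b (\<zeta> i) (\<zeta>' i) (\<zeta> j) (\<zeta>' j)\<bar>"])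
         (use that in \<open>auto intro: sum_nonneg\<close>)
    finally show ?thesis .
  qed
  have M0: "0 \<le> M" unfolding M_def by (intro sum_nonneg) auto
  (* the second order terms, of size at most \<epsilon> * (\<epsilon> * M), must not exceed \<epsilon> / (4 d) *)
  define \<epsilon> where "\<epsilon> = 1 / (4 * d * (M + 1))"
  have \<epsilon>: "0 < \<epsilon>" using d M0 by (simp add: \<epsilon>_def)
  have \<epsilon>M: "\<epsilon> * M \<le> 1 / (4 * d)"
  proof -
    have "M / (M + 1) \<le> 1" using M0 by simp
    then have "1 / (4 * d) * (M / (M + 1)) \<le> 1 / (4 * d) * 1" by (intro mult_left_mono) auto
    then show ?thesis by (simp add: \<epsilon>_def)
  qed
  have "0 < \<epsilon> / (4 * d)" using \<epsilon> d by simp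
  from first[OF this] obtain \<alpha>0 S0 \<eta>0 \<gamma>0 where f: "lo < \<alpha>0" "admissible \<alpha>0 (t 1) S0 \<eta>0 \<gamma>0"
    "\<And>r. t 0 < r \<Longrightarrow> r < t 1 \<Longrightarrow> \<eta>0 r = w r" "\<And>r. t 0 < r \<Longrightarrow> r < t 1 \<Longrightarrow> \<gamma>0 r = w' r"
    "\<eta>0 (t 1) = 0" "\<gamma>0 (t 1) = 0" "\<bar>b \<eta>0 \<gamma>0 \<eta>0 \<gamma>0\<bar> \<le> \<epsilon> / (4 * d)" by metis
  define \<alpha> where "\<alpha> = min \<alpha>0 (t 0)"
  define \<beta> where "\<beta> = t d + \<delta>"
  define S where "S = S0 \<union> t ` {..d}"
  have S0: "finite S0" using f(2) by (simp add: admissible_def)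
  then have S: "finite S" by (simp add: S_def)
  have ab: "lo < \<alpha>" "\<beta> < hi" using f(1) t0 \<delta>(3) by (auto simp: \<alpha>_def \<beta>_def)
  have \<alpha>\<beta>: "\<alpha> < \<beta>" using le[of 0 d] \<delta>(1) by (auto simp: \<alpha>_def \<beta>_def min_def)
  define \<eta> where "\<eta> i = (if i = 0 then \<eta>0 else piece (t i) (t (Suc i)))" for i
  define \<gamma> where "\<gamma> i = (if i = 0 then \<gamma>0 else piece' (t i) (t (Suc i)))" for i
  have wi: "lo < t i" "t i < hi" if "i \<le> d" for i
    using le[of 0 i] le[of i d] that t0 td by auto
  have eadm: "admissible \<alpha> \<beta> S (\<eta> i) (\<gamma> i)" if i: "i < d" for i
  proof (cases "i = 0")
    case True
    show ?thesis unfolding \<eta>_def \<gamma>_def using True le[of 1 d] d \<delta>(1)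
      by (auto intro!: admissible_mono[OF f(2)] S0 simp: \<alpha>_def \<beta>_def S_def)
  next
    case False
    have "admissible (t i) (t (Suc i)) {t i, t (Suc i)} (piece (t i) (t (Suc i))) (piece' (t i) (t (Suc i)))"
      using i False mono[OF i] zero(1)[of i] zero(1)[of "Suc i"] wi[of i] wi[of "Suc i"] by (intro piece_admissible) auto
    then have "admissible \<alpha> \<beta> S (piece (t i) (t (Suc i))) (piece' (t i) (t (Suc i)))"
      by (rule admissible_mono) (use i le[of 0 i] le[of "Suc i" d] \<delta>(1) S in \<open>auto simp: \<alpha>_def \<beta>_def S_def\<close>)
    then show ?thesis using False by (simp add: \<eta>_def \<gamma>_def)
  qed
  have zadm': "admissible \<alpha> \<beta> S (\<zeta> j) (\<zeta>' j)" for j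
    by (rule admissible_mono[OF zadm]) (use S in \<open>auto simp: \<alpha>_def \<beta>_def\<close>)
  have eupper: "\<eta> i r = 0 \<and> \<gamma> i r = 0" if "t (Suc i) \<le> r" "i < d" for i r
  proof (cases "i = 0")
    case True
    then show ?thesis using that f(2,5,6) by (cases "r = t 1") (auto simp: \<eta>_def \<gamma>_def admissible_def)
  qed (use that in \<open>auto simp: \<eta>_def \<gamma>_def piece_def piece'_def\<close>)
  have elower: "\<eta> i r = 0 \<and> \<gamma> i r = 0" if "r \<le> t i" "0 < i" for i r
    using that by (auto simp: \<eta>_def \<gamma>_def piece_def piece'_def)
  have b1: "b (\<eta> i) (\<gamma> i) (\<eta> j) (\<gamma> j) = 0" if ij: "i < j" "j < d" for i j
  proof -
    have "\<gamma> i r * \<gamma> j r = 0 \<and> \<eta> i r * \<eta> j r = 0" for r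
      using eupper[of i r] elower[of r j] le[of "Suc i" j] ij by (cases "r \<le> t j") auto
    then have "(\<lambda>r. r ^ (N + 1) * (\<gamma> i r * \<gamma> j r - B r * (\<eta> i r * \<eta> j r))) = (\<lambda>r. 0)" by (simp only: fun_eq_iff) simp
    then show ?thesis unfolding bform_def by simp
  qed
  have b2: "\<bar>b (\<eta> i) (\<gamma> i) (\<eta> j) (\<gamma> j)\<bar> \<le> \<epsilon> / (4 * d)" if ij: "i < d" "j < d" for i j
  proof (cases i j rule: linorder_cases)
    case less then show ?thesis using b1[of i j] ij \<epsilon> by simp
  next
    case greater then show ?thesis using b1[of j i] ij \<epsilon> by (simp add: bform_commute)
  next
    case equal
    show ?thesis
    proof (cases "i = 0")
      case False
      have "b (\<eta> i) (\<gamma> i) (\<eta> i) (\<gamma> i) = 0"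
        using b_piece_self[of "t i" "t (Suc i)"] ij False mono[of i] zero(1)[of i] zero(1)[of "Suc i"] wi[of i] wi[of "Suc i"]
        by (simp add: \<eta>_def \<gamma>_def)
      then show ?thesis using equal \<epsilon> by simp
    qed (use equal f(7) in \<open>simp add: \<eta>_def \<gamma>_def\<close>)
  qed
  have b3: "b (\<eta> i) (\<gamma> i) (\<zeta> j) (\<zeta>' j) = (if i = j then -1 else 0)" if i: "i < d" for i j
  proof -
    have "b (\<eta> i) (\<gamma> i) (\<zeta> j) (\<zeta>' j) = t (Suc i) ^ (N + 1) * w' (t (Suc i)) * \<zeta> j (t (Suc i)) - t i ^ (N + 1) * w' (t i) * \<zeta> j (t i)"
    proof (rule b_piece[OF _ _ _ ab zadm'])
      show "lo < t i" "t (Suc i) < hi" "t i \<le> t (Suc i)" using wi i mono[OF i] by auto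
      show "\<eta> i r = (if t i < r \<and> r < t (Suc i) then w r else 0) \<or> (\<zeta> j r = 0 \<and> \<zeta>' j r = 0)" for r
        using zlow[of r j] f(3)[of r] eupper[of i r] i by (cases "i = 0") (auto simp: \<eta>_def piece_def not_less)
      show "\<gamma> i r = (if t i < r \<and> r < t (Suc i) then w' r else 0) \<or> (\<zeta> j r = 0 \<and> \<zeta>' j r = 0)" for r
        using zlow[of r j] f(4)[of r] eupper[of i r] i by (cases "i = 0") (auto simp: \<gamma>_def piece'_def not_less)
    qed
    also have "\<dots> = P (Suc i) * \<zeta> j (t (Suc i)) - P i * \<zeta> j (t i)" by (simp add: P_def)
    also have "\<dots> = (if i = j then -1 else 0)" using zt[of i j] zt[of "Suc i" j] i by auto
    finally show ?thesis .
  qed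
  define e where "e j r = \<eta> j r + \<epsilon> * \<zeta> j r" for j r
  define e' where "e' j r = \<gamma> j r + \<epsilon> * \<zeta>' j r" for j r
  have adm: "admissible \<alpha> \<beta> S (e j) (e' j)" if "j < d" for j
    unfolding e_def[abs_def] e'_def[abs_def] by (rule admissible_add[OF eadm[OF that] zadm'])
  have "\<bar>b (e i) (e' i) (e j) (e' j) + (if i = j then 2 * \<epsilon> else 0)\<bar> \<le> \<epsilon> / (2 * real d)" if ij: "i < d" "j < d" for i j
  proof -
    have lin: "b (e k) (e' k) g g' = b (\<eta> k) (\<gamma> k) g g' + \<epsilon> * b (\<zeta> k) (\<zeta>' k) g g'"
      if "admissible \<alpha> \<beta> S g g'" "k < d" for k g g'
      unfolding e_def[abs_def] e'_def[abs_def] by (rule b_add[OF ab eadm[OF that(2)] zadm' that(1)])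
    have "b (e i) (e' i) (e j) (e' j) = b (\<eta> i) (\<gamma> i) (e j) (e' j) + \<epsilon> * b (\<zeta> i) (\<zeta>' i) (e j) (e' j)"
      by (rule lin[OF adm[OF ij(2)] ij(1)])
    also have "\<dots> = b (e j) (e' j) (\<eta> i) (\<gamma> i) + \<epsilon> * b (e j) (e' j) (\<zeta> i) (\<zeta>' i)"
      by (simp add: bform_commute)
    also have "\<dots> = b (\<eta> j) (\<gamma> j) (\<eta> i) (\<gamma> i) + \<epsilon> * b (\<zeta> j) (\<zeta>' j) (\<eta> i) (\<gamma> i)
        + \<epsilon> * (b (\<eta> j) (\<gamma> j) (\<zeta> i) (\<zeta>' i) + \<epsilon> * b (\<zeta> j) (\<zeta>' j) (\<zeta> i) (\<zeta>' i))"
      by (simp add: lin[OF eadm[OF ij(1)] ij(2)] lin[OF zadm' ij(2)])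
    also have "b (\<zeta> j) (\<zeta>' j) (\<eta> i) (\<gamma> i) = (if i = j then -1 else 0)" by (subst bform_commute) (rule b3[OF ij(1)])
    also have "b (\<eta> j) (\<gamma> j) (\<zeta> i) (\<zeta>' i) = (if i = j then -1 else 0)" using b3[OF ij(2), of i] by auto
    finally have "b (e i) (e' i) (e j) (e' j) + (if i = j then 2 * \<epsilon> else 0)
      = b (\<eta> j) (\<gamma> j) (\<eta> i) (\<gamma> i) + \<epsilon> * (\<epsilon> * b (\<zeta> j) (\<zeta>' j) (\<zeta> i) (\<zeta>' i))"
      by (auto simp: algebra_simps)
    moreover have "\<bar>\<epsilon> * (\<epsilon> * b (\<zeta> j) (\<zeta>' j) (\<zeta> i) (\<zeta>' i))\<bar> \<le> \<epsilon> * (1 / (4 * d))"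
    proof -
      have "\<epsilon> * \<bar>b (\<zeta> j) (\<zeta>' j) (\<zeta> i) (\<zeta>' i)\<bar> \<le> \<epsilon> * M" using M[OF ij(2,1)] \<epsilon> by (intro mult_left_mono) auto
      then have "\<epsilon> * \<bar>b (\<zeta> j) (\<zeta>' j) (\<zeta> i) (\<zeta>' i)\<bar> \<le> 1 / (4 * d)" using \<epsilon>M by linarith
      then show ?thesis unfolding abs_mult using \<epsilon> by (intro mult_mono) auto
    qed
    moreover have "\<epsilon> * (1 / (4 * d)) = \<epsilon> / (4 * d)" "\<epsilon> / (4 * d) + \<epsilon> / (4 * d) = \<epsilon> / (2 * real d)" by simp_all
    ultimately show ?thesis using b2[OF ij(2,1)] by linarith
  qed
  with ab \<alpha>\<beta> \<epsilon> adm that show ?thesis by blast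
qed

text \<open>Negative definiteness is an open condition on the matrix of the form, and the entries are continuous
under the convergence provided by \<open>smooth_approximation\<close>.\<close>

lemma smooth_negative_directions:
  assumes d: "0 < d" and ab: "lo < \<alpha>'" "\<alpha>' < \<beta>'" "\<beta>' < hi" and \<epsilon>: "0 < \<epsilon>"
    and adm: "\<And>j. j < d \<Longrightarrow> admissible \<alpha>' \<beta>' S (e j) (e' j)"
    and be: "\<And>i j. i < d \<Longrightarrow> j < d \<Longrightarrow> \<bar>b (e i) (e' i) (e j) (e' j) + (if i = j then 2 * \<epsilon> else 0)\<bar> \<le> \<epsilon> / (2 * real d)"
  obtains \<alpha> \<beta> and q p :: "nat \<Rightarrow> real \<Rightarrow> real" where "lo < \<alpha>" "\<alpha> < \<beta>" "\<beta> < hi"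
    "\<And>j. j < d \<Longrightarrow> real_polynomial_function (q j)" "\<And>j r. j < d \<Longrightarrow> (q j has_real_derivative p j r) (at r)"
    "\<And>j. j < d \<Longrightarrow> continuous_on UNIV (p j)"
    "\<And>c. \<exists>j<d. c j \<noteq> 0 \<Longrightarrow> qform N B (\<lambda>r. \<Sum>j<d. c j * (cutoff \<alpha> \<beta> r * q j r))
        (\<lambda>r. \<Sum>j<d. c j * (cutoff' \<alpha> \<beta> r * q j r + cutoff \<alpha> \<beta> r * p j r)) < 0"
proof -
  define \<alpha> where "\<alpha> = (lo + \<alpha>') / 2"
  define \<beta> where "\<beta> = (\<beta>' + hi) / 2"
  have \<alpha>: "lo < \<alpha>" "0 < \<alpha>" "\<alpha> < \<alpha>'" using ab lo by (auto simp: \<alpha>_def)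
  have \<beta>: "\<beta> < hi" "\<beta>' < \<beta>" using ab by (auto simp: \<beta>_def)
  have \<alpha>\<beta>: "\<alpha> < \<beta>" using \<alpha> \<beta> ab by linarith
  define A where "A j q p C \<longleftrightarrow> (\<forall>m. real_polynomial_function (q m)) \<and> (\<forall>m r. (q m has_real_derivative p m r) (at r)) \<and>
    (\<forall>m. continuous_on UNIV (p m)) \<and>
    (\<forall>r. (\<lambda>m. cutoff \<alpha> \<beta> r * q m r) \<longlonglongrightarrow> e j r) \<and>
    (\<forall>r. r \<notin> S \<longrightarrow> (\<lambda>m. cutoff' \<alpha> \<beta> r * q m r + cutoff \<alpha> \<beta> r * p m r) \<longlonglongrightarrow> e' j r) \<and>
    (\<forall>m r. \<bar>cutoff \<alpha> \<beta> r * q m r\<bar> \<le> C) \<and> (\<forall>m r. \<bar>cutoff' \<alpha> \<beta> r * q m r + cutoff \<alpha> \<beta> r * p m r\<bar> \<le> C)"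
    for j :: nat and q p :: "nat \<Rightarrow> real \<Rightarrow> real" and C :: real
  have ex: "\<exists>q p C. A j q p C" if "j < d" for j
  proof (rule smooth_approximation[OF \<alpha>(2,3) less_imp_le[OF ab(2)] \<beta>(2) adm[OF that]])
    fix q p C
    assume A: "\<And>m. real_polynomial_function (q m)" "\<And>m r. (q m has_real_derivative p m r) (at r)"
      "\<And>m. continuous_on UNIV (p m)" "\<And>r. (\<lambda>m. cutoff \<alpha> \<beta> r * q m r) \<longlonglongrightarrow> e j r"
      "\<And>r. r \<notin> S \<Longrightarrow> (\<lambda>m. cutoff' \<alpha> \<beta> r * q m r + cutoff \<alpha> \<beta> r * p m r) \<longlonglongrightarrow> e' j r"
      "\<And>m r. \<bar>cutoff \<alpha> \<beta> r * q m r\<bar> \<le> C"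
      "\<And>m r. \<bar>cutoff' \<alpha> \<beta> r * q m r + cutoff \<alpha> \<beta> r * p m r\<bar> \<le> C"
    show ?thesis unfolding A_def
      by (intro exI[of _ q] exI[of _ p] exI[of _ C] conjI allI impI A)
  qed
  obtain q p C where qpC: "\<And>j. j < d \<Longrightarrow> A j (q j) (p j) (C j)"
    using ex by metis
  define s where "s j m r = cutoff \<alpha> \<beta> r * q j m r" for j :: nat and m :: nat and r
  define s' where "s' j m r = cutoff' \<alpha> \<beta> r * q j m r + cutoff \<alpha> \<beta> r * p j m r" for j :: nat and m :: nat and r
  have q: "real_polynomial_function (q j m)" "(q j m has_real_derivative p j m r) (at r)" "continuous_on UNIV (p j m)"
    and sl: "(\<lambda>m. s j m r) \<longlonglongrightarrow> e j r" "r \<notin> S \<Longrightarrow> (\<lambda>m. s' j m r) \<longlonglongrightarrow> e' j r"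
    and sC: "\<bar>s j m r\<bar> \<le> C j" "\<bar>s' j m r\<bar> \<le> C j" if "j < d" for j m r
    using qpC[OF that] unfolding A_def s_def s'_def by blast+
  have sd: "(s j m has_real_derivative s' j m r) (at r)" if "j < d" for j m r
    unfolding s_def[abs_def] s'_def
    by (rule DERIV_cong[OF DERIV_mult[OF cutoff_deriv[OF \<alpha>(2) \<alpha>\<beta>] q(2)[OF that]]]) simp
  have cc: "continuous_on UNIV (cutoff \<alpha> \<beta>)"
    using cutoff_deriv[OF \<alpha>(2) \<alpha>\<beta>] by (meson DERIV_isCont continuous_at_imp_continuous_on)
  have qc: "continuous_on UNIV (q j m)" if "j < d" for j m
    using q(2)[OF that] by (meson DERIV_isCont continuous_at_imp_continuous_on)
  have s'c: "continuous_on UNIV (s' j m)" if "j < d" for j m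
    unfolding s'_def[abs_def] by (intro continuous_intros cc cutoff'_cont[OF \<alpha>(2) \<alpha>\<beta>] qc q(3) that)
  have sz: "s j m r = 0" "s' j m r = 0" if "r \<notin> {\<alpha>..\<beta>}" for j m r
  proof -
    have "r \<notin> {\<alpha><..<\<beta>}" using that by auto
    then show "s j m r = 0" "s' j m r = 0" using cutoff_zero[OF \<alpha>(2) \<alpha>\<beta>, of r] by (auto simp: s_def s'_def)
  qed
  have sadm: "admissible \<alpha> \<beta> {} (s j m) (s' j m)" if "j < d" for j m
    by (rule admissible_smooth[OF sd[OF that] s'c[OF that] sz])
  have bconv: "(\<lambda>m. b (s i m) (s' i m) (s j m) (s' j m)) \<longlonglongrightarrow> b (e i) (e' i) (e j) (e' j)" if ij: "i < d" "j < d" for i j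
  proof -
    have bd: "\<bar>s i m r * s j m r\<bar> \<le> C i * C j" "\<bar>s' i m r * s' j m r\<bar> \<le> C i * C j" for m r
    proof -
      have "0 \<le> C i" using sC(1)[OF ij(1), of 0 0] by linarith
      then show "\<bar>s i m r * s j m r\<bar> \<le> C i * C j" "\<bar>s' i m r * s' j m r\<bar> \<le> C i * C j"
        unfolding abs_mult using sC ij by (auto intro!: mult_mono)
    qed
    have m: "s i m \<in> borel_measurable borel" "s' i m \<in> borel_measurable borel" if "i < d" for i m
      using admissible_props[OF sadm[OF that]] by metis+
    note [measurable] = m[OF ij(1)] m[OF ij(2)]
    have me: "e i \<in> borel_measurable borel" "e' i \<in> borel_measurable borel" if "i < d" for i
      using admissible_props[OF adm[OF that]] by metis+
    note [measurable] = me[OF ij(1)] me[OF ij(2)] Bm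
    show ?thesis unfolding bform_def
    proof (rule integral_dominated_convergence)
      show "integrable lborel (\<lambda>r. \<beta> ^ (N + 1) * (C i * C j * indicator {\<alpha>..\<beta>} r + \<bar>indicator {\<alpha>..\<beta>} r *\<^sub>R B r\<bar> * (C i * C j)))"
        by (rule weighted_integrable(2)[OF \<alpha>(1) \<beta>(1), of "\<lambda>r. s i 0 r * s j 0 r" "\<lambda>r. s' i 0 r * s' j 0 r"])
           (auto simp: sz bd simp del: atLeastAtMost_iff)
      show "AE r in lborel. norm (r ^ (N + 1) * (s' i m r * s' j m r - B r * (s i m r * s j m r)))
         \<le> \<beta> ^ (N + 1) * (C i * C j * indicator {\<alpha>..\<beta>} r + \<bar>indicator {\<alpha>..\<beta>} r *\<^sub>R B r\<bar> * (C i * C j))" for m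
        unfolding real_norm_def
        by (intro AE_I2 weighted_integrable(1)[OF \<alpha>(1) \<beta>(1)]) (auto simp: sz bd simp del: atLeastAtMost_iff)
      have "S \<in> null_sets lborel" using adm[OF ij(1)] by (auto simp: admissible_def intro: finite_imp_null_set_lborel)
      then have "AE r in lborel. r \<notin> S" by (rule AE_not_in)
      then show "AE r in lborel. (\<lambda>m. r ^ (N + 1) * (s' i m r * s' j m r - B r * (s i m r * s j m r)))
          \<longlonglongrightarrow> r ^ (N + 1) * (e' i r * e' j r - B r * (e i r * e j r))"
        by eventually_elim (intro tendsto_intros sl ij)
    qed measurable
  qed
  have "\<forall>\<^sub>F m in sequentially. \<forall>i\<in>{..<d}. \<forall>j\<in>{..<d}. \<bar>b (s i m) (s' i m) (s j m) (s' j m) - b (e i) (e' i) (e j) (e' j)\<bar> < \<epsilon> / (2 * real d)"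
  proof (intro eventually_ball_finite finite_lessThan ballI)
    fix i j assume ij: "i \<in> {..<d}" "j \<in> {..<d}"
    have "0 < \<epsilon> / (2 * real d)" using \<epsilon> d by simp
    from tendstoD[OF bconv this] ij
    show "\<forall>\<^sub>F m in sequentially. \<bar>b (s i m) (s' i m) (s j m) (s' j m) - b (e i) (e' i) (e j) (e' j)\<bar> < \<epsilon> / (2 * real d)"
      by (simp add: dist_real_def)
  qed
  then obtain m where m: "\<And>i j. i < d \<Longrightarrow> j < d \<Longrightarrow> \<bar>b (s i m) (s' i m) (s j m) (s' j m) - b (e i) (e' i) (e j) (e' j)\<bar> < \<epsilon> / (2 * real d)"
    by (auto simp: eventually_sequentially)
  have near: "\<bar>b (s i m) (s' i m) (s j m) (s' j m) + (if i = j then 2 * \<epsilon> else 0)\<bar> \<le> \<epsilon> / d" if "i < d" "j < d" for i j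
  proof -
    have "\<epsilon> / (2 * real d) + \<epsilon> / (2 * real d) = \<epsilon> / d" by simp
    then show ?thesis using m[OF that] be[OF that] by linarith
  qed
  have neg: "qform N B (\<lambda>r. \<Sum>j<d. c j * s j m r) (\<lambda>r. \<Sum>j<d. c j * s' j m r) < 0" if c: "\<exists>j<d. c j \<noteq> 0" for c
  proof -
    have "qform N B (\<lambda>r. \<Sum>j<d. c j * s j m r) (\<lambda>r. \<Sum>j<d. c j * s' j m r)
      = (LINT r|lborel. (\<Sum>i<d. \<Sum>j<d. (c i * c j) * (r ^ (N + 1) * (s' i m r * s' j m r - B r * (s i m r * s j m r)))))"
      unfolding qform_def
    proof (rule Bochner_Integration.integral_cong)
      fix r
      have "r ^ (N + 1) * ((\<Sum>j<d. c j * s' j m r)\<^sup>2 - B r * (\<Sum>j<d. c j * s j m r)\<^sup>2) =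
        (\<Sum>i<d. \<Sum>j<d. r ^ (N + 1) * (c i * s' i m r * (c j * s' j m r)) - r ^ (N + 1) * (B r * (c i * s i m r * (c j * s j m r))))"
        unfolding power2_eq_square sum_product unfolding right_diff_distrib sum_distrib_left sum_subtractf ..
      also have "\<dots> = (\<Sum>i<d. \<Sum>j<d. (c i * c j) * (r ^ (N + 1) * (s' i m r * s' j m r - B r * (s i m r * s j m r))))"
        by (intro sum.cong refl) (simp add: algebra_simps)
      finally show "r ^ (N + 1) * ((\<Sum>j<d. c j * s' j m r)\<^sup>2 - B r * (\<Sum>j<d. c j * s j m r)\<^sup>2) =
        (\<Sum>i<d. \<Sum>j<d. (c i * c j) * (r ^ (N + 1) * (s' i m r * s' j m r - B r * (s i m r * s j m r))))" .
    qed simp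
    also have "\<dots> = (\<Sum>i<d. \<Sum>j<d. (c i * c j) * b (s i m) (s' i m) (s j m) (s' j m))"
    proof -
      have int: "integrable lborel (\<lambda>r. r ^ (N + 1) * (s' i m r * s' j m r - B r * (s i m r * s j m r)))" if "i < d" "j < d" for i j
        by (rule b_integrable[OF \<alpha>(1) \<beta>(1) sadm[OF that(1)] sadm[OF that(2)]])
      have "(LINT r|lborel. (\<Sum>i<d. \<Sum>j<d. (c i * c j) * (r ^ (N + 1) * (s' i m r * s' j m r - B r * (s i m r * s j m r)))))
        = (\<Sum>i<d. LINT r|lborel. (\<Sum>j<d. (c i * c j) * (r ^ (N + 1) * (s' i m r * s' j m r - B r * (s i m r * s j m r)))))"
        by (rule Bochner_Integration.integral_sum) (intro Bochner_Integration.integrable_sum integrable_mult_right int; simp)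
      also have "\<dots> = (\<Sum>i<d. \<Sum>j<d. LINT r|lborel. (c i * c j) * (r ^ (N + 1) * (s' i m r * s' j m r - B r * (s i m r * s j m r))))"
        by (intro sum.cong refl Bochner_Integration.integral_sum integrable_mult_right int) auto
      finally show ?thesis by (simp add: bform_def)
    qed
    also have "\<dots> < 0" by (rule almost_diagonal_negative[OF \<epsilon> near c])
    finally show ?thesis .
  qed
  show ?thesis
    by (rule that[of \<alpha> \<beta> "\<lambda>j. q j m" "\<lambda>j. p j m"])
       (use \<alpha> \<beta> \<alpha>\<beta> q neg in \<open>auto simp: s_def s'_def\<close>)
qed

end

section \<open>The radial equation\<close>

text \<open>In the variable \<open>v\<close> with \<open>u = g v\<close> the equation is \<open>v'' + (N - 1) / r * v' = - h v\<close>. Here \<open>y = sqrt (a U) * U'\<close> is \<open>v'\<close>,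
and \<open>f U / sqrt (a U)\<close> is \<open>h v\<close>, so \<open>v\<close> itself does not have to be introduced.\<close>

lemma radial_reduction:
  fixes \<Omega> :: "(real^'n) set" and u :: "real^'n \<Rightarrow> real" and e :: "real^'n"
  assumes sol: "quasilinear_solution \<Omega> a f u" and rad: "radial_on \<Omega> u"
    and sub: "{x. lo < norm x \<and> norm x < hi} \<subseteq> \<Omega>" and lo: "0 \<le> lo"
    and a: "\<And>t. (a has_real_derivative a' t) (at t)" "\<And>t. 0 < a t"
    and e: "e = axis k 1"
    and U: "\<And>r. U r = u (r *\<^sub>R e)" and y: "\<And>r. y r = sqrt (a (U r)) * grad u (r *\<^sub>R e) $ k"
    and r: "lo < r" "r < hi"
  shows "(U has_real_derivative y r / sqrt (a (U r))) (at r)"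
    and "(y has_real_derivative - (real CARD('n) - 1) / r * y r - f (U r) / sqrt (a (U r))) (at r)"
proof -
  define A where "A = {x::real^'n. lo < norm x \<and> norm x < hi}"
  have oA: "open A" unfolding A_def by (intro open_Collect_conj open_Collect_less continuous_intros)
  have A\<Omega>: "A \<subseteq> \<Omega>" using sub by (simp add: A_def)
  have ne: "norm e = 1" by (simp add: e)
  have reA: "t *\<^sub>R e \<in> A" if "lo < t" "t < hi" for t
    using that lo by (simp add: A_def ne)
  have C2: "Ck_on (Suc (Suc 0)) \<Omega> u" using sol by (simp add: quasilinear_solution_def numeral_2_eq_2)
  have du: "u differentiable (at x)" and dg: "(\<lambda>x. grad u x $ i) differentiable (at x)" if "x \<in> A" for x i
    using C2 that A\<Omega> by auto
  have Ueq: "U = (\<lambda>s. u (s *\<^sub>R e))" using U by (intro ext)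
  define U' where "U' t = grad u (t *\<^sub>R e) $ k" for t
  define U'' where "U'' t = grad (\<lambda>x. grad u x $ k) (t *\<^sub>R e) $ k" for t
  have line: "((\<lambda>s. F (s *\<^sub>R e)) has_real_derivative grad F (t *\<^sub>R e) $ k) (at t)"
    if F: "F differentiable (at (t *\<^sub>R e))" for F :: "real^'n \<Rightarrow> real" and t
  proof -
    have h: "(F has_derivative (\<lambda>h. grad F (t *\<^sub>R e) \<bullet> h)) (at (t *\<^sub>R e))" by (rule has_derivative_grad[OF F])
    have "((\<lambda>s. s *\<^sub>R e) has_derivative (\<lambda>h. h *\<^sub>R e)) (at t)" by (auto intro!: derivative_eq_intros)
    from has_derivative_compose[OF this h]
    have "((\<lambda>s. F (s *\<^sub>R e)) has_derivative (\<lambda>h. grad F (t *\<^sub>R e) \<bullet> (h *\<^sub>R e))) (at t)" .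
    then show ?thesis unfolding has_field_derivative_def
      by (rule has_derivative_eq_rhs) (auto simp: e inner_axis mult.commute)
  qed
  have dU: "(U has_real_derivative U' t) (at t)" if "lo < t" "t < hi" for t
    unfolding Ueq U'_def by (rule line[OF du[OF reA[OF that]]])
  have dU': "(U' has_real_derivative U'' t) (at t)" if "lo < t" "t < hi" for t
    unfolding U'_def[abs_def] U''_def by (rule line[OF dg[OF reA[OF that]]])
  have uU: "u x = U (norm x)" if "x \<in> A" for x
  proof -
    have "norm x *\<^sub>R e \<in> A" using that lo by (intro reA) (auto simp: A_def)
    moreover have "norm x = norm (norm x *\<^sub>R e)" by (simp add: ne)
    ultimately have "u x = u (norm x *\<^sub>R e)"
      using rad that A\<Omega> unfolding radial_on_def by blast
    then show ?thesis by (simp only: U)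
  qed
  have nd: "(norm has_derivative (\<lambda>h. x \<bullet> h / norm x)) (at x)" if "x \<in> A" for x
  proof -
    have "x \<noteq> 0" using that lo by (auto simp: A_def)
    from has_derivative_norm[OF this] show ?thesis
      by (simp add: sgn_div_norm inner_commute divide_inverse mult.commute)
  qed
  have gu: "grad u x $ i = U' (norm x) * (x $ i / norm x)" if x: "x \<in> A" for x i
  proof -
    have "((\<lambda>x. U (norm x)) has_derivative (\<lambda>h. (x \<bullet> h / norm x) * U' (norm x))) (at x)"
      by (rule DERIV_compose_FDERIV[OF dU nd[OF x]]) (use x in \<open>auto simp: A_def\<close>)
    then have "(u has_derivative (\<lambda>h. (x \<bullet> h / norm x) * U' (norm x))) (at x)"
      by (rule has_derivative_transform_within_open[OF _ oA x]) (simp add: uU)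
    from grad_eqI[OF this] show ?thesis by (simp add: inner_axis)
  qed
  define Y where "Y t = a (U t) * U' t / t" for t
  define Y' where "Y' t = ((a' (U t) * U' t) * U' t + U'' t * a (U t)) / t - a (U t) * U' t / t^2" for t
  have dY: "(Y has_real_derivative Y' t) (at t)" if "lo < t" "t < hi" for t
  proof -
    have "t \<noteq> 0" using that lo by auto
    have aU: "((\<lambda>t. a (U t)) has_real_derivative a' (U t) * U' t) (at t)" by (rule DERIV_chain2[OF a(1) dU[OF that]])
    have "((\<lambda>t. a (U t) * U' t / t) has_real_derivative
      (((a' (U t) * U' t) * U' t + U'' t * a (U t)) * t - a (U t) * U' t * 1) / (t * t)) (at t)"
      by (rule DERIV_divide[OF DERIV_mult[OF aU dU'[OF that]] DERIV_ident \<open>t \<noteq> 0\<close>])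
    then show ?thesis unfolding Y_def[abs_def]
      by (rule DERIV_cong) (use \<open>t \<noteq> 0\<close> in \<open>simp add: Y'_def power2_eq_square diff_divide_distrib\<close>)
  qed
  define x where "x = r *\<^sub>R e"
  have x: "x \<in> A" "norm x = r" using reA[OF r] r lo by (auto simp: x_def ne)
  have r0: "r > 0" using r lo by linarith
  have flux: "grad (\<lambda>y. (a (u y) *\<^sub>R grad u y) $ i) x $ i = Y' r * (x $ i)\<^sup>2 / r + Y r" for i
  proof -
    have v: "((\<lambda>x. x $ i) has_derivative (\<lambda>h. h $ i)) (at x)"
      by (rule bounded_linear_imp_has_derivative) (rule bounded_linear_vec_nth)
    have "((\<lambda>x. Y (norm x)) has_derivative (\<lambda>h. (x \<bullet> h / norm x) * Y' (norm x))) (at x)"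
      by (rule DERIV_compose_FDERIV[OF dY nd]) (use x r in auto)
    from has_derivative_mult[OF this v]
    have "((\<lambda>x. Y (norm x) * x $ i) has_derivative (\<lambda>h. Y (norm x) * h $ i + (x \<bullet> h / norm x) * Y' (norm x) * x $ i)) (at x)" .
    then have "((\<lambda>y. (a (u y) *\<^sub>R grad u y) $ i) has_derivative (\<lambda>h. Y (norm x) * h $ i + (x \<bullet> h / norm x) * Y' (norm x) * x $ i)) (at x)"
      by (rule has_derivative_transform_within_open[OF _ oA x(1)]) (simp add: Y_def gu uU)
    from grad_eqI[OF this] show ?thesis by (simp add: inner_axis x(2) power2_eq_square)
  qed
  have "divergence (\<lambda>y. a (u y) *\<^sub>R grad u y) x = (\<Sum>i\<in>UNIV. Y' r * (x $ i)\<^sup>2 / r + Y r)"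
    unfolding divergence_def flux ..
  also have "\<dots> = Y' r / r * (\<Sum>i\<in>UNIV. (x $ i)\<^sup>2) + CARD('n) * Y r"
    by (simp add: sum.distrib sum_distrib_left)
  also have "(\<Sum>i\<in>UNIV. (x $ i)\<^sup>2) = r\<^sup>2"
    unfolding x(2)[symmetric] by (simp add: norm_vec_def L2_set_def sum_nonneg)
  finally have div: "divergence (\<lambda>y. a (u y) *\<^sub>R grad u y) x = r * Y' r + CARD('n) * Y r"
    using r0 by (simp add: power2_eq_square)
  have ng: "(norm (grad u x))\<^sup>2 = (U' r)\<^sup>2"
  proof -
    have "(norm (grad u x))\<^sup>2 = (\<Sum>i\<in>UNIV. (grad u x $ i)\<^sup>2)"
      by (simp add: norm_vec_def L2_set_def sum_nonneg)
    also have "\<dots> = (U' r / r)\<^sup>2 * (\<Sum>i\<in>UNIV. (x $ i)\<^sup>2)"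
      by (simp add: gu[OF x(1)] x(2) sum_distrib_left power_mult_distrib power_divide)
    also have "(\<Sum>i\<in>UNIV. (x $ i)\<^sup>2) = (norm x)\<^sup>2" by (simp add: norm_vec_def L2_set_def sum_nonneg)
    finally show ?thesis using x(2) r0 by (simp add: power_divide)
  qed
  have "- divergence (\<lambda>y. a (u y) *\<^sub>R grad u y) x + deriv a (u x) / 2 * (norm (grad u x))\<^sup>2 = f (u x)"
    using sol x(1) A\<Omega> unfolding quasilinear_solution_def by blast
  then have pde: "- (r * Y' r + CARD('n) * Y r) + a' (U r) / 2 * (U' r)\<^sup>2 = f (U r)"
    using uU[OF x(1)] x(2) unfolding div ng by (simp add: DERIV_imp_deriv[OF a(1)])
  have rY: "r * Y' r = a' (U r) * (U' r)\<^sup>2 + a (U r) * U'' r - a (U r) * U' r / r"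
    using r0 by (simp add: Y'_def power2_eq_square field_simps)
  have key: "a' (U r) * (U' r)\<^sup>2 / 2 + a (U r) * U'' r = - f (U r) - (real CARD('n) - 1) * (a (U r) * U' r) / r"
  proof -
    have "- (a' (U r) * (U' r)\<^sup>2 + a (U r) * U'' r - a (U r) * U' r / r + CARD('n) * (a (U r) * U' r / r)) + a' (U r) / 2 * (U' r)\<^sup>2 = f (U r)"
      using pde unfolding rY Y_def .
    then show ?thesis by (simp add: left_diff_distrib diff_divide_distrib)
  qed
  have sq: "sqrt (a (U r)) > 0" "sqrt (a (U r)) * sqrt (a (U r)) = a (U r)" using a(2)[of "U r"] by auto
  have yU: "y = (\<lambda>t. sqrt (a (U t)) * U' t)" by (auto simp: y U'_def)
  show "(U has_real_derivative y r / sqrt (a (U r))) (at r)"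
    using dU[OF r] sq by (simp add: yU)
  have ds: "((\<lambda>t. sqrt (a (U t))) has_real_derivative (a' (U r) * U' r) * (inverse (sqrt (a (U r))) / 2)) (at r)"
    by (rule DERIV_cong[OF DERIV_chain2[OF DERIV_real_sqrt DERIV_chain2[OF a(1) dU[OF r]]]]) (use a(2) in auto)
  have "(y has_real_derivative (a' (U r) * U' r) * (inverse (sqrt (a (U r))) / 2) * U' r + U'' r * sqrt (a (U r))) (at r)"
    unfolding yU by (rule DERIV_mult[OF ds dU'[OF r]])
  moreover have "(a' (U r) * U' r) * (inverse (sqrt (a (U r))) / 2) * U' r + U'' r * sqrt (a (U r))
     = - (real CARD('n) - 1) / r * y r - f (U r) / sqrt (a (U r))"
  proof -
    define q where "q = sqrt (a (U r))"
    have q: "q > 0" "a (U r) = q * q" using sq by (auto simp: q_def)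
    have "(a' (U r) * U' r) * (inverse q / 2) * U' r + U'' r * q = (a' (U r) * (U' r)\<^sup>2 / 2 + (q * q) * U'' r) / q"
      using q(1) by (simp add: field_simps power2_eq_square)
    also have "\<dots> = (- f (U r) - (real CARD('n) - 1) * ((q * q) * U' r) / r) / q" using key unfolding q(2) by simp
    also have "\<dots> = - (real CARD('n) - 1) / r * (q * U' r) - f (U r) / q"
      using q(1) r0 by (simp add: field_simps)
    finally show ?thesis unfolding yU q_def[symmetric] .
  qed
  ultimately show "(y has_real_derivative - (real CARD('n) - 1) / r * y r - f (U r) / sqrt (a (U r))) (at r)" by simp
qed

text \<open>\<open>U\<close> is the profile of \<open>u\<close>, \<open>\<Phi>\<close> a primitive of \<open>f\<close>, and \<open>h'\<close> the derivative of \<open>f / sqrt a\<close>, which may be singular at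
0. The number \<open>K0\<close> stands for the value that the total function \<open>deriv\<close> assigns to the potential where
\<open>U = 0\<close>; with it, the potential of the second variation agrees with \<open>B\<close> at every point other
than the origin.\<close>

locale radial_ode =
  fixes lo hi :: real and N :: nat and U y a f h' \<Phi> :: "real \<Rightarrow> real" and K0 :: real
  assumes lo: "0 \<le> lo" and N: "2 \<le> N"
    and U: "\<And>r. lo < r \<Longrightarrow> r < hi \<Longrightarrow> (U has_real_derivative y r / sqrt (a (U r))) (at r)"
    and y: "\<And>r. lo < r \<Longrightarrow> r < hi \<Longrightarrow> (y has_real_derivative - (real N - 1) / r * y r - f (U r) / sqrt (a (U r))) (at r)"
    and a: "\<And>t. 0 < a t" "continuous_on UNIV a"
    and f: "continuous_on UNIV f" "f 0 = 0"
    and \<Phi>: "\<And>t. (\<Phi> has_real_derivative f t) (at t)" "\<And>t. 0 \<le> \<Phi> t" "\<And>t. \<Phi> t = 0 \<longleftrightarrow> t = 0"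
    and h': "\<And>t. t \<noteq> 0 \<Longrightarrow> ((\<lambda>t. f t / sqrt (a t)) has_real_derivative h' t) (at t)"
      "\<And>t. t \<noteq> 0 \<Longrightarrow> 0 \<le> h' t" "continuous_on (- {0}) h'"
begin

definition "H t = f t / sqrt (a t)"

definition "potential t = (if t = 0 then K0 else h' t / sqrt (a t))"

definition "B r = (if lo < r \<and> r < hi then potential (U r) else 0)"

definition "Z = {r. U r = 0}"

text \<open>The mechanical energy \<open>v'\<^sup>2 / 2 + \<integral> h\<close> of the radial motion; in terms of \<open>U\<close> the potential energy is \<open>\<Phi> U\<close>.\<close>

definition "energy r = (y r)\<^sup>2 / 2 + \<Phi> (U r)"

lemma energy_deriv: "lo < r \<Longrightarrow> r < hi \<Longrightarrow> (energy has_real_derivative - (real N - 1) * (y r)\<^sup>2 / r) (at r)"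
proof -
  assume r: "lo < r" "r < hi"
  have "(energy has_real_derivative (2 * y r * (- (real N - 1) / r * y r - f (U r) / sqrt (a (U r)))) / 2 + f (U r) * (y r / sqrt (a (U r)))) (at r)"
    unfolding energy_def[abs_def]
    by (intro DERIV_add DERIV_chain2[OF \<Phi>(1) U[OF r]] DERIV_cdivide)
       (auto intro!: derivative_eq_intros y[OF r])
  moreover have "(2 * Y * (- (real N - 1) / r * Y - q / s)) / 2 + q * (Y / s) = - (real N - 1) * Y\<^sup>2 / r" for Y q s
    by (simp add: power2_eq_square algebra_simps diff_divide_distrib add_divide_distrib)
  ultimately show ?thesis by simp
qed

text \<open>Friction makes the energy nonincreasing, so it stays 0 to the right of \<open>r0\<close>; to the left, \<open>r ^ (2 N - 2)\<close> times
the energy is nondecreasing, so it is 0 there as well. This replaces uniqueness for the initial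
value problem, which is not available when \<open>h\<close> fails to be Lipschitz at 0.\<close>

lemma energy_zero:
  assumes r0: "lo < r0" "r0 < hi" and E0: "energy r0 = 0" and r: "lo < r" "r < hi"
  shows "U r = 0"
proof -
  have nn: "0 \<le> energy t" for t by (simp add: energy_def \<Phi>(2))
  have "energy r = 0"
  proof (cases "r0 \<le> r")
    case True
    have "energy r \<le> energy r0"
    proof (rule DERIV_nonpos_imp_nonincreasing[OF True])
      fix t assume "r0 \<le> t" "t \<le> r"
      then have t: "lo < t" "t < hi" "0 < t" using r0 r lo by auto
      have "- (real N - 1) * (y t)\<^sup>2 / t \<le> 0"
        using t(3) N by (auto simp: divide_le_0_iff mult_le_0_iff)
      with energy_deriv[OF t(1,2)]
      show "\<exists>d. (energy has_real_derivative d) (at t) \<and> d \<le> 0" by blast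
    qed
    then show ?thesis using E0 nn[of r] by simp
  next
    case False
    let ?G = "\<lambda>t. t ^ (2 * N - 2) * energy t"
    obtain n where n: "2 * N - 2 = Suc n" using N by (cases "2 * N - 2") auto
    have rn: "real (Suc n) = 2 * (real N - 1)" using n N by (simp add: of_nat_diff flip: n)
    have "?G r \<le> ?G r0"
    proof (rule DERIV_nonneg_imp_nondecreasing[of r r0])
      fix t assume "r \<le> t" "t \<le> r0"
      then have t: "lo < t" "t < hi" "0 < t" using r0 r lo by auto
      have "(?G has_real_derivative (real (2 * N - 2) * t ^ (2 * N - 2 - Suc 0)) * energy t + (- (real N - 1) * (y t)\<^sup>2 / t) * t ^ (2 * N - 2)) (at t)"
        by (rule DERIV_mult[OF DERIV_pow energy_deriv[OF t(1,2)]])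
      moreover have "(real (2 * N - 2) * t ^ (2 * N - 2 - Suc 0)) * energy t + (- (real N - 1) * (y t)\<^sup>2 / t) * t ^ (2 * N - 2)
         = real (Suc n) * t ^ n * \<Phi> (U t)"
        unfolding n rn using t(3) by (simp add: energy_def field_simps)
      moreover have "0 \<le> real (Suc n) * t ^ n * \<Phi> (U t)" using t(3) \<Phi>(2) by (intro mult_nonneg_nonneg) auto
      ultimately show "\<exists>d. (?G has_real_derivative d) (at t) \<and> 0 \<le> d" by metis
    qed (use False in auto)
    then have "?G r \<le> 0" using E0 by simp
    moreover have "0 < r ^ (2 * N - 2)" using r lo by auto
    ultimately show ?thesis using nn[of r] by (metis linorder_not_less mult_pos_pos order_less_le)
  qed
  then have "\<Phi> (U r) = 0" using \<Phi>(2)[of "U r"] zero_le_power2[of "y r"] unfolding energy_def by linarith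
  then show ?thesis by (simp add: \<Phi>(3))
qed

lemma cont: "\<And>r. lo < r \<Longrightarrow> r < hi \<Longrightarrow> isCont U r" "\<And>r. lo < r \<Longrightarrow> r < hi \<Longrightarrow> isCont y r"
  using U y by (blast intro: DERIV_isCont)+

lemma cont_on: "A \<subseteq> {lo<..<hi} \<Longrightarrow> continuous_on A U" "A \<subseteq> {lo<..<hi} \<Longrightarrow> continuous_on A y"
  using cont by (auto intro!: continuous_at_imp_continuous_on)

lemma cont_H: "continuous_on UNIV H"
  unfolding H_def[abs_def] using a(1) by (intro continuous_intros f a) (auto simp: less_imp_neq[symmetric])

lemma cont_HU: "A \<subseteq> {lo<..<hi} \<Longrightarrow> continuous_on A (\<lambda>r. H (U r))"
  by (rule continuous_on_compose2[OF cont_H cont_on(1)]) auto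

lemma HU_deriv:
  assumes r: "lo < r" "r < hi" and "U r \<noteq> 0"
  shows "((\<lambda>r. H (U r)) has_real_derivative B r * y r) (at r)"
  unfolding H_def[abs_def]
  by (rule DERIV_cong[OF DERIV_chain2[OF h'(1)[OF assms(3)] U[OF r]]]) (use assms in \<open>simp add: B_def potential_def\<close>)

lemma potential_measurable[measurable]: "potential \<in> borel_measurable borel"
proof (rule borel_measurable_continuous_countable_exceptions[of "{0}"])
  have "continuous_on (- {0}) (\<lambda>t. h' t / sqrt (a t))"
    using a(1) by (intro continuous_intros h' continuous_on_subset[OF a(2)]) (auto simp: less_imp_neq[symmetric])
  then show "continuous_on (- {0}) potential"
    by (rule continuous_on_eq) (simp add: potential_def)
qed simp

lemma B_measurable[measurable]: "B \<in> borel_measurable borel"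
proof -
  have [measurable]: "(\<lambda>r. indicator {lo<..<hi} r *\<^sub>R U r) \<in> borel_measurable borel"
    by (intro borel_measurable_continuous_on_indicator cont_on) auto
  have "B = (\<lambda>r. indicator {lo<..<hi} r * potential (indicator {lo<..<hi} r *\<^sub>R U r))"
    by (auto simp: B_def indicator_def)
  also have "\<dots> \<in> borel_measurable borel" by measurable
  finally show ?thesis .
qed

text \<open>The partial derivatives of \<open>v\<close> are \<open>x $ i * w (norm x)\<close>; \<open>w'\<close> is the derivative of \<open>w\<close>, with \<open>y'\<close>
eliminated through the equation.\<close>

definition "w r = y r / r"
definition "w' r = - (real N * (y r / r) + H (U r)) / r"

lemma w_deriv:
  assumes r: "lo < r" "r < hi"
  shows "(w has_real_derivative w' r) (at r)"
proof -
  have r0: "r \<noteq> 0" using r lo by auto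
  show ?thesis unfolding w_def[abs_def]
    by (rule DERIV_cong[OF DERIV_divide[OF y[OF r] DERIV_ident r0]])
       (use r0 in \<open>simp add: w'_def H_def[symmetric] field_simps\<close>)
qed

text \<open>The linearized equation for \<open>w\<close>. After elimination of \<open>y'\<close> the flux is \<open>- r ^ N * H U - N * r ^ (N - 1) * y\<close>, which
can be differentiated wherever \<open>H\<close> can be differentiated at \<open>U\<close>.\<close>

lemma P_deriv:
  assumes r: "lo < r" "r < hi" and Z: "r \<notin> Z"
  shows "((\<lambda>r. r ^ (N + 1) * w' r) has_real_derivative - (r ^ (N + 1) * (B r * w r))) (at r)"
proof -
  have r0: "0 < r" using r lo by linarith
  obtain n where n: "N = Suc (Suc n)" using N by (metis add_2_eq_Suc le_Suc_ex)
  have pow: "((\<lambda>r. r ^ Suc k) has_real_derivative real (Suc k) * r ^ k) (at r)" for k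
    using DERIV_pow[of "Suc k" r] by simp
  have eq: "- (v ^ Suc (Suc n) * H (U v)) - real N * (v ^ Suc n * y v) = v ^ (N + 1) * w' v" if "0 < v" for v
  proof -
    have "v ^ (N + 1) = v ^ n * v * v * v" by (simp add: n)
    then show ?thesis using that by (simp add: w'_def field_simps)
  qed
  have "((\<lambda>r. - (r ^ Suc (Suc n) * H (U r)) - real N * (r ^ Suc n * y r)) has_real_derivative
      - ((real (Suc (Suc n)) * r ^ Suc n) * H (U r) + (B r * y r) * r ^ Suc (Suc n))
      - real N * ((real (Suc n) * r ^ n) * y r + (- (real N - 1) / r * y r - f (U r) / sqrt (a (U r))) * r ^ Suc n)) (at r)"
    by (intro DERIV_diff DERIV_minus DERIV_mult DERIV_cmult pow HU_deriv[OF r] y[OF r])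
       (use Z in \<open>simp add: Z_def\<close>)
  then have "((\<lambda>r. - (r ^ Suc (Suc n) * H (U r)) - real N * (r ^ Suc n * y r)) has_real_derivative
      - (r ^ (N + 1) * (B r * w r))) (at r)"
    by (rule DERIV_cong) (use r0 in \<open>simp add: H_def[symmetric] w_def n field_simps\<close>)
  then show ?thesis
    by (rule has_field_derivative_transform_within_open[where S="{0<..}"])
       (use r0 eq in auto)
qed

lemma B_nonneg: "U r \<noteq> 0 \<Longrightarrow> 0 \<le> B r"
  using h'(2) a(1) by (simp add: B_def potential_def less_imp_le)

text \<open>Near a zero \<open>x\<close> of \<open>U\<close> the derivative \<open>y\<close> keeps its sign, so \<open>x\<close> is an isolated zero. There
\<open>B * y\<close> is the derivative of the monotone continuous function \<open>H U\<close>, hence integrable, and \<open>\<bar>y\<bar>\<close> is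
bounded below.\<close>

lemma local_structure:
  assumes simple: "\<And>r. lo < r \<Longrightarrow> r < hi \<Longrightarrow> U r \<noteq> 0 \<or> y r \<noteq> 0" and x: "lo < x" "x < hi"
  shows "\<exists>d>0. \<forall>p q. p \<le> x \<and> x \<le> q \<and> q - p < d \<longrightarrow> set_integrable lborel {p..q} B \<and> finite (Z \<inter> {p..q})"
proof (cases "U x = 0")
  case False
  then have "\<forall>\<^sub>F r in at x. U r \<noteq> 0" using cont(1)[OF x]
    by (metis isCont_def tendsto_imp_eventually_ne)
  then obtain d1 where d1: "0 < d1" "\<And>r. r \<noteq> x \<Longrightarrow> dist r x < d1 \<Longrightarrow> U r \<noteq> 0"
    by (auto simp: eventually_at)
  define d where "d = min d1 (min (x - lo) (hi - x))"
  have d: "0 < d" using d1 x by (simp add: d_def)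
  have "set_integrable lborel {p..q} B \<and> finite (Z \<inter> {p..q})" if pq: "p \<le> x" "x \<le> q" "q - p < d" for p q
  proof
    have sub: "lo < r \<and> r < hi \<and> U r \<noteq> 0" if "r \<in> {p..q}" for r
    proof -
      have "\<bar>r - x\<bar> < d" using that pq by auto
      then have "\<bar>r - x\<bar> < d1" "\<bar>r - x\<bar> < x - lo" "\<bar>r - x\<bar> < hi - x" unfolding d_def by auto
      then show ?thesis using d1(2)[of r] False by (cases "r = x") (auto simp: dist_real_def)
    qed
    then have "Z \<inter> {p..q} = {}" by (auto simp: Z_def)
    then show "finite (Z \<inter> {p..q})" by simp
    have "continuous_on {p..q} (\<lambda>r. h' (U r) / sqrt (a (U r)))"
    proof (intro continuous_intros)
      show "continuous_on {p..q} (\<lambda>r. h' (U r))"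
        by (rule continuous_on_compose2[OF h'(3) cont_on(1)]) (use sub in auto)
      show "continuous_on {p..q} (\<lambda>r. a (U r))"
        by (rule continuous_on_compose2[OF a(2) cont_on(1)]) (use sub in auto)
      show "\<forall>r\<in>{p..q}. sqrt (a (U r)) \<noteq> 0" using a(1) by (auto simp: less_imp_neq[symmetric])
    qed
    then have "continuous_on {p..q} B"
      by (rule continuous_on_eq) (use sub in \<open>auto simp: B_def potential_def\<close>)
    then show "set_integrable lborel {p..q} B" by (rule borel_integrable_atLeastAtMost')
  qed
  with d show ?thesis by blast
next
  case True
  then have y0: "y x \<noteq> 0" using simple[OF x] by simp
  define m where "m = \<bar>y x\<bar> / 2"
  define \<sigma> where "\<sigma> = sgn (y x)"
  have m: "m > 0" using y0 by (simp add: m_def)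
  have "\<forall>\<^sub>F r in at x. dist (y r) (y x) < m" using cont(2)[OF x] m by (auto simp: isCont_def tendsto_iff)
  then obtain d1 where d1: "0 < d1" "\<And>r. r \<noteq> x \<Longrightarrow> dist r x < d1 \<Longrightarrow> dist (y r) (y x) < m"
    by (auto simp: eventually_at)
  define d where "d = min d1 (min (x - lo) (hi - x))"
  have d: "0 < d" using d1 x by (simp add: d_def)
  have "set_integrable lborel {p..q} B \<and> finite (Z \<inter> {p..q})" if pq: "p \<le> x" "x \<le> q" "q - p < d" for p q
  proof
    have sub: "lo < r \<and> r < hi \<and> m \<le> \<sigma> * y r" if "r \<in> {p..q}" for r
    proof -
      have "\<bar>r - x\<bar> < d" using that pq by auto
      then have b: "\<bar>r - x\<bar> < d1" "\<bar>r - x\<bar> < x - lo" "\<bar>r - x\<bar> < hi - x" unfolding d_def by auto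
      then have "dist (y r) (y x) < m" using d1(2)[of r] m by (cases "r = x") (auto simp: dist_real_def)
      then have "m \<le> \<sigma> * y r" using y0 by (auto simp: dist_real_def m_def \<sigma>_def sgn_if abs_if split: if_splits)
      then show ?thesis using b by auto
    qed
    have nz: "U r \<noteq> 0" if r: "r \<in> {p..q}" "r \<noteq> x" for r
    proof -
      have mono: "\<sigma> * U s < \<sigma> * U t" if "s < t" "s \<in> {p..q}" "t \<in> {p..q}" for s t
      proof (rule DERIV_pos_imp_increasing[OF that(1)])
        fix v assume "s \<le> v" "v \<le> t"
        then have v: "v \<in> {p..q}" using that by auto
        have "((\<lambda>r. \<sigma> * U r) has_real_derivative \<sigma> * (y v / sqrt (a (U v)))) (at v)"
          by (rule DERIV_cmult[OF U]) (use sub[OF v] in auto)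
        moreover have "0 < \<sigma> * (y v / sqrt (a (U v)))"
        proof -
          have "0 < \<sigma> * y v" using sub[OF v] m by linarith
          then have "0 < (\<sigma> * y v) / sqrt (a (U v))" using a(1) by (intro divide_pos_pos) auto
          then show ?thesis by simp
        qed
        ultimately show "\<exists>d. ((\<lambda>r. \<sigma> * U r) has_real_derivative d) (at v) \<and> 0 < d" by blast
      qed
      have "x \<in> {p..q}" using pq by simp
      then show ?thesis using mono[of r x] mono[of x r] r True by (cases r x rule: linorder_cases) auto
    qed
    have "Z \<inter> {p..q} \<subseteq> {x}"
    proof
      fix r assume "r \<in> Z \<inter> {p..q}"
      then show "r \<in> {x}" using nz[of r] by (cases "r = x") (auto simp: Z_def)
    qed
    then show "finite (Z \<inter> {p..q})" by (rule finite_subset) simp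
    define k where "k r = (if r = x then 0 else \<sigma> * (B r * y r))" for r
    have k0: "0 \<le> k r" if "r \<in> {p..q}" for r
    proof (cases "r = x")
      case False
      have "0 \<le> \<sigma> * y r" using sub[OF that] m by linarith
      then have "0 \<le> B r * (\<sigma> * y r)" using B_nonneg[OF nz[OF that False]] by (rule mult_nonneg_nonneg[rotated])
      then show ?thesis using False by (simp add: k_def mult_ac)
    qed (simp add: k_def)
    have "(k has_integral (\<sigma> * H (U q) - \<sigma> * H (U p))) {p..q}"
    proof (rule fundamental_theorem_of_calculus_interior_strong[of "{x}"])
      show "continuous_on {p..q} (\<lambda>r. \<sigma> * H (U r))"
        by (intro continuous_intros cont_HU) (use sub in auto)
      fix r assume r: "r \<in> {p<..<q} - {x}"
      then have "r \<in> {p..q}" "r \<noteq> x" by auto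
      then have "((\<lambda>r. \<sigma> * H (U r)) has_real_derivative k r) (at r)"
        using DERIV_cmult[OF HU_deriv[of r], of \<sigma>] sub[of r] nz[of r] by (simp add: k_def)
      then show "((\<lambda>r. \<sigma> * H (U r)) has_vector_derivative k r) (at r)"
        by (simp add: has_real_derivative_iff_has_vector_derivative)
    qed (use pq in auto)
    then have "k absolutely_integrable_on {p..q}"
      using k0 by (intro nonnegative_absolutely_integrable_1) auto
    then have "set_integrable lebesgue {p..q} k" .
    have [measurable]: "(\<lambda>r. indicator {p..q} r *\<^sub>R y r) \<in> borel_measurable borel"
      by (intro borel_measurable_continuous_on_indicator cont_on) (use sub in auto)
    have "(\<lambda>r. indicator {p..q} r *\<^sub>R k r) = (\<lambda>r. if r = x then 0 else \<sigma> * (B r * (indicator {p..q} r *\<^sub>R y r)))"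
      by (auto simp: k_def indicator_def)
    also have "\<dots> \<in> borel_measurable borel" by measurable
    finally have km: "(\<lambda>r. indicator {p..q} r *\<^sub>R k r) \<in> borel_measurable borel" .
    have ki: "integrable lborel (\<lambda>r. indicator {p..q} r *\<^sub>R k r)"
      using \<open>set_integrable lebesgue {p..q} k\<close> km unfolding set_integrable_def by (subst (asm) integrable_completion) auto
    show "set_integrable lborel {p..q} B" unfolding set_integrable_def
    proof (rule Bochner_Integration.integrable_bound[OF integrable_mult_right[OF ki, of "1 / m"]])
      have bd: "norm (indicator {p..q} r *\<^sub>R B r) \<le> norm (1 / m * (indicator {p..q} r *\<^sub>R k r))" if "r \<noteq> x" for r
      proof (cases "r \<in> {p..q}")
        case r: True
        have B0: "0 \<le> B r" by (rule B_nonneg[OF nz[OF r that]])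
        have "m * B r \<le> (\<sigma> * y r) * B r" using sub[OF r] B0 by (intro mult_right_mono) auto
        then have "B r \<le> 1 / m * k r" using that m by (simp add: k_def field_simps)
        then show ?thesis using r B0 k0[OF r] m by simp
      qed simp
      show "AE r in lborel. norm (indicator {p..q} r *\<^sub>R B r) \<le> norm (1 / m * (indicator {p..q} r *\<^sub>R k r))"
        using AE_lborel_singleton[of x] by eventually_elim (rule bd)
    qed measurable
  qed
  with d show ?thesis by blast
qed

text \<open>Local integrability and local finiteness pass to compact intervals by bisection.\<close>

lemma compact_structure:
  assumes simple: "\<And>r. lo < r \<Longrightarrow> r < hi \<Longrightarrow> U r \<noteq> 0 \<or> y r \<noteq> 0" and x: "lo < \<alpha>" "\<beta> < hi"
  shows "set_integrable lborel {\<alpha>..\<beta>} B \<and> finite (Z \<inter> {\<alpha>..\<beta>})"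
proof (cases "\<alpha> \<le> \<beta>")
  case True
  show ?thesis
  proof (rule Bolzano[OF True, of "\<lambda>p q. set_integrable lborel {p..q} B \<and> finite (Z \<inter> {p..q})"])
    fix p q r assume h: "set_integrable lborel {p..q} B \<and> finite (Z \<inter> {p..q})"
      "set_integrable lborel {q..r} B \<and> finite (Z \<inter> {q..r})" "p \<le> q" "q \<le> r"
    have eq: "{p..r} = {p..q} \<union> {q..r}" using h(3,4) by auto
    show "set_integrable lborel {p..r} B \<and> finite (Z \<inter> {p..r})"
      unfolding eq using h by (auto intro: set_integrable_Un simp: Int_Un_distrib)
  next
    fix r assume r: "\<alpha> \<le> r" "r \<le> \<beta>"
    then have "lo < r" "r < hi" using x by auto
    from local_structure[OF simple this]
    show "\<exists>d>0. \<forall>p q. p \<le> r \<and> r \<le> q \<and> q - p < d \<longrightarrow> set_integrable lborel {p..q} B \<and> finite (Z \<inter> {p..q})"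
      by blast
  qed
qed (simp add: set_integrable_def)

lemma linearization_sturm:
  assumes simple: "\<And>r. lo < r \<Longrightarrow> r < hi \<Longrightarrow> U r \<noteq> 0 \<or> y r \<noteq> 0"
  shows "sturm lo hi N w w' B Z"
proof
  show "continuous_on {lo<..<hi} w'" unfolding w'_def[abs_def]
    by (intro continuous_intros cont_on cont_HU) (use lo in auto)
qed (use lo w_deriv P_deriv compact_structure[OF simple] in auto)

end

section \<open>From radial profiles to the Morse index\<close>

lemma elementary_cutoff_power:
  assumes "0 < \<alpha>" "\<alpha> < \<beta>"
  shows "elementary (\<lambda>x::real^'n. cutoff \<alpha> \<beta> (norm x) * norm x ^ k)"
proof -
  have "cutoff \<alpha> \<beta> (norm x) * norm x ^ k =
      flat (real k / 2) ((norm x)\<^sup>2) * (flat 0 ((norm x)\<^sup>2 + - \<alpha>\<^sup>2) * flat 0 (\<beta>\<^sup>2 + (-1) * (norm x)\<^sup>2))" for x :: "real^'n"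
  proof (cases "x = 0")
    case True
    then show ?thesis by (simp add: cutoff_def flat_def)
  next
    case False
    then have r: "0 < norm x" by simp
    have "((norm x)\<^sup>2) powr (real k / 2) = norm x ^ k"
    proof -
      have "(norm x)\<^sup>2 = norm x powr 2" using r by (simp add: powr_numeral)
      then have "((norm x)\<^sup>2) powr (real k / 2) = norm x powr (2 * (real k / 2))" by (simp only: powr_powr)
      then show ?thesis using r by (simp add: powr_realpow)
    qed
    then have "flat (real k / 2) ((norm x)\<^sup>2) = flat 0 ((norm x)\<^sup>2) * norm x ^ k"
      using r by (simp add: flat_def)
    then show ?thesis using r by (simp add: cutoff_def)
  qed
  moreover have "elementary (\<lambda>x::real^'n. flat (real k / 2) ((norm x)\<^sup>2) * (flat 0 ((norm x)\<^sup>2 + - \<alpha>\<^sup>2) * flat 0 (\<beta>\<^sup>2 + (-1) * (norm x)\<^sup>2)))"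
    by (intro elementary.mult elementary.flat elementary.add elementary_norm2 elementary.const)
  ultimately show ?thesis by simp
qed

lemma elementary_cutoff_polynomial:
  assumes "0 < \<alpha>" "\<alpha> < \<beta>" "real_polynomial_function q"
  shows "elementary (\<lambda>x::real^'n. cutoff \<alpha> \<beta> (norm x) * q (norm x))"
proof -
  obtain c n where "q = (\<lambda>r. \<Sum>k\<le>n. c k * r ^ k)" using assms(3) real_polynomial_function_iff_sum by blast
  then have eq: "(\<lambda>x::real^'n. cutoff \<alpha> \<beta> (norm x) * q (norm x)) = (\<lambda>x. \<Sum>k\<in>{..n}. c k * (cutoff \<alpha> \<beta> (norm x) * norm x ^ k))"
    by (simp add: sum_distrib_left mult_ac)
  show ?thesis unfolding eq
    by (intro elementary_sum elementary.mult elementary.const elementary_cutoff_power assms) simp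
qed

lemma qform_zero: "qform N B (\<lambda>r. 0) (\<lambda>r. 0) = 0"
  by (simp add: qform_def)

lemma qform_cong:
  assumes "\<And>r. B r = B' r \<or> s r = 0"
  shows "qform N B s s' = qform N B' s s'"
  unfolding qform_def
proof (rule Bochner_Integration.integral_cong)
  show "r ^ (N + 1) * ((s' r)\<^sup>2 - B r * (s r)\<^sup>2) = r ^ (N + 1) * ((s' r)\<^sup>2 - B' r * (s r)\<^sup>2)" for r
    using assms[of r] by auto
qed simp

context sturm
begin

text \<open>Each of the \<open>d\<close> profiles \<open>s j\<close> yields \<open>N + 1\<close> test functions: \<open>norm x * s j (norm x)\<close> and \<open>x $ i * s j (norm x)\<close>. In a
nontrivial combination, the coefficients of each spherical harmonic form a profile in the span of the
\<open>s j\<close>, and by \<open>energy_bound\<close> the second variation is at most a sum of values of the negative definite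
one-dimensional form, one of them at a nontrivial combination.\<close>

lemma morse_lower_bound:
  fixes \<Omega> :: "(real^'n) set" and u :: "real^'n \<Rightarrow> real" and p q :: "nat \<Rightarrow> real \<Rightarrow> real"
  assumes NN: "N = CARD('n)" "2 \<le> N" and \<Omega>: "open \<Omega>" and sub: "{x. lo < norm x \<and> norm x < hi} \<subseteq> \<Omega>"
    and pot: "\<And>x. x \<in> \<Omega> \<Longrightarrow> x \<noteq> 0 \<Longrightarrow> deriv (\<lambda>s. f (cauchy_g a s) / sqrt (a (cauchy_g a s))) (inv (cauchy_g a) (u x)) = B (norm x)"
    and ab: "lo < \<alpha>" "\<alpha> < \<beta>" "\<beta> < hi"
    and q: "\<And>j. j < d \<Longrightarrow> real_polynomial_function (q j)" "\<And>j r. j < d \<Longrightarrow> (q j has_real_derivative p j r) (at r)"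
    "\<And>j. j < d \<Longrightarrow> continuous_on UNIV (p j)"
    and neg: "\<And>c. \<exists>j<d. c j \<noteq> 0 \<Longrightarrow> qform N B (\<lambda>r. \<Sum>j<d. c j * (cutoff \<alpha> \<beta> r * q j r))
        (\<lambda>r. \<Sum>j<d. c j * (cutoff' \<alpha> \<beta> r * q j r + cutoff \<alpha> \<beta> r * p j r)) < 0"
  shows "enat ((N + 1) * d) \<le> morse_index \<Omega> a f u"
proof -
  have \<alpha>: "0 < \<alpha>" using ab lo by linarith
  note [measurable] = Bm
  define s where "s j r = cutoff \<alpha> \<beta> r * q j r" for j r
  define s' where "s' j r = cutoff' \<alpha> \<beta> r * q j r + cutoff \<alpha> \<beta> r * p j r" for j r
  define K where "K = {x::real^'n. norm x \<in> {\<alpha>..\<beta>}}"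
  have K: "compact K" "K \<subseteq> \<Omega>"
  proof -
    have "closed K" unfolding K_def by (simp, intro closed_Collect_conj closed_Collect_le continuous_intros)
    moreover have "K \<subseteq> cball 0 \<beta>" by (auto simp: K_def)
    ultimately show "compact K" by (metis bounded_cball bounded_subset compact_eq_bounded_closed)
    show "K \<subseteq> \<Omega>" using sub ab by (auto simp: K_def)
  qed
  define \<theta> where "\<theta> = (\<lambda>(k::'n option, j::nat) x. (case k of None \<Rightarrow> norm x | Some i \<Rightarrow> x $ i) * s j (norm (x::real^'n)))"
  define I where "I = (UNIV :: 'n option set) \<times> {..<d}"
  have I: "finite I" "card I = (N + 1) * d" by (auto simp: I_def card_cartesian_product card_UNIV_option NN)
  have sz: "s j r = 0" "s' j r = 0" if "r \<notin> {\<alpha>..\<beta>}" for j r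
  proof -
    have "r \<notin> {\<alpha><..<\<beta>}" using that by auto
    then show "s j r = 0" "s' j r = 0" using cutoff_zero[OF \<alpha> ab(2), of r] by (auto simp: s_def s'_def)
  qed
  have el: "elementary (\<theta> i)" if iI: "i \<in> I" for i
  proof -
    obtain k j where i: "i = (k, j)" "j < d" using iI by (cases i) (auto simp: I_def)
    show ?thesis
    proof (cases k)
      case None
      have "elementary (\<lambda>x::real^'n. cutoff \<alpha> \<beta> (norm x) * (\<lambda>r. r * q j r) (norm x))"
        by (rule elementary_cutoff_polynomial[OF \<alpha> ab(2)])
           (intro real_polynomial_function.intros(4) real_polynomial_function.intros(1) q(1) i(2) bounded_linear_ident)
      then show ?thesis by (simp add: \<theta>_def i(1) None s_def[abs_def] mult_ac)
    next
      case (Some l)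
      have "elementary (\<lambda>x::real^'n. x $ l * (cutoff \<alpha> \<beta> (norm x) * q j (norm x)))"
        by (intro elementary.mult elementary.coord elementary_cutoff_polynomial[OF \<alpha> ab(2)] q(1) i(2))
      then show ?thesis by (simp add: \<theta>_def i(1) Some s_def[abs_def])
    qed
  qed
  have \<theta>0: "\<theta> i x = 0" if "x \<notin> K" for i x
    using that by (cases i) (auto simp: \<theta>_def K_def sz simp del: atLeastAtMost_iff)
  have test1: "test_function \<Omega> (\<theta> i)" if "i \<in> I" for i
    by (rule elementary_test_function[OF el[OF that] K]) (rule \<theta>0)
  have test: "test_function \<Omega> (\<lambda>x. \<Sum>i\<in>I. c i * \<theta> i x)" for c
    by (rule elementary_test_function[OF _ K])
       (auto intro!: elementary_sum I(1) elementary.mult elementary.const el sum.neutral simp: \<theta>0)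
  have "enat (card I) \<le> morse_index \<Omega> a f u"
  proof (rule morse_index_ge[OF I(1) test test1 \<Omega>])
    fix c :: "'n option \<times> nat \<Rightarrow> real" assume c: "\<exists>i\<in>I. c i \<noteq> 0"
    define S where "S k r = (\<Sum>j<d. c (k, j) * s j r)" for k r
    define S' where "S' k r = (\<Sum>j<d. c (k, j) * s' j r)" for k r
    define B' where "B' r = indicator {\<alpha>..\<beta>} r * B r" for r
    have B': "radial_profile \<alpha> \<beta> B'"
      using Bi[OF ab(1,3)] by (auto simp: radial_profile_def B'_def[abs_def] set_integrable_def)
    have Sd: "(S k has_real_derivative S' k r) (at r)" for k r
      unfolding S_def[abs_def] S'_def
    proof (intro DERIV_sum DERIV_cmult)
      fix j assume "j \<in> {..<d}"
      then have j: "j < d" by simp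
      show "(s j has_real_derivative s' j r) (at r)"
        unfolding s_def[abs_def] s'_def
        by (rule DERIV_cong[OF DERIV_mult[OF cutoff_deriv[OF \<alpha> ab(2)] q(2)[OF j]]]) simp
    qed
    have cc: "continuous_on UNIV (cutoff \<alpha> \<beta>)"
      using cutoff_deriv[OF \<alpha> ab(2)] by (meson DERIV_isCont continuous_at_imp_continuous_on)
    have qc: "continuous_on UNIV (q j)" if "j < d" for j
      using q(2)[OF that] by (meson DERIV_isCont continuous_at_imp_continuous_on)
    have S'c: "continuous_on UNIV (S' k)" for k
      unfolding S'_def[abs_def] s'_def[abs_def]
      by (intro continuous_intros cc cutoff'_cont[OF \<alpha> ab(2)] qc q(3)) auto
    have Sz: "S k r = 0" "S' k r = 0" if "r \<notin> {\<alpha>..\<beta>}" for k r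
      using sz[OF that] by (simp_all add: S_def S'_def)
    interpret profiles \<alpha> \<beta> "S None" "S' None" "\<lambda>i. S (Some i)" "\<lambda>i. S' (Some i)" B'
      by unfold_locales (use \<alpha> ab(2) Sd S'c Sz B' in \<open>auto simp del: atLeastAtMost_iff\<close>)
    have comb: "(\<Sum>i\<in>I. c i * \<theta> i x) = \<phi> x" for x :: "real^'n"
    proof -
      have "(\<Sum>i\<in>I. c i * \<theta> i x) = (\<Sum>k\<in>UNIV. \<Sum>j<d. c (k, j) * \<theta> (k, j) x)"
        unfolding I_def by (subst sum.cartesian_product) (auto intro!: sum.cong)
      also have "\<dots> = (\<Sum>k\<in>UNIV. (case k of None \<Rightarrow> norm x | Some i \<Rightarrow> x $ i) * S k (norm x))"
        by (intro sum.cong refl) (simp add: \<theta>_def S_def sum_distrib_left mult_ac)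
      also have "\<dots> = norm x * S None (norm x) + (\<Sum>i\<in>UNIV. x $ i * S (Some i) (norm x))"
        by (simp add: UNIV_option_conv sum.reindex)
      finally show ?thesis by (simp add: \<phi>_def)
    qed
    define \<Phi> where "\<Phi> x = (\<Sum>i\<in>I. c i * \<theta> i x)" for x
    have \<Phi>eq: "\<Phi> = \<phi>" using comb by (auto simp: \<Phi>_def)
    have test\<Phi>: "test_function \<Omega> \<Phi>" unfolding \<Phi>_def[abs_def] by (rule test)
    have c\<Phi>: "continuous_on UNIV \<Phi>" using test_function_props[OF test\<Phi>] by metis
    have m\<Phi>[measurable]: "\<Phi> \<in> borel_measurable borel" using c\<Phi> by (rule borel_measurable_continuous_onI)
    define V where "V x = deriv (\<lambda>s. f (cauchy_g a s) / sqrt (a (cauchy_g a s))) (inv (cauchy_g a) (u x))" for x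
    have Vm: "(\<lambda>x. indicator \<Omega> x * V x) \<in> borel_measurable lebesgue"
    proof (rule measurable_completion)
      have "(\<lambda>x::real^'n. B (norm x)) \<in> borel_measurable borel"
        by (rule measurable_compose[OF _ Bm]) simp
      then have "(\<lambda>x. indicator \<Omega> x * B (norm x)) \<in> borel_measurable lborel"
        using \<Omega> by simp
      then show "(\<lambda>x. indicator \<Omega> x * V x) \<in> borel_measurable lborel"
        by (rule measurable_discrete_difference[where X="{0}"]) (auto simp: V_def pot indicator_def)
    qed
    have "(LINT x:\<Omega>|lebesgue. V x * (rep_L0 (abs_L0 \<Phi>) x)\<^sup>2) = (LINT x:\<Omega>|lebesgue. V x * (\<Phi> x)\<^sup>2)"
      by (rule set_integral_rep_abs_L0[OF Vm measurable_completion]) simp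
    also have "\<dots> = (LINT x:\<Omega>|lebesgue. B' (norm x) * (\<Phi> x)\<^sup>2)"
      unfolding set_lebesgue_integral_def
    proof (rule Bochner_Integration.integral_cong)
      fix x
      show "indicator \<Omega> x *\<^sub>R (V x * (\<Phi> x)\<^sup>2) = indicator \<Omega> x *\<^sub>R (B' (norm x) * (\<Phi> x)\<^sup>2)"
      proof (cases "x \<in> K")
        case True
        then have "x \<in> \<Omega>" "x \<noteq> 0" "norm x \<in> {\<alpha>..\<beta>}" using K \<alpha> by (auto simp: K_def)
        then show ?thesis using pot[of x] by (simp add: V_def B'_def)
      next
        case False
        then have "\<Phi> x = 0" by (simp add: \<Phi>_def \<theta>0)
        then show ?thesis by simp
      qed
    qed simp
    also have "\<dots> = (LINT x|lborel. B' (norm x) * (\<Phi> x)\<^sup>2)"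
    proof (rule set_integral_lebesgue_lborel)
      show "(\<lambda>x. B' (norm x) * (\<Phi> x)\<^sup>2) \<in> borel_measurable borel" unfolding B'_def by measurable
      show "B' (norm x) * (\<Phi> x)\<^sup>2 = 0" if "x \<notin> \<Omega>" for x
      proof -
        have "x \<notin> K" using that K(2) by blast
        then show ?thesis by (simp add: \<Phi>_def \<theta>0)
      qed
    qed
    finally have pot_int: "(LINT x:\<Omega>|lebesgue. V x * (rep_L0 (abs_L0 \<Phi>) x)\<^sup>2) = (LINT x|lborel. B' (norm x) * (\<Phi> x)\<^sup>2)" .
    have qS: "qform N B' (S k) (S' k) \<le> 0" "\<exists>j<d. c (k, j) \<noteq> 0 \<Longrightarrow> qform N B' (S k) (S' k) < 0" for k
    proof -
      have eq: "qform N B' (S k) (S' k) = qform N B (S k) (S' k)"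
        by (rule qform_cong) (use Sz in \<open>auto simp: B'_def indicator_def simp del: atLeastAtMost_iff\<close>)
      show n: "qform N B' (S k) (S' k) < 0" if "\<exists>j<d. c (k, j) \<noteq> 0"
        unfolding eq using neg[of "\<lambda>j. c (k, j)"] that
        unfolding S_def[abs_def] S'_def[abs_def] s_def s'_def by simp
      show "qform N B' (S k) (S' k) \<le> 0"
      proof (cases "\<exists>j<d. c (k, j) \<noteq> 0")
        case False
        then have "S k = (\<lambda>r. 0)" "S' k = (\<lambda>r. 0)" by (auto simp: S_def S'_def)
        then show ?thesis by (simp add: qform_zero)
      qed (use n in auto)
    qed
    have "second_variation \<Omega> a f u (abs_L0 \<Phi>) = (LINT x|lborel. (norm (grad \<Phi> x))\<^sup>2) - (LINT x|lborel. B' (norm x) * (\<Phi> x)\<^sup>2)"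
      unfolding second_variation_def Let_def weak_grad_test_function[OF \<Omega> test\<Phi>] pot_int[unfolded V_def] ..
    also have "\<dots> \<le> unit_ball_vol N * N * (qform N B' (S None) (S' None) + (\<Sum>i\<in>(UNIV::'n set). qform N B' (S (Some i)) (S' (Some i))) / N)"
      unfolding \<Phi>eq using energy_bound NN by simp
    also have "\<dots> < 0"
    proof -
      obtain k j where kj: "j < d" "c (k, j) \<noteq> 0" using c by (auto simp: I_def)
      have sum: "(\<Sum>i\<in>(UNIV::'n set). qform N B' (S (Some i)) (S' (Some i))) \<le> 0" by (rule sum_nonpos) (rule qS)
      have "qform N B' (S None) (S' None) + (\<Sum>i\<in>(UNIV::'n set). qform N B' (S (Some i)) (S' (Some i))) / N < 0"
      proof (cases k)
        case None
        then have "qform N B' (S None) (S' None) < 0" using kj by (intro qS) auto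
        moreover have "(\<Sum>i\<in>(UNIV::'n set). qform N B' (S (Some i)) (S' (Some i))) / N \<le> 0" using sum by (simp add: divide_le_0_iff)
        ultimately show ?thesis by linarith
      next
        case (Some i)
        have "qform N B' (S (Some i)) (S' (Some i)) < 0" using Some kj by (intro qS) auto
        then have "(\<Sum>i\<in>(UNIV::'n set). qform N B' (S (Some i)) (S' (Some i))) < (\<Sum>i\<in>(UNIV::'n set). 0)"
          by (intro sum_strict_mono_ex1) (auto intro: qS)
        then have "(\<Sum>i\<in>(UNIV::'n set). qform N B' (S (Some i)) (S' (Some i))) / N < 0" using NN by (simp add: divide_less_0_iff)
        then show ?thesis using qS(1)[of None] by linarith
      qed
      moreover have "0 < unit_ball_vol N * N" using NN by simp
      ultimately show ?thesis by (simp add: mult_pos_neg)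
    qed
    finally show "second_variation \<Omega> a f u (abs_L0 (\<lambda>x. \<Sum>i\<in>I. c i * \<theta> i x)) < 0" unfolding \<Phi>_def[abs_def] .
  qed
  then show ?thesis by (simp add: I)
qed

end

section \<open>The substitution and the power nonlinearities\<close>

text \<open>Surjectivity: a primitive \<open>A\<close> of \<open>sqrt a\<close> satisfies \<open>A (g s) = s + A (g 0)\<close>, and \<open>A\<close> is injective.\<close>

lemma cauchy_g_props:
  fixes a :: "real \<Rightarrow> real"
  assumes cont: "continuous_on UNIV a" and ge1: "\<And>s. 1 \<le> a s"
  shows "cauchy_g a 0 = 0" "(cauchy_g a has_real_derivative 1 / sqrt (a (cauchy_g a s))) (at s)"
    "surj (cauchy_g a)"
proof -
  define g where "g = cauchy_g a"
  have g: "g 0 = 0" "\<And>s. (g has_real_derivative 1 / sqrt (a (g s))) (at s)"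
    using theI'[OF ex1_cauchy_g[OF cont ge1]] unfolding g_def cauchy_g_def by auto
  then show "cauchy_g a 0 = 0" "(cauchy_g a has_real_derivative 1 / sqrt (a (cauchy_g a s))) (at s)"
    by (simp_all add: g_def)
  have "\<exists>F. \<forall>x::real. -\<infinity> < ereal x \<longrightarrow> ereal x < \<infinity> \<longrightarrow> (F has_vector_derivative sqrt (a x)) (at x)"
    by (rule einterval_antiderivative)
       (use cont in \<open>auto intro!: continuous_intros simp: continuous_on_eq_continuous_at\<close>)
  then obtain A where A: "\<And>x. (A has_real_derivative sqrt (a x)) (at x)"
    by (auto simp: has_real_derivative_iff_has_vector_derivative)
  have pos: "0 < sqrt (a x)" for x using ge1[of x] by simp
  have "((\<lambda>s. A (g s) - s) has_real_derivative 0) (at s)" for s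
  proof -
    have "((\<lambda>s. A (g s)) has_real_derivative sqrt (a (g s)) * (1 / sqrt (a (g s)))) (at s)"
      by (rule DERIV_chain2[OF A g(2)])
    then have "((\<lambda>s. A (g s)) has_real_derivative 1) (at s)" using pos[of "g s"] by simp
    from DERIV_diff[OF this DERIV_ident] show ?thesis by simp
  qed
  then have Ag: "A (g s) - s = A (g 0) - 0" for s
    using DERIV_isconst_all[of "\<lambda>s. A (g s) - s"] by blast
  have inc: "A x < A y" if "x < y" for x y
    by (rule DERIV_pos_imp_increasing[OF that]) (use A pos in blast)
  have "\<exists>s. x = g s" for x
  proof -
    have "A (g (A x - A (g 0))) = A x" using Ag[of "A x - A (g 0)"] by simp
    then have "g (A x - A (g 0)) = x" using inc[of "g (A x - A (g 0))" x] inc[of x "g (A x - A (g 0))"] by (cases "g (A x - A (g 0))" x rule: linorder_cases) auto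
    then show ?thesis by metis
  qed
  then show "surj (cauchy_g a)" unfolding surj_def g_def by blast
qed

text \<open>The potential of the second variation, expressed through \<open>t = u x\<close> instead of \<open>v x\<close>.\<close>

lemma deriv_h:
  assumes cont: "continuous_on UNIV a" and ge1: "\<And>s. 1 \<le> a s"
    and h': "((\<lambda>t. f t / sqrt (a t)) has_real_derivative h') (at t)"
  shows "deriv (\<lambda>s. f (cauchy_g a s) / sqrt (a (cauchy_g a s))) (inv (cauchy_g a) t) = h' / sqrt (a t)"
proof -
  note g = cauchy_g_props[OF cont ge1]
  have gt: "cauchy_g a (inv (cauchy_g a) t) = t" by (rule surj_f_inv_f[OF g(3)])
  have "((\<lambda>s. f (cauchy_g a s) / sqrt (a (cauchy_g a s))) has_real_derivative h' * (1 / sqrt (a t))) (at (inv (cauchy_g a) t))"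
    using DERIV_chain2[of "\<lambda>t. f t / sqrt (a t)" h' "cauchy_g a" "inv (cauchy_g a) t"] h' g(2)[of "inv (cauchy_g a) t"]
    unfolding gt by blast
  then show ?thesis by (simp add: DERIV_imp_deriv)
qed

lemma abs_powr_deriv:
  fixes q :: real
  assumes "1 < q"
  shows "((\<lambda>t. \<bar>t\<bar> powr q) has_real_derivative q * \<bar>t\<bar> powr (q - 1) * sgn t) (at t)"
proof (cases t "0::real" rule: linorder_cases)
  case greater
  have "((\<lambda>t. t powr q) has_real_derivative q * t powr (q - 1)) (at t)"
    using greater by (rule has_real_derivative_powr)
  then have "((\<lambda>t. \<bar>t\<bar> powr q) has_real_derivative q * t powr (q - 1)) (at t)"
    by (rule has_field_derivative_transform_within_open[where S="{0<..}"]) (use greater in auto)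
  then show ?thesis using greater by simp
next
  case less
  have "((\<lambda>t. (- t) powr q) has_real_derivative (q * (- t) powr (q - 1)) * (- 1)) (at t)"
    by (rule DERIV_chain2[OF has_real_derivative_powr]) (use less in \<open>auto intro!: derivative_eq_intros\<close>)
  then have "((\<lambda>t. \<bar>t\<bar> powr q) has_real_derivative (q * (- t) powr (q - 1)) * (- 1)) (at t)"
    by (rule has_field_derivative_transform_within_open[where S="{..<0}"]) (use less in auto)
  then show ?thesis using less by simp
next
  case equal
  have lim: "((\<lambda>h::real. \<bar>h\<bar> powr (q - 1)) \<longlongrightarrow> 0) (at 0)"
  proof (rule tendsto_zero_powrI)
    show "((\<lambda>h::real. \<bar>h\<bar>) \<longlongrightarrow> 0) (at 0)" using tendsto_rabs[OF tendsto_ident_at[of "0::real" UNIV]] by simp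
    show "((\<lambda>h::real. q - 1) \<longlongrightarrow> q - 1) (at 0)" by simp
  qed (use assms in auto)
  have "((\<lambda>h::real. \<bar>h\<bar> powr q / h) \<longlongrightarrow> 0) (at 0)"
  proof (rule Lim_null_comparison[OF _ lim])
    have "norm (\<bar>h\<bar> powr q / h) \<le> \<bar>h\<bar> powr (q - 1)" if "h \<noteq> 0" for h :: real
      using that by (simp add: powr_diff)
    then show "\<forall>\<^sub>F h in at 0. norm (\<bar>h\<bar> powr q / h) \<le> \<bar>h\<bar> powr (q - 1)"
      by (auto simp: eventually_at intro!: exI[of _ 1])
  qed
  then show ?thesis using equal assms by (simp add: has_field_derivative_iff)
qed

lemma abs_powr_sign_deriv:
  fixes t :: real
  assumes "t \<noteq> 0"
  shows "((\<lambda>t. \<bar>t\<bar> powr (p - 1) * t) has_real_derivative p * \<bar>t\<bar> powr (p - 1)) (at t)"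
proof (cases "0 < t")
  case True
  have "((\<lambda>t. t powr p) has_real_derivative p * t powr (p - 1)) (at t)"
    using True by (rule has_real_derivative_powr)
  then have "((\<lambda>t. \<bar>t\<bar> powr (p - 1) * t) has_real_derivative p * t powr (p - 1)) (at t)"
    by (rule has_field_derivative_transform_within_open[where S="{0<..}"]) (use True in \<open>auto simp: powr_diff\<close>)
  then show ?thesis using True by simp
next
  case False
  then have t: "t < 0" using assms by simp
  have "((\<lambda>t. - ((- t) powr p)) has_real_derivative - ((p * (- t) powr (p - 1)) * (- 1))) (at t)"
    by (rule DERIV_minus[OF DERIV_chain2[OF has_real_derivative_powr]]) (use t in \<open>auto intro!: derivative_eq_intros\<close>)
  then have "((\<lambda>t. \<bar>t\<bar> powr (p - 1) * t) has_real_derivative - ((p * (- t) powr (p - 1)) * (- 1))) (at t)"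
    by (rule has_field_derivative_transform_within_open[where S="{..<0}"]) (use t in \<open>auto simp: powr_diff\<close>)
  then show ?thesis using t by simp
qed

lemma abs_powr_sign_continuous:
  assumes "0 < p"
  shows "continuous_on UNIV (\<lambda>t::real. \<bar>t\<bar> powr (p - 1) * t)"
proof (rule continuous_at_imp_continuous_on, intro ballI)
  fix t :: real
  show "isCont (\<lambda>t::real. \<bar>t\<bar> powr (p - 1) * t) t"
  proof (cases "t = 0")
    case False
    then show ?thesis by (rule DERIV_isCont[OF abs_powr_sign_deriv])
  next
    case True
    have lim: "((\<lambda>h::real. \<bar>h\<bar> powr p) \<longlongrightarrow> 0) (at 0)"
    proof (rule tendsto_zero_powrI)
      show "((\<lambda>h::real. \<bar>h\<bar>) \<longlongrightarrow> 0) (at 0)" using tendsto_rabs[OF tendsto_ident_at[of "0::real" UNIV]] by simp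
      show "((\<lambda>h::real. p) \<longlongrightarrow> p) (at 0)" by simp
    qed (use assms in auto)
    have "((\<lambda>t::real. \<bar>t\<bar> powr (p - 1) * t) \<longlongrightarrow> 0) (at 0)"
    proof (rule Lim_null_comparison[OF _ lim])
      have "norm (\<bar>h\<bar> powr (p - 1) * h) \<le> \<bar>h\<bar> powr p" if "h \<noteq> 0" for h :: real
        using that by (simp add: powr_diff abs_mult)
      then show "\<forall>\<^sub>F h in at 0. norm (\<bar>h\<bar> powr (p - 1) * h) \<le> \<bar>h\<bar> powr p"
        by (auto simp: eventually_at intro!: exI[of _ 1])
    qed
    then show ?thesis using True by (simp add: isCont_def)
  qed
qed

section \<open>The first shell, nodal domains and critical radii\<close>

context sturm
begin

lemma cut_admissible:
  assumes x: "lo < x" "x < y" "y < hi" and wy: "w y = 0"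
    and S: "finite S" and \<theta>: "continuous_on UNIV \<theta>" "\<And>r. r \<notin> S \<Longrightarrow> (\<theta> has_real_derivative \<theta>' r) (at r)"
    "continuous_on (- S) \<theta>'" "\<And>r. \<bar>\<theta>' r\<bar> \<le> L" "\<And>r. r \<le> x \<Longrightarrow> \<theta> r = 0" "\<And>r. r \<le> x \<Longrightarrow> \<theta>' r = 0"
  shows "admissible x y (insert y S) (\<lambda>r. if r < y then \<theta> r * w r else 0) (\<lambda>r. if r < y then \<theta>' r * w r + \<theta> r * w' r else 0)"
    (is "admissible x y _ ?\<eta> ?\<gamma>")
proof -
  have wc: "continuous_on A w" if "A \<subseteq> {lo<..<hi}" for A
    using that by (intro continuous_at_imp_continuous_on) (auto intro!: DERIV_isCont[OF w])
  have w'c1: "continuous_on A w'" if "A \<subseteq> {lo<..<hi}" for A by (rule continuous_on_subset[OF w'c that])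
  have c: "continuous_on ({x..y} \<union> ({..x} \<union> {y..})) ?\<eta>"
  proof (rule continuous_on_closed_Un)
    have "continuous_on {x..y} (\<lambda>r. \<theta> r * w r)"
      by (intro continuous_intros wc continuous_on_subset[OF \<theta>(1)]) (use x in auto)
    then show "continuous_on {x..y} ?\<eta>"
      by (rule continuous_on_eq) (use wy in \<open>auto simp: order_le_less\<close>)
    show "continuous_on ({..x} \<union> {y..}) ?\<eta>"
      by (rule continuous_on_eq[OF continuous_on_const[of _ 0]]) (auto simp: \<theta>(5))
  qed auto
  have oS: "open (- S)" using S by (simp add: open_Compl finite_imp_closed)
  have c': "continuous_on (({lo<..<y} - S) \<union> ({..<x} \<union> {y<..})) ?\<gamma>"
  proof (rule continuous_on_open_Un)
    have "continuous_on ({lo<..<y} - S) (\<lambda>r. \<theta>' r * w r + \<theta> r * w' r)"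
      by (intro continuous_intros wc w'c1 continuous_on_subset[OF \<theta>(1)] continuous_on_subset[OF \<theta>(3)]) (use x in auto)
    then show "continuous_on ({lo<..<y} - S) ?\<gamma>"
      by (rule continuous_on_eq) auto
    show "continuous_on ({..<x} \<union> {y<..}) ?\<gamma>"
      by (rule continuous_on_eq[OF continuous_on_const[of _ 0]]) (auto simp: \<theta>(5,6))
    show "open ({lo<..<y} - S)" using oS by (simp add: Diff_eq open_Int)
  qed auto
  have U: "{x..y} \<union> ({..x} \<union> {y..}) = UNIV" "- insert y S \<subseteq> ({lo<..<y} - S) \<union> ({..<x} \<union> {y<..})" using x by auto
  have d: "(?\<eta> has_real_derivative ?\<gamma> r) (at r)" if "r \<notin> insert y S" for r
  proof (cases "x \<le> r \<and> r < y")
    case True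
    then have r: "lo < r" "r < hi" using x by auto
    have "((\<lambda>r. \<theta> r * w r) has_real_derivative \<theta>' r * w r + w' r * \<theta> r) (at r)"
      by (rule DERIV_mult[OF \<theta>(2) w[OF r]]) (use that in auto)
    then have "(?\<eta> has_real_derivative \<theta>' r * w r + w' r * \<theta> r) (at r)"
      by (rule has_field_derivative_transform_within_open[where S="{..<y}"]) (use True in auto)
    then show ?thesis using True by (simp add: mult.commute)
  next
    case False
    have "((\<lambda>_. 0) has_real_derivative 0) (at r)" by simp
    then have "(?\<eta> has_real_derivative 0) (at r)"
      by (rule has_field_derivative_transform_within_open[where S="{..<x} \<union> {y<..}"]) (use False that \<theta>(5) in auto)
    moreover have "?\<gamma> r = 0" using False that \<theta>(5,6)[of r] by auto
    ultimately show ?thesis by simp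
  qed
  have "continuous_on {x..y} \<theta>" "continuous_on {x..y} w" "continuous_on {x..y} w'"
    using x by (auto intro!: wc w'c1 continuous_on_subset[OF \<theta>(1)])
  moreover have "\<exists>K. \<forall>r\<in>{x..y}. \<bar>h r\<bar> \<le> K" if "continuous_on {x..y} h" for h :: "real \<Rightarrow> real"
    using compact_imp_bounded[OF compact_continuous_image[OF that compact_Icc]] by (auto simp: bounded_iff)
  ultimately obtain K1 K2 K3 where K: "\<forall>r\<in>{x..y}. \<bar>\<theta> r\<bar> \<le> K1" "\<forall>r\<in>{x..y}. \<bar>w r\<bar> \<le> K2" "\<forall>r\<in>{x..y}. \<bar>w' r\<bar> \<le> K3"
    by meson
  have K0: "0 \<le> K1" "0 \<le> K2" "0 \<le> K3" "0 \<le> L"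
    using K x \<theta>(4)[of 0] by (auto dest!: bspec[of _ _ x])
  have "\<bar>?\<gamma> r\<bar> \<le> L * K2 + K1 * K3" for r
  proof (cases "x \<le> r \<and> r < y")
    case True
    then have "\<bar>\<theta>' r * w r\<bar> \<le> L * K2" "\<bar>\<theta> r * w' r\<bar> \<le> K1 * K3"
      unfolding abs_mult using K \<theta>(4)[of r] K0 by (auto intro!: mult_mono)
    then show ?thesis using True by auto
  next
    case False
    then have "?\<gamma> r = 0" using \<theta>(5,6)[of r] by auto
    moreover have "0 \<le> L * K2 + K1 * K3" using K0 by (intro add_nonneg_nonneg mult_nonneg_nonneg)
    ultimately show ?thesis by (simp only: abs_zero)
  qed
  note bd = this
  have "bounded (range ?\<gamma>)"
  proof (rule boundedI)
    fix v assume "v \<in> range ?\<gamma>"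
    then obtain r where "v = ?\<gamma> r" by blast
    then show "norm v \<le> L * K2 + K1 * K3" using bd[of r] by (simp only: real_norm_def)
  qed
  moreover have "?\<eta> r = 0 \<and> ?\<gamma> r = 0" if "r \<notin> {x..y}" for r using that \<theta>(5,6)[of r] by auto
  ultimately show ?thesis using c d S continuous_on_subset[OF c' U(2)] unfolding U(1)
    by (simp only: admissible_def finite_insert) blast
qed

text \<open>In a ball the first shell reaches down to the origin, where \<open>w\<close> has to be cut off by a piecewise linear
\<open>\<theta>\<close> rising from 0 at \<open>\<delta>\<close> to 1 at \<open>2 \<delta>\<close>. As \<open>w\<close> solves the equation, the form of \<open>\<theta> w\<close> is the integral of
\<open>r ^ (N + 1) * (\<theta>' * w)\<^sup>2\<close>. Since \<open>r * w r\<close> is small near 0, this integral is at most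
\<open>2 ^ (N - 1) * \<delta> ^ (N - 2) * e\<^sup>2\<close>.\<close>

lemma first_direction_at_origin:
  assumes lo0: "lo = 0" and N: "2 \<le> N" and t: "0 < t0" "t0 < t1" "t1 < hi" and wt: "w t1 = 0"
    and small: "\<And>e. 0 < e \<Longrightarrow> \<exists>\<delta>>0. \<forall>r. 0 < r \<and> r < \<delta> \<longrightarrow> \<bar>r * w r\<bar> < e" and \<kappa>: "0 < \<kappa>"
  shows "\<exists>\<alpha> S \<eta> \<gamma>. lo < \<alpha> \<and> admissible \<alpha> t1 S \<eta> \<gamma> \<and>
      (\<forall>r. t0 < r \<and> r < t1 \<longrightarrow> \<eta> r = w r \<and> \<gamma> r = w' r) \<and> \<eta> t1 = 0 \<and> \<gamma> t1 = 0 \<and> \<bar>b \<eta> \<gamma> \<eta> \<gamma>\<bar> \<le> \<kappa>"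
proof -
  define e where "e = sqrt (\<kappa> / 2 ^ (N - 1))"
  have e: "0 < e" "2 ^ (N - 1) * e\<^sup>2 = \<kappa>" using \<kappa> by (auto simp: e_def)
  obtain \<delta>0 where \<delta>0: "\<delta>0 > 0" "\<And>r. 0 < r \<Longrightarrow> r < \<delta>0 \<Longrightarrow> \<bar>r * w r\<bar> < e" using small[OF e(1)] by blast
  define \<delta> where "\<delta> = min 1 (min (\<delta>0 / 3) (t0 / 2))"
  have \<delta>: "0 < \<delta>" "\<delta> \<le> 1" "2 * \<delta> < \<delta>0" "2 * \<delta> \<le> t0" using \<delta>0(1) t by (auto simp: \<delta>_def min_def field_simps)
  define \<theta> where "\<theta> r = min 1 (max 0 ((r - \<delta>) / \<delta>))" for r
  define \<theta>' where "\<theta>' r = (if \<delta> < r \<and> r < 2 * \<delta> then 1 / \<delta> else 0)" for r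
  have \<theta>_eq: "\<theta> r = (if r \<le> \<delta> then 0 else if r \<le> 2 * \<delta> then (r - \<delta>) / \<delta> else 1)" for r
    using \<delta>(1) by (auto simp: \<theta>_def min_def max_def field_simps)
  have cd: "continuous_on A (\<lambda>r. (r - \<delta>) / \<delta>)" for A using \<delta>(1) by (auto intro!: continuous_intros)
  have c\<theta>: "continuous_on UNIV \<theta>" unfolding \<theta>_def[abs_def] by (intro continuous_intros continuous_on_min continuous_on_max cd)
  let ?S = "{\<delta>, 2 * \<delta>}"
  have d\<theta>: "(\<theta> has_real_derivative \<theta>' r) (at r)" if r: "r \<notin> ?S" for r
  proof -
    have cst: "((\<lambda>_. k) has_real_derivative 0) (at r)" for k :: real by simp
    consider "r < \<delta>" | "\<delta> < r" "r < 2 * \<delta>" | "2 * \<delta> < r" using r by fastforce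
    then show ?thesis
    proof cases
      case 1
      have "(\<theta> has_real_derivative 0) (at r)"
        by (rule has_field_derivative_transform_within_open[OF cst[of 0], where S="{..<\<delta>}"]) (use 1 in \<open>auto simp: \<theta>_eq\<close>)
      then show ?thesis using 1 by (simp add: \<theta>'_def)
    next
      case 2
      have "((\<lambda>r. (r - \<delta>) / \<delta>) has_real_derivative 1 / \<delta>) (at r)"
        using \<delta>(1) by (auto intro!: derivative_eq_intros)
      then have "(\<theta> has_real_derivative 1 / \<delta>) (at r)"
        by (rule has_field_derivative_transform_within_open[where S="{\<delta><..<2*\<delta>}"]) (use 2 in \<open>auto simp: \<theta>_eq\<close>)
      then show ?thesis using 2 by (simp add: \<theta>'_def)
    next
      case 3
      have "(\<theta> has_real_derivative 0) (at r)"
        by (rule has_field_derivative_transform_within_open[OF cst[of 1], where S="{2*\<delta><..}"]) (use 3 \<delta>(1) in \<open>auto simp: \<theta>_eq\<close>)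
      then show ?thesis using 3 by (simp add: \<theta>'_def)
    qed
  qed
  have c\<theta>': "continuous_on (- ?S) \<theta>'"
  proof -
    have "continuous_on ({\<delta><..<2*\<delta>} \<union> ({..<\<delta>} \<union> {2*\<delta><..})) \<theta>'"
    proof (rule continuous_on_open_Un)
      show "continuous_on {\<delta><..<2*\<delta>} \<theta>'" by (rule continuous_on_eq[OF continuous_on_const[of _ "1/\<delta>"]]) (auto simp: \<theta>'_def)
      show "continuous_on ({..<\<delta>} \<union> {2*\<delta><..}) \<theta>'" by (rule continuous_on_eq[OF continuous_on_const[of _ 0]]) (auto simp: \<theta>'_def)
    qed auto
    moreover have "{\<delta><..<2*\<delta>} \<union> ({..<\<delta>} \<union> {2*\<delta><..}) = - ?S" using \<delta>(1) by auto
    ultimately show ?thesis by simp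
  qed
  have b\<theta>: "\<bar>\<theta> r\<bar> \<le> 1" "\<bar>\<theta>' r\<bar> \<le> 1 / \<delta>" for r using \<delta>(1) by (auto simp: \<theta>_def \<theta>'_def)
  have z\<theta>: "\<theta> r = 0" "\<theta>' r = 0" if "r \<le> \<delta>" for r using that by (auto simp: \<theta>_eq \<theta>'_def)
  have xy: "lo < \<delta>" "\<delta> < t1" "t1 < hi" using lo0 \<delta> t by auto
  define \<eta> where "\<eta> r = (if r < t1 then \<theta> r * w r else 0)" for r
  define \<gamma> where "\<gamma> r = (if r < t1 then \<theta>' r * w r + \<theta> r * w' r else 0)" for r
  have adm: "admissible \<delta> t1 (insert t1 ?S) \<eta> \<gamma>"
    unfolding \<eta>_def[abs_def] \<gamma>_def[abs_def]
    by (rule cut_admissible[OF xy wt _ c\<theta> d\<theta> c\<theta>' b\<theta>(2) z\<theta>]) auto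
  (* the test function \<theta>^2 w: paired with w it gives the form of \<theta> w except for the \<theta>'^2 term R below *)
  define g where "g r = (if r < t1 then (\<theta> r)\<^sup>2 * w r else 0)" for r
  define g' where "g' r = (if r < t1 then (2 * \<theta> r * \<theta>' r) * w r + (\<theta> r)\<^sup>2 * w' r else 0)" for r
  have admg: "admissible \<delta> t1 (insert t1 ?S) g g'"
    unfolding g_def[abs_def] g'_def[abs_def]
  proof (rule cut_admissible[OF xy wt])
    show "continuous_on UNIV (\<lambda>r. (\<theta> r)\<^sup>2)" by (intro continuous_intros c\<theta>)
    show "((\<lambda>r. (\<theta> r)\<^sup>2) has_real_derivative 2 * \<theta> r * \<theta>' r) (at r)" if "r \<notin> ?S" for r
      by (rule DERIV_cong[OF DERIV_power[OF d\<theta>[OF that], of 2]]) simp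
    show "continuous_on (- ?S) (\<lambda>r. 2 * \<theta> r * \<theta>' r)" by (intro continuous_intros c\<theta>' continuous_on_subset[OF c\<theta>]) auto
    show "\<bar>2 * \<theta> r * \<theta>' r\<bar> \<le> 2 * 1 * (1 / \<delta>)" for r
      unfolding abs_mult using b\<theta>[of r] \<delta>(1) by (intro mult_mono) auto
  qed (auto simp: z\<theta>)
  have X0: "b (piece \<delta> t1) (piece' \<delta> t1) g g' = 0"
    using b_piece[OF xy(1) less_imp_le[OF xy(2)] xy(3) xy(1,3) admg, of "piece \<delta> t1" "piece' \<delta> t1"]
    by (simp add: piece_def piece'_def g_def z\<theta>)
  define R where "R r = r ^ (N + 1) * (\<theta>' r * w r)\<^sup>2" for r
  have pw: "r ^ (N + 1) * (piece' \<delta> t1 r * g' r - B r * (piece \<delta> t1 r * g r)) = r ^ (N + 1) * (\<gamma> r * \<gamma> r - B r * (\<eta> r * \<eta> r)) - R r" for r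
  proof -
    consider "r \<le> \<delta>" | "\<delta> < r" "r < t1" | "t1 \<le> r" by linarith
    then show ?thesis
    proof cases
      case 2
      then show ?thesis
        by (simp add: piece_def piece'_def g_def g'_def \<eta>_def \<gamma>_def R_def power2_eq_square algebra_simps)
    next
      case 3
      then have "\<theta>' r = 0" using \<delta> t by (simp add: \<theta>'_def)
      then show ?thesis using 3 by (simp add: piece_def piece'_def \<eta>_def \<gamma>_def R_def)
    qed (simp add: z\<theta> piece_def piece'_def \<eta>_def \<gamma>_def R_def)
  qed
  define C where "C = (2 * \<delta>) ^ (N - 1) * e\<^sup>2 / \<delta>\<^sup>2"
  have Rb: "0 \<le> R r" "R r \<le> C * indicator {\<delta>..2*\<delta>} r" for r
  proof -
    show "0 \<le> R r"
    proof (cases "\<delta> < r \<and> r < 2 * \<delta>")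
      case True
      then have "0 < r" using \<delta>(1) by auto
      then show ?thesis unfolding R_def by (intro mult_nonneg_nonneg) auto
    qed (auto simp: R_def \<theta>'_def)
    show "R r \<le> C * indicator {\<delta>..2*\<delta>} r"
    proof (cases "\<delta> < r \<and> r < 2 * \<delta>")
      case True
      then have r: "0 < r" "r < \<delta>0" using \<delta> by auto
      have N2: "r ^ (N + 1) = r ^ (N - 1) * r\<^sup>2"
        using N by (simp flip: power_add)
      have "(r * w r)\<^sup>2 \<le> e\<^sup>2" using \<delta>0(2)[OF r] e(1) by (intro abs_le_square_iff[THEN iffD1]) auto
      moreover have "r ^ (N - 1) \<le> (2 * \<delta>) ^ (N - 1)" using True r by (intro power_mono) auto
      ultimately have "r ^ (N - 1) * (r * w r)\<^sup>2 \<le> (2 * \<delta>) ^ (N - 1) * e\<^sup>2" using r \<delta>(1) by (intro mult_mono) auto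
      then have "(r ^ (N - 1) * (r * w r)\<^sup>2) / \<delta>\<^sup>2 \<le> C" unfolding C_def by (rule divide_right_mono) simp
      moreover have "R r = (r ^ (N - 1) * (r * w r)\<^sup>2) / \<delta>\<^sup>2"
        unfolding R_def N2 using True by (simp add: \<theta>'_def power_mult_distrib power_divide)
      ultimately show ?thesis using True by simp
    next
      case False
      then have "\<theta>' r = 0" by (auto simp: \<theta>'_def)
      then show ?thesis using \<delta>(1) by (simp add: R_def C_def)
    qed
  qed
  have Rm: "R \<in> borel_measurable borel"
  proof -
    have "continuous_on {\<delta>..2*\<delta>} w"
      using xy \<delta>(4) t by (intro continuous_at_imp_continuous_on) (auto intro!: DERIV_isCont[OF w])
    then have [measurable]: "(\<lambda>r. indicator {\<delta>..2*\<delta>} r *\<^sub>R w r) \<in> borel_measurable borel"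
      by (intro borel_measurable_continuous_on_indicator) auto
    have [measurable]: "\<theta>' \<in> borel_measurable borel"
      by (rule borel_measurable_continuous_countable_exceptions[OF _ c\<theta>']) simp
    have "R = (\<lambda>r. r ^ (N + 1) * (\<theta>' r * (indicator {\<delta>..2*\<delta>} r *\<^sub>R w r))\<^sup>2)"
      by (auto simp: R_def \<theta>'_def indicator_def)
    also have "\<dots> \<in> borel_measurable borel" by measurable
    finally show ?thesis .
  qed
  have Ci: "integrable lborel (\<lambda>r. C * indicat_real {\<delta>..2*\<delta>} r)" by (simp add: emeasure_lborel_Icc_eq)
  have Ri: "integrable lborel R"
    by (rule Bochner_Integration.integrable_bound[OF Ci]) (use Rm Rb in \<open>auto intro!: AE_I2 order_trans[OF _ abs_ge_self]\<close>)
  have "(LINT r|lborel. R r) \<le> (LINT r|lborel. C * indicat_real {\<delta>..2*\<delta>} r)"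
    by (rule integral_mono[OF Ri Ci Rb(2)])
  also have "\<dots> = C * \<delta>" using \<delta>(1) by simp
  also have "\<dots> \<le> \<kappa>"
  proof -
    obtain n where n: "N = Suc (Suc n)" using N by (metis add_2_eq_Suc le_Suc_ex)
    have "C * \<delta> = \<delta> ^ n * (2 ^ (N - 1) * e\<^sup>2)"
      using \<delta>(1) by (simp add: C_def n power_mult_distrib power2_eq_square)
    also have "\<dots> \<le> 1 * (2 ^ (N - 1) * e\<^sup>2)" using \<delta>(1,2) by (intro mult_right_mono power_le_one) auto
    finally show ?thesis using e(2) by simp
  qed
  finally have R\<kappa>: "(LINT r|lborel. R r) \<le> \<kappa>" .
  have Ei: "integrable lborel (\<lambda>r. r ^ (N + 1) * (\<gamma> r * \<gamma> r - B r * (\<eta> r * \<eta> r)))"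
    by (rule b_integrable[OF xy(1,3) adm adm])
  have "0 = b \<eta> \<gamma> \<eta> \<gamma> - (LINT r|lborel. R r)"
    using X0 unfolding bform_def pw using Bochner_Integration.integral_diff[OF Ei Ri] by simp
  moreover have "0 \<le> (LINT r|lborel. R r)" by (rule Bochner_Integration.integral_nonneg) (rule Rb)
  ultimately have "\<bar>b \<eta> \<gamma> \<eta> \<gamma>\<bar> \<le> \<kappa>" using R\<kappa> by simp
  moreover have "\<eta> r = w r \<and> \<gamma> r = w' r" if "t0 < r" "r < t1" for r
    using that \<delta> by (simp add: \<eta>_def \<gamma>_def \<theta>_eq \<theta>'_def)
  moreover have "\<eta> t1 = 0" "\<gamma> t1 = 0" by (simp_all add: \<eta>_def \<gamma>_def)
  ultimately show ?thesis using xy(1) adm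
    by (intro exI[of _ \<delta>] exI[of _ "insert t1 ?S"] exI[of _ \<eta>] exI[of _ \<gamma>]) auto
qed

lemma first_direction_annulus:
  assumes t: "lo < t0" "t0 < t1" "t1 < hi" and wt: "w t0 = 0" "w t1 = 0" and \<kappa>: "0 < \<kappa>"
  shows "\<exists>\<alpha> S \<eta> \<gamma>. lo < \<alpha> \<and> admissible \<alpha> t1 S \<eta> \<gamma> \<and>
      (\<forall>r. t0 < r \<and> r < t1 \<longrightarrow> \<eta> r = w r \<and> \<gamma> r = w' r) \<and> \<eta> t1 = 0 \<and> \<gamma> t1 = 0 \<and> \<bar>b \<eta> \<gamma> \<eta> \<gamma>\<bar> \<le> \<kappa>"
  using piece_admissible[OF t wt] b_piece_self[OF t wt] t(1) \<kappa>
  by (intro exI[of _ t0] exI[of _ "{t0, t1}"] exI[of _ "piece t0 t1"] exI[of _ "piece' t0 t1"])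
     (auto simp: piece_def piece'_def)

end

lemma rolle_zeros:
  fixes U D :: "real \<Rightarrow> real" and p :: "nat \<Rightarrow> real"
  assumes p: "\<And>i. i < n \<Longrightarrow> p i < p (Suc i)" and U0: "\<And>i. i \<le> n \<Longrightarrow> U (p i) = 0"
    and c: "continuous_on {p 0..p n} U" and d: "\<And>r. p 0 < r \<Longrightarrow> r < p n \<Longrightarrow> (U has_real_derivative D r) (at r)"
  obtains t where "\<And>i. i < n \<Longrightarrow> p i < t i" "\<And>i. i < n \<Longrightarrow> t i < p (Suc i)" "\<And>i. i < n \<Longrightarrow> D (t i) = 0"
proof -
  have le: "p i \<le> p j" if "i \<le> j" "j \<le> n" for i j
    using that
  proof (induction j)
    case (Suc j)
    then show ?case using p[of j] by (cases "i = Suc j") auto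
  qed simp
  have "\<exists>t. p i < t \<and> t < p (Suc i) \<and> D t = 0" if i: "i < n" for i
  proof -
    have sub: "p 0 \<le> p i" "p (Suc i) \<le> p n" using le[of 0 i] le[of "Suc i" n] i by auto
    have "\<exists>z. p i < z \<and> z < p (Suc i) \<and> (U has_real_derivative 0) (at z)"
    proof (rule Rolle[OF p[OF i]])
      show "U (p i) = U (p (Suc i))" using U0 i by simp
      show "continuous_on {p i..p (Suc i)} U" by (rule continuous_on_subset[OF c]) (use sub in auto)
      show "U differentiable at r" if "p i < r" "r < p (Suc i)" for r
        using d[of r] that sub real_differentiable_def by fastforce
    qed
    then obtain z where z: "p i < z" "z < p (Suc i)" "(U has_real_derivative 0) (at z)" by blast
    have "D z = 0" using DERIV_unique[OF d z(3)] z sub by auto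
    with z show ?thesis by blast
  qed
  then obtain t where "\<forall>i. i < n \<longrightarrow> p i < t i \<and> t i < p (Suc i) \<and> D (t i) = 0" by metis
  with that[of t] show ?thesis by auto
qed

text \<open>Pick a point in each of \<open>m\<close> nodal domains and order the points by their norm. If \<open>U\<close> had no zero strictly
between two of the norms, the closed shell between the points, which is connected in dimension at
least 2, would join their nodal domains.\<close>

lemma nodal_zeros:
  fixes \<Omega> :: "(real^'n) set"
  assumes N: "2 \<le> CARD('n)" and rad: "radial_on \<Omega> u"
    and between: "\<And>x y p. x \<in> \<Omega> \<Longrightarrow> y \<in> \<Omega> \<Longrightarrow> norm x \<le> norm p \<Longrightarrow> norm p \<le> norm y \<Longrightarrow> p \<in> \<Omega>"
    and m: "enat m \<le> nod \<Omega> u" and U: "\<And>x. x \<in> \<Omega> \<Longrightarrow> x \<noteq> 0 \<Longrightarrow> u x = U (norm x)"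
  obtains z :: "nat \<Rightarrow> real" where "\<And>i. Suc i < m \<Longrightarrow> U (z i) = 0" "\<And>i. Suc (Suc i) < m \<Longrightarrow> z i < z (Suc i)"
    "\<And>i. Suc i < m \<Longrightarrow> \<exists>x\<in>\<Omega>. \<exists>y\<in>\<Omega>. norm x < z i \<and> z i < norm y"
proof -
  define O' where "O' = \<Omega> - u -` {0}"
  obtain C where C: "C \<subseteq> components O'" "finite C" "card C = m"
  proof (cases "finite (components O')")
    case True
    then have "m \<le> card (components O')" using m by (simp add: nod_def O'_def)
    from obtain_subset_with_card_n[OF this] True that show ?thesis by (metis finite_subset)
  next
    case False
    from infinite_arbitrarily_large[OF this] that show ?thesis by metis
  qed
  have "\<exists>x. x \<in> c" if "c \<in> C" for c using C(1) that in_components_nonempty by blast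
  then obtain pt where pt: "\<And>c. c \<in> C \<Longrightarrow> pt c \<in> c" by metis
  have ptO: "pt c \<in> O'" if "c \<in> C" for c using pt[OF that] C(1) that in_components_subset by blast
  have key: "\<exists>r. norm (pt c) < r \<and> r < norm (pt c') \<and> U r = 0"
    if cc: "c \<in> C" "c' \<in> C" "c \<noteq> c'" "norm (pt c) \<le> norm (pt c')" for c c'
  proof (rule ccontr)
    assume no: "\<not> ?thesis"
    define A where "A = {p::real^'n. norm (pt c) \<le> norm p \<and> norm p \<le> norm (pt c')}"
    have conn: "connected A" using connected_annulus(4)[where a="0::real^'n" and ?r1.0="norm (pt c)" and ?r2.0="norm (pt c')"] N
    by (simp add: A_def)
    have AO: "A \<subseteq> O'"
    proof
      fix p assume p: "p \<in> A"
      have O: "pt c \<in> \<Omega>" "pt c' \<in> \<Omega>" "u (pt c) \<noteq> 0" "u (pt c') \<noteq> 0" using ptO cc by (auto simp: O'_def)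
      then have p\<Omega>: "p \<in> \<Omega>" using between[of "pt c" "pt c'" p] p by (auto simp: A_def)
      have "u p \<noteq> 0"
      proof -
        consider "norm p = norm (pt c)" | "norm p = norm (pt c')" | "norm (pt c) < norm p" "norm p < norm (pt c')"
          using p by (force simp: A_def)
        then show ?thesis
        proof cases
          case 1 then show ?thesis using rad p\<Omega> O unfolding radial_on_def by metis
        next
          case 2 then show ?thesis using rad p\<Omega> O unfolding radial_on_def by metis
        next
          case 3
          then have "p \<noteq> 0" by auto
          then show ?thesis using U[OF p\<Omega>] no 3 by auto
        qed
      qed
      with p\<Omega> show "p \<in> O'" by (simp add: O'_def)
    qed
    have in_A: "pt c \<in> A" "pt c' \<in> A" using cc by (auto simp: A_def)
    have "A \<subseteq> c" using components_maximal[of c O' A] C(1) cc conn AO in_A pt by blast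
    moreover have "A \<subseteq> c'" using components_maximal[of c' O' A] C(1) cc conn AO in_A pt by blast
    ultimately have "c \<inter> c' \<noteq> {}" using in_A by blast
    then show False using components_nonoverlap[of c O' c'] C(1) cc by blast
  qed
  define \<rho> where "\<rho> c = norm (pt c)" for c
  have inj: "inj_on \<rho> C"
    using key by (force simp: inj_on_def \<rho>_def)
  define xs where "xs = sorted_list_of_set (\<rho> ` C)"
  have xs: "length xs = m" "sorted_wrt (<) xs" "set xs = \<rho> ` C"
    using C card_image[OF inj] by (auto simp: xs_def)
  have "\<exists>z. xs ! i < z \<and> z < xs ! Suc i \<and> U z = 0" if i: "Suc i < m" for i
  proof -
    have lt: "xs ! i < xs ! Suc i" using sorted_wrt_nth_less[OF xs(2), of i "Suc i"] xs(1) i by simp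
    have "xs ! i \<in> \<rho> ` C" "xs ! Suc i \<in> \<rho> ` C" using xs i nth_mem[of i xs] nth_mem[of "Suc i" xs] by auto
    then obtain c c' where c: "c \<in> C" "xs ! i = \<rho> c" "c' \<in> C" "xs ! Suc i = \<rho> c'" by blast
    then show ?thesis using key[of c c'] lt by (auto simp: \<rho>_def)
  qed
  then obtain z where z: "\<And>i. Suc i < m \<Longrightarrow> xs ! i < z i \<and> z i < xs ! Suc i \<and> U (z i) = 0" by metis
  show ?thesis
  proof (rule that[of z])
    show "U (z i) = 0" if "Suc i < m" for i using z[OF that] by simp
    show "z i < z (Suc i)" if "Suc (Suc i) < m" for i using z[of i] z[of "Suc i"] that by simp
    show "\<exists>x\<in>\<Omega>. \<exists>y\<in>\<Omega>. norm x < z i \<and> z i < norm y" if i: "Suc i < m" for i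
    proof -
      have "xs ! i \<in> \<rho> ` C" "xs ! Suc i \<in> \<rho> ` C" using xs i nth_mem[of i xs] nth_mem[of "Suc i" xs] by auto
      then obtain c c' where c: "c \<in> C" "xs ! i = \<rho> c" "c' \<in> C" "xs ! Suc i = \<rho> c'" by blast
      then show ?thesis using z[OF i] ptO[of c] ptO[of c'] by (intro bexI[of _ "pt c"] bexI[of _ "pt c'"]) (auto simp: \<rho>_def O'_def)
    qed
  qed
qed

section \<open>The estimate\<close>

lemma radial_domain_facts:
  fixes \<Omega> :: "(real^'n) set" and e :: "real^'n"
  assumes \<Omega>: "\<Omega> = ball 0 hi \<and> lo = 0 \<and> 0 < hi \<or> \<Omega> = {x. lo < norm x \<and> norm x < hi} \<and> 0 < lo \<and> lo < hi"
    and e: "norm e = 1"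
  shows "open \<Omega>" "0 \<le> lo" "lo < hi" "{x. lo < norm x \<and> norm x < hi} \<subseteq> \<Omega>" "\<And>x. x \<in> \<Omega> \<Longrightarrow> x \<noteq> 0 \<Longrightarrow> lo < norm x \<and> norm x < hi"
    "\<And>r. lo \<le> r \<Longrightarrow> r \<le> hi \<Longrightarrow> r *\<^sub>R e \<in> closure \<Omega>" "hi *\<^sub>R e \<in> frontier \<Omega>" "0 < lo \<Longrightarrow> lo *\<^sub>R e \<in> frontier \<Omega>"
    "\<And>x y p. x \<in> \<Omega> \<Longrightarrow> y \<in> \<Omega> \<Longrightarrow> norm x \<le> norm p \<Longrightarrow> norm p \<le> norm y \<Longrightarrow> p \<in> \<Omega>"
proof -
  show o: "open \<Omega>" using \<Omega>
  proof
    assume "\<Omega> = {x. lo < norm x \<and> norm x < hi} \<and> 0 < lo \<and> lo < hi"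
    then show ?thesis by (auto intro!: open_Collect_conj open_Collect_less continuous_intros)
  qed auto
  show lo: "0 \<le> lo" "lo < hi" using \<Omega> by auto
  show sub: "{x. lo < norm x \<and> norm x < hi} \<subseteq> \<Omega>" using \<Omega> by auto
  show "lo < norm x \<and> norm x < hi" if "x \<in> \<Omega>" "x \<noteq> 0" for x using \<Omega> that by auto
  show cl: "r *\<^sub>R e \<in> closure \<Omega>" if "lo \<le> r" "r \<le> hi" for r
  proof -
    have "(\<lambda>r. r *\<^sub>R e) ` closure {lo<..<hi} \<subseteq> closure \<Omega>"
    proof (rule image_closure_subset)
      show "(\<lambda>r. r *\<^sub>R e) ` {lo<..<hi} \<subseteq> closure \<Omega>"
      proof
        fix v assume "v \<in> (\<lambda>r. r *\<^sub>R e) ` {lo<..<hi}"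
        then obtain r where r: "lo < r" "r < hi" "v = r *\<^sub>R e" by auto
        then have "norm v = r" using lo e by simp
        then have "v \<in> \<Omega>" using sub r by auto
        then show "v \<in> closure \<Omega>" by (rule subsetD[OF closure_subset])
      qed
    qed (auto intro!: continuous_intros)
    moreover have "r \<in> closure {lo<..<hi}" using that lo by (simp add: closure_greaterThanLessThan)
    ultimately show ?thesis by blast
  qed
  have "hi *\<^sub>R e \<notin> \<Omega>" using \<Omega> e lo by auto
  then show "hi *\<^sub>R e \<in> frontier \<Omega>" using cl[of hi] o lo by (simp add: frontier_def interior_open)
  have "lo *\<^sub>R e \<notin> \<Omega>" if "0 < lo" using \<Omega> e that by auto
  then show "lo *\<^sub>R e \<in> frontier \<Omega>" if "0 < lo" using cl[of lo] o lo that by (simp add: frontier_def interior_open)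
  show "p \<in> \<Omega>" if "x \<in> \<Omega>" "y \<in> \<Omega>" "norm x \<le> norm p" "norm p \<le> norm y" for x y p using \<Omega> that by auto
qed

text \<open>The estimate for all finite numbers \<open>m\<close> of nodal domains covers the case of infinitely many as well:
then the Morse index exceeds every bound.\<close>

lemma nodal_bound:
  assumes "\<And>m. enat m \<le> n \<Longrightarrow> enat ((N + 1) * (m - 1)) \<le> M"
  shows "ereal_of_enat n \<le> 1 + ereal_of_enat M / ereal (real N + 1)"
proof (cases M)
  case infinity
  then have "1 + ereal_of_enat M / ereal (real N + 1) = \<infinity>" by simp
  then show ?thesis by simp
next
  case (enat k)
  have le: "m - 1 \<le> k" if "enat m \<le> n" for m
    using assms[OF that] enat by simp
  have "n \<noteq> \<infinity>"
  proof
    assume "n = \<infinity>"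
    then show False using le[of "k + 2"] by simp
  qed
  then obtain m where n: "n = enat m" by auto
  have "(N + 1) * (m - 1) \<le> k" using assms[of m] n enat by simp
  then have "real ((N + 1) * (m - 1)) \<le> real k" by (rule of_nat_mono)
  then have "(real N + 1) * real (m - 1) \<le> real k" by (simp add: distrib_right)
  then have "real (m - 1) \<le> real k / (real N + 1)" by (simp add: field_simps)
  then have "real m \<le> 1 + real k / (real N + 1)" by (cases m) auto
  then show ?thesis using n enat by (simp add: one_ereal_def)
qed

text \<open>The derivative is nonnegative for \<open>k \<le> 2 p\<close>; this is where the lower bound on \<open>p\<close> enters.\<close>

lemma power_ratio_deriv:
  fixes k p t :: real and a f :: "real \<Rightarrow> real"
  assumes k: "1 < k" and t: "t \<noteq> 0"
    and a_def: "a = (\<lambda>s. 1 + \<bar>s\<bar> powr k)" and f_def: "f = (\<lambda>s. \<bar>s\<bar> powr (p - 1) * s)"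
  shows "((\<lambda>t. f t / sqrt (a t)) has_real_derivative
    \<bar>t\<bar> powr (p - 1) * (2 * p + (2 * p - k) * \<bar>t\<bar> powr k) / (2 * a t * sqrt (a t))) (at t)"
    (is "(_ has_real_derivative ?h') _")
proof -
  define a' where "a' t = k * \<bar>t\<bar> powr (k - 1) * sgn t" for t
  have da: "(a has_real_derivative a' t) (at t)" for t
    unfolding a_def a'_def by (rule DERIV_cong[OF DERIV_add[OF DERIV_const abs_powr_deriv[OF k]]]) simp
  have a0: "0 < a t" for t by (simp add: a_def add_pos_nonneg)
  have s: "0 < sqrt (a t)" using a0 by simp
  have ds: "((\<lambda>t. sqrt (a t)) has_real_derivative a' t * (inverse (sqrt (a t)) / 2)) (at t)"
    by (rule DERIV_cong[OF DERIV_chain2[OF DERIV_real_sqrt da]]) (use a0 in auto)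
  have df: "(f has_real_derivative p * \<bar>t\<bar> powr (p - 1)) (at t)"
    unfolding f_def by (rule abs_powr_sign_deriv[OF t])
  have fa: "f t * a' t = k * (\<bar>t\<bar> powr (p - 1) * \<bar>t\<bar> powr k)"
  proof -
    have "t * sgn t = \<bar>t\<bar>" by (simp add: sgn_if abs_if)
    then have "f t * a' t = k * \<bar>t\<bar> powr (p - 1) * (\<bar>t\<bar> powr (k - 1) * \<bar>t\<bar>)"
      by (simp add: f_def a'_def mult_ac)
    also have "\<bar>t\<bar> powr (k - 1) * \<bar>t\<bar> = \<bar>t\<bar> powr k" using t by (simp add: powr_diff)
    finally show ?thesis by simp
  qed
  define q where "q = sqrt (a t)"
  have q: "0 < q" "a t = q * q" using s a0[of t] by (auto simp: q_def)
  have "((\<lambda>t. f t / sqrt (a t)) has_real_derivative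
     ((p * \<bar>t\<bar> powr (p - 1)) * sqrt (a t) - f t * (a' t * (inverse (sqrt (a t)) / 2))) / (sqrt (a t) * sqrt (a t))) (at t)"
    by (rule DERIV_divide[OF df ds]) (use s in simp)
  moreover have "((p * \<bar>t\<bar> powr (p - 1)) * q - f t * (a' t * (inverse q / 2))) / (q * q) = ?h'"
  proof -
    have "((p * \<bar>t\<bar> powr (p - 1)) * q - f t * (a' t * (inverse q / 2))) / (q * q)
      = (2 * p * \<bar>t\<bar> powr (p - 1) * (q * q) - f t * a' t) / (2 * (q * q) * q)"
      using q(1) by (simp add: field_simps)
    also have "\<dots> = ?h'" unfolding fa q_def[symmetric] q(2)[symmetric]
      by (rule arg_cong2[where f="(/)"]) (simp_all add: a_def algebra_simps)
    finally show ?thesis .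
  qed
  ultimately show ?thesis by (simp add: q_def)
qed

text \<open>Rolle's theorem between consecutive zeros of \<open>U\<close> and between the last one and \<open>hi\<close> gives \<open>t 1, \<dots>, t d\<close>. The point
\<open>t 0\<close> lies to the left of the first zero; it is a critical point if \<open>U\<close> vanishes at \<open>lo\<close> too, that is, in an
annulus, and an auxiliary point in a ball.\<close>

lemma interlacing_critical_points:
  fixes U D :: "real \<Rightarrow> real" and z :: "nat \<Rightarrow> real"
  assumes d: "0 < d" and z: "\<And>i. i < d \<Longrightarrow> U (z i) = 0" "\<And>i. Suc i < d \<Longrightarrow> z i < z (Suc i)"
    "\<And>i. i < d \<Longrightarrow> lo < z i" "\<And>i. i < d \<Longrightarrow> z i < hi"
    and cU: "continuous_on {lo..hi} U" and Uhi: "U hi = 0"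
    and dU: "\<And>r. lo < r \<Longrightarrow> r < hi \<Longrightarrow> (U has_real_derivative D r) (at r)"
  obtains t where "lo < t 0" "\<And>i. i < d \<Longrightarrow> t i < t (Suc i)" "t d < hi"
    "\<And>i. 1 \<le> i \<Longrightarrow> i \<le> d \<Longrightarrow> D (t i) = 0" "U lo = 0 \<Longrightarrow> D (t 0) = 0"
proof -
  define P where "P i = (if i < d then z i else hi)" for i
  have P: "lo < P i" "P i \<le> hi" for i using z(3,4)[of i] z(3,4)[OF d] by (auto simp: P_def)
  obtain s where s: "\<And>i. i < d \<Longrightarrow> P i < s i" "\<And>i. i < d \<Longrightarrow> s i < P (Suc i)" "\<And>i. i < d \<Longrightarrow> D (s i) = 0"
  proof (rule rolle_zeros[of d P U D])
    show "P i < P (Suc i)" if "i < d" for i using that z(2,4)[of i] by (auto simp: P_def)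
    show "U (P i) = 0" for i using z(1)[of i] Uhi by (auto simp: P_def)
    show "continuous_on {P 0..P d} U" by (rule continuous_on_subset[OF cU]) (use P[of 0] P[of d] in auto)
    show "(U has_real_derivative D r) (at r)" if "P 0 < r" "r < P d" for r
      using that P[of 0] P[of d] by (intro dU) auto
  qed (use that in blast)
  have "\<exists>t0. lo < t0 \<and> t0 < z 0 \<and> (U lo = 0 \<longrightarrow> D t0 = 0)"
  proof (cases "U lo = 0")
    case True
    define Q where "Q i = (if i = 0 then lo else z 0)" for i :: nat
    obtain q where q: "\<And>i. i < 1 \<Longrightarrow> Q i < q i" "\<And>i. i < 1 \<Longrightarrow> q i < Q (Suc i)" "\<And>i. i < 1 \<Longrightarrow> D (q i) = 0"
    proof (rule rolle_zeros[of 1 Q U D])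
      show "continuous_on {Q 0..Q 1} U" by (rule continuous_on_subset[OF cU]) (use z(4)[OF d] in \<open>auto simp: Q_def\<close>)
    qed (use True z(1,3,4)[OF d] dU that in \<open>auto simp: Q_def\<close>)
    then show ?thesis using q[of 0] by (auto simp: Q_def)
  next
    case False
    then show ?thesis using z(3)[OF d] dense by blast
  qed
  then obtain t0 where t0: "lo < t0" "t0 < z 0" "U lo = 0 \<Longrightarrow> D t0 = 0" by blast
  define t where "t i = (case i of 0 \<Rightarrow> t0 | Suc j \<Rightarrow> s j)" for i
  show ?thesis
  proof (rule that[of t])
    show "lo < t 0" "U lo = 0 \<Longrightarrow> D (t 0) = 0" using t0 by (simp_all add: t_def)
    show "t i < t (Suc i)" if "i < d" for i
      using t0(2) s(1)[OF that] s(2)[of "i - 1"] that by (cases i) (auto simp: t_def P_def)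
    show "t d < hi" using s(2)[of "d - 1"] P(2)[of d] d by (cases d) (auto simp: t_def)
    show "D (t i) = 0" if "1 \<le> i" "i \<le> d" for i using s(3)[of "i - 1"] that by (cases i) (auto simp: t_def)
  qed
qed

text \<open>Along a line through the origin a radial function is even, so its derivative at 0 vanishes.\<close>

lemma radial_gradient_at_origin:
  fixes u :: "real^'n \<Rightarrow> real"
  assumes C2: "Ck_on 2 (ball 0 R) u" and rad: "radial_on (ball 0 R) u" and R: "0 < R"
  shows "((\<lambda>r. grad u (r *\<^sub>R axis l 1) $ l) \<longlongrightarrow> 0) (at 0)"
proof -
  let ?e = "axis l 1 :: real^'n"
  have 0: "(0 :: real^'n) \<in> ball 0 R" using R by simp
  have "Ck_on (Suc (Suc 0)) (ball 0 R) u" using C2 by (simp only: numeral_2_eq_2)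
  then have d: "u differentiable (at 0)" "(\<lambda>x. grad u x $ l) differentiable (at 0)" using 0 by auto
  have h: "(u has_derivative (\<lambda>h. grad u 0 \<bullet> h)) (at (0 *\<^sub>R ?e))"
    using has_derivative_grad[OF d(1)] by simp
  have "((\<lambda>s. s *\<^sub>R ?e) has_derivative (\<lambda>h. h *\<^sub>R ?e)) (at 0)" by (auto intro!: derivative_eq_intros)
  from has_derivative_compose[OF this h]
  have "((\<lambda>s. u (s *\<^sub>R ?e)) has_derivative (\<lambda>h. grad u 0 \<bullet> (h *\<^sub>R ?e))) (at 0)" .
  then have d1: "((\<lambda>s. u (s *\<^sub>R ?e)) has_real_derivative grad u 0 $ l) (at 0)"
    unfolding has_field_derivative_def
    by (rule has_derivative_eq_rhs) (auto simp: inner_axis mult.commute)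
  have "((\<lambda>s. u ((- s) *\<^sub>R ?e)) has_real_derivative grad u 0 $ l * (- 1)) (at 0)"
    by (rule DERIV_chain2[where f="\<lambda>s. u (s *\<^sub>R ?e)"]) (use d1 in \<open>auto intro!: derivative_eq_intros\<close>)
  then have "((\<lambda>s. u (s *\<^sub>R ?e)) has_real_derivative grad u 0 $ l * (- 1)) (at 0)"
  proof (rule has_field_derivative_transform_within_open[where S="{-R<..<R}"])
    fix s assume "s \<in> {-R<..<R}"
    then show "u ((- s) *\<^sub>R ?e) = u (s *\<^sub>R ?e)" using rad unfolding radial_on_def by auto
  qed (use R in auto)
  from DERIV_unique[OF d1 this] have g0: "grad u 0 $ l = 0" by simp
  have "isCont (\<lambda>x. grad u x $ l) 0" using d(2) by (rule differentiable_imp_continuous_within)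
  moreover have "isCont (\<lambda>r. r *\<^sub>R ?e) 0" by (intro continuous_intros)
  ultimately have "isCont (\<lambda>r. grad u (r *\<^sub>R ?e) $ l) 0"
    using isCont_o2[of 0 "\<lambda>r. r *\<^sub>R ?e" "\<lambda>x. grad u x $ l"] by simp
  then show ?thesis using g0 by (simp add: isCont_def)
qed

lemma nod_le_1:
  assumes "\<And>x. x \<in> \<Omega> \<Longrightarrow> x \<noteq> 0 \<Longrightarrow> u x = 0"
  shows "nod \<Omega> u \<le> 1"
proof -
  let ?C = "components (\<Omega> - u -` {0})"
  have sub0: "\<Omega> - u -` {0} \<subseteq> {0}" using assms by auto
  have "?C \<subseteq> {{0}}"
  proof
    fix c assume c: "c \<in> ?C"
    then have "c \<noteq> {}" "c \<subseteq> {0}"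
      using in_components_nonempty[OF c] in_components_subset[OF c] sub0 by auto
    then show "c \<in> {{0}}" by auto
  qed
  then have "finite ?C" "card ?C \<le> 1"
    using finite_subset card_mono[of "{{0}}" ?C] by auto
  then show ?thesis by (simp add: nod_def one_enat_def)
qed

theorem theorem3p6:
  fixes \<Omega> :: "(real^'n) set" and k p :: real and u :: "real^'n \<Rightarrow> real"
    and a f :: "real \<Rightarrow> real"
  defines "a \<equiv> \<lambda>s. 1 + \<bar>s\<bar> powr k"
    and "f \<equiv> \<lambda>s. \<bar>s\<bar> powr (p - 1) * s"
  assumes "2 \<le> CARD('n)"
    and "(\<exists>R>0. \<Omega> = ball 0 R) \<or> (\<exists>r R. 0 < r \<and> r < R \<and> \<Omega> = {x. r < norm x \<and> norm x < R})"
    and "1 < k"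
    and "k / 2 < p"
    and "2 < CARD('n) \<Longrightarrow> p < ((k + 1) * real CARD('n) + 2) / (real CARD('n) - 2)"
    and "quasilinear_solution \<Omega> a f u"
    and "radial_on \<Omega> u"
  shows "ereal_of_enat (nod \<Omega> u)
      \<le> 1 + ereal_of_enat (morse_index \<Omega> a f u) / ereal (real CARD('n) + 1)"
proof (rule nodal_bound)
  note N2 = assms(3) and k1 = \<open>1 < k\<close> and kp = \<open>k / 2 < p\<close> and sol = \<open>quasilinear_solution \<Omega> a f u\<close> and rad = \<open>radial_on \<Omega> u\<close>
  have p0: "0 < p" using k1 kp by linarith
  obtain l :: 'n where True by blast
  define e where "e = (axis l 1 :: real^'n)"
  have ne: "norm e = 1" by (simp add: e_def)
  (* a ball is treated as a shell of inner radius 0, together with its centre *)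
  obtain lo hi where \<Omega>: "\<Omega> = ball 0 hi \<and> lo = 0 \<and> 0 < hi \<or> \<Omega> = {x. lo < norm x \<and> norm x < hi} \<and> 0 < lo \<and> lo < hi"
    using assms(4) by blast
  note dom = radial_domain_facts[OF \<Omega> ne]
  define a' where "a' t = k * \<bar>t\<bar> powr (k - 1) * sgn t" for t
  have da: "(a has_real_derivative a' t) (at t)" for t
    unfolding a_def a'_def by (rule DERIV_cong[OF DERIV_add[OF DERIV_const abs_powr_deriv[OF k1]]]) simp
  have a1: "1 \<le> a t" for t by (simp add: a_def)
  have a0: "0 < a t" for t using a1[of t] by linarith
  have ca: "continuous_on UNIV a" using da by (meson DERIV_isCont continuous_at_imp_continuous_on)
  have cf: "continuous_on UNIV f" unfolding f_def by (rule abs_powr_sign_continuous[OF p0])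
  define h' where "h' t = \<bar>t\<bar> powr (p - 1) * (2 * p + (2 * p - k) * \<bar>t\<bar> powr k) / (2 * a t * sqrt (a t))" for t
  have dh: "((\<lambda>t. f t / sqrt (a t)) has_real_derivative h' t) (at t)" if "t \<noteq> 0" for t
    unfolding h'_def by (rule power_ratio_deriv[OF k1 that]) (simp_all add: a_def f_def)
  have h'0: "0 \<le> h' t" for t
    unfolding h'_def using a0[of t] kp p0 by (intro divide_nonneg_pos mult_nonneg_nonneg add_nonneg_nonneg mult_pos_pos) auto
  have h'c: "continuous_on (- {0}) h'"
    unfolding h'_def[abs_def] using a0
    by (intro continuous_intros continuous_on_subset[OF ca]) (auto simp: less_imp_neq[symmetric])
  define \<Phi> where "\<Phi> t = \<bar>t\<bar> powr (p + 1) / (p + 1)" for t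
  have d\<Phi>: "(\<Phi> has_real_derivative f t) (at t)" for t
  proof -
    have "(\<Phi> has_real_derivative ((p + 1) * \<bar>t\<bar> powr (p + 1 - 1) * sgn t) / (p + 1)) (at t)"
      unfolding \<Phi>_def[abs_def] by (rule DERIV_cdivide[OF abs_powr_deriv]) (use p0 in simp)
    moreover have "((p + 1) * \<bar>t\<bar> powr (p + 1 - 1) * sgn t) / (p + 1) = f t"
      using p0 by (cases "t = 0") (auto simp: f_def powr_diff sgn_if)
    ultimately show ?thesis by simp
  qed
  define U where "U r = u (r *\<^sub>R e)" for r
  define y where "y r = sqrt (a (U r)) * grad u (r *\<^sub>R e) $ l" for r
  note red = radial_reduction[OF sol rad dom(4,2) da a0 e_def U_def y_def]
  define K0 where "K0 = deriv (\<lambda>s. f (cauchy_g a s) / sqrt (a (cauchy_g a s))) (inv (cauchy_g a) 0)"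
  interpret radial_ode lo hi "CARD('n)" U y a f h' \<Phi> K0
  proof
    show "\<Phi> t = 0 \<longleftrightarrow> t = 0" "0 \<le> \<Phi> t" for t using p0 by (auto simp: \<Phi>_def)
  qed (use dom(2) N2 red a0 ca cf d\<Phi> dh h'0 h'c in \<open>auto simp: f_def\<close>)
  have uU: "u x = U (norm x)" if x: "x \<in> \<Omega>" "x \<noteq> 0" for x
  proof -
    have "norm (norm x *\<^sub>R e) = norm x" by (simp add: ne)
    moreover have "norm x *\<^sub>R e \<in> \<Omega>" using dom(4,5) x by (auto simp: ne)
    ultimately show ?thesis using rad x(1) unfolding radial_on_def U_def by metis
  qed
  have pot: "deriv (\<lambda>s. f (cauchy_g a s) / sqrt (a (cauchy_g a s))) (inv (cauchy_g a) (u x)) = B (norm x)"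
    if x: "x \<in> \<Omega>" "x \<noteq> 0" for x
  proof (cases "u x = 0")
    case True
    then have "B (norm x) = K0" using uU[OF x] dom(5)[OF x] by (simp add: B_def potential_def)
    then show ?thesis unfolding True K0_def[symmetric] by (rule sym)
  next
    case False
    then show ?thesis using uU[OF x] dom(5)[OF x] deriv_h[OF ca a1 dh[OF False]] by (simp add: B_def potential_def)
  qed
  have cU: "continuous_on {lo..hi} U"
  proof -
    have "continuous_on (closure \<Omega>) u" using sol by (simp add: quasilinear_solution_def)
    then show ?thesis unfolding U_def[abs_def]
      by (rule continuous_on_compose2) (use dom(6) in \<open>auto intro!: continuous_intros\<close>)
  qed
  have Uhi: "U hi = 0" "0 < lo \<Longrightarrow> U lo = 0"
    using sol dom(7,8) by (auto simp: quasilinear_solution_def U_def)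
  fix m assume m: "enat m \<le> nod \<Omega> u"
  show "enat ((CARD('n) + 1) * (m - 1)) \<le> morse_index \<Omega> a f u"
  proof (cases "m \<le> 1")
    case True
    then have "enat ((CARD('n) + 1) * (m - 1)) = 0" by (simp add: zero_enat_def)
    then show ?thesis by simp
  next
    case False
    then have m2: "2 \<le> m" by simp
    obtain z where z: "\<And>i. Suc i < m \<Longrightarrow> U (z i) = 0" "\<And>i. Suc (Suc i) < m \<Longrightarrow> z i < z (Suc i)"
      "\<And>i. Suc i < m \<Longrightarrow> \<exists>x\<in>\<Omega>. \<exists>y\<in>\<Omega>. norm x < z i \<and> z i < norm y"
    proof (rule nodal_zeros[OF N2 rad _ m, of U])
      show "p \<in> \<Omega>" if "x \<in> \<Omega>" "y \<in> \<Omega>" "norm x \<le> norm p" "norm p \<le> norm y" for x y p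
        using dom(9)[OF that] .
      show "u x = U (norm x)" if "x \<in> \<Omega>" "x \<noteq> 0" for x using uU[OF that] .
    qed (rule that)
    have zin: "lo < z i" "z i < hi" if i: "Suc i < m" for i
    proof -
      obtain x y where xy: "x \<in> \<Omega>" "y \<in> \<Omega>" "norm x < z i" "z i < norm y" using z(3)[OF i] by blast
      have "norm y > 0" using xy by (meson le_less_trans less_trans norm_ge_zero)
      then have "y \<noteq> 0" by auto
      then show "z i < hi" using dom(5)[OF xy(2)] xy by auto
      show "lo < z i"
      proof (cases "x = 0")
        case True
        then have "lo = 0" using \<Omega> xy(1) by auto
        then show ?thesis using xy(3) norm_ge_zero[of x] by linarith
      qed (use dom(5)[OF xy(1)] xy in auto)
    qed
    (* a double zero would make u vanish away from the origin, leaving at most one nodal domain *)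
    have simple: "U r \<noteq> 0 \<or> y r \<noteq> 0" if r: "lo < r" "r < hi" for r
    proof (rule ccontr)
      assume "\<not> ?thesis"
      then have "energy r = 0" by (simp add: energy_def \<Phi>_def)
      then have "U s = 0" if "lo < s" "s < hi" for s using energy_zero[OF r _ that] by blast
      then have "nod \<Omega> u \<le> 1" using uU dom(5) by (intro nod_le_1) simp
      with m have "enat m \<le> 1" by (rule order_trans)
      then show False using m2 by (simp add: one_enat_def)
    qed
    interpret sturm lo hi "CARD('n)" w w' B Z by (rule linearization_sturm[OF simple])
    define d where "d = m - 1"
    have d: "0 < d" using m2 by (simp add: d_def)
    have w0: "w s = 0" "w' s \<noteq> 0" if s: "lo < s" "s < hi" "y s / sqrt (a (U s)) = 0" for s
    proof -
      have y0: "y s = 0" using s(3) a0[of "U s"] by simp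
      then show "w s = 0" by (simp add: w_def)
      have "U s \<noteq> 0" using simple[OF s(1,2)] y0 by simp
      then have "f (U s) \<noteq> 0" by (simp add: f_def)
      then have "H (U s) \<noteq> 0" using a0[of "U s"] by (simp add: H_def)
      then show "w' s \<noteq> 0" using s y0 dom(2) by (simp add: w'_def)
    qed
    obtain t where t: "lo < t 0" "\<And>i. i < d \<Longrightarrow> t i < t (Suc i)" "t d < hi"
      "\<And>i. 1 \<le> i \<Longrightarrow> i \<le> d \<Longrightarrow> y (t i) / sqrt (a (U (t i))) = 0" "U lo = 0 \<Longrightarrow> y (t 0) / sqrt (a (U (t 0))) = 0"
    proof (rule interlacing_critical_points[OF d _ _ _ _ cU Uhi(1) red(1)])
      show "U (z i) = 0" "lo < z i" "z i < hi" if "i < d" for i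
        using z(1)[of i] zin[of i] that by (auto simp: d_def less_diff_conv)
      show "z i < z (Suc i)" if "Suc i < d" for i using z(2)[of i] that by (simp add: d_def less_diff_conv)
    qed (use that in blast)+
    have tle: "t i \<le> t j" if "i \<le> j" "j \<le> d" for i j
      using that
    proof (induction j)
      case (Suc j)
      then show ?case using t(2)[of j] by (cases "i = Suc j") auto
    qed simp
    have tin: "lo < t i" "t i < hi" if "i \<le> d" for i using tle[of 0 i] tle[of i d] that t(1,3) by auto
    have first: "\<exists>\<alpha> S \<eta> \<gamma>. lo < \<alpha> \<and> admissible \<alpha> (t 1) S \<eta> \<gamma> \<and>
      (\<forall>r. t 0 < r \<and> r < t 1 \<longrightarrow> \<eta> r = w r \<and> \<gamma> r = w' r) \<and> \<eta> (t 1) = 0 \<and> \<gamma> (t 1) = 0 \<and> \<bar>b \<eta> \<gamma> \<eta> \<gamma>\<bar> \<le> \<kappa>" if \<kappa>: "0 < \<kappa>" for \<kappa>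
    proof (cases "lo = 0")
      case True
      show ?thesis
      proof (rule first_direction_at_origin[OF True N2 _ _ _ _ _ \<kappa>])
        show "0 < t 0" "t 0 < t 1" "t 1 < hi" "w (t 1) = 0"
          using t(1) True t(2)[OF d] tin[of 1] d w0(1)[of "t 1"] t(4)[of 1] by auto
        fix e' :: real assume e': "0 < e'"
        have \<Omega>b: "\<Omega> = ball 0 hi" using \<Omega> True by auto
        have C2: "Ck_on 2 \<Omega> u" using sol by (simp add: quasilinear_solution_def)
        have "((\<lambda>r. grad u (r *\<^sub>R e) $ l) \<longlongrightarrow> 0) (at 0)"
          unfolding e_def using C2 rad dom(2,3) True unfolding \<Omega>b by (intro radial_gradient_at_origin) auto
        moreover have "isCont (\<lambda>r. sqrt (a (U r))) 0"
        proof -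
          have "Ck_on (Suc (Suc 0)) \<Omega> u" using C2 by (simp only: numeral_2_eq_2)
          then have "isCont u (0 *\<^sub>R e)" using True dom(2,3) \<Omega>b by (auto intro!: differentiable_imp_continuous_within)
          then have "isCont U 0" unfolding U_def[abs_def] by (rule isCont_o2[rotated]) (intro continuous_intros)
          then have "isCont (\<lambda>r. a (U r)) 0"
            by (rule isCont_o2) (use da in \<open>blast intro: DERIV_isCont\<close>)
          then show ?thesis by (intro continuous_intros)
        qed
        ultimately have "(y \<longlongrightarrow> sqrt (a (U 0)) * 0) (at 0)"
          unfolding y_def[abs_def] by (intro tendsto_mult) (simp_all add: isCont_def)
        then have "(y \<longlongrightarrow> 0) (at 0)" by simp
        from tendstoD[OF this e'] obtain \<delta> where \<delta>: "0 < \<delta>" "\<And>r. r \<noteq> 0 \<Longrightarrow> dist r 0 < \<delta> \<Longrightarrow> dist (y r) 0 < e'"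
          by (auto simp: eventually_at)
        show "\<exists>\<delta>>0. \<forall>r. 0 < r \<and> r < \<delta> \<longrightarrow> \<bar>r * w r\<bar> < e'"
          using \<delta> by (intro exI[of _ \<delta>]) (auto simp: w_def dist_real_def)
      qed
    next
      case False
      then have "y (t 0) / sqrt (a (U (t 0))) = 0" using t(5) Uhi(2) dom(2) by simp
      then show ?thesis
        using t(1) t(2)[OF d] tin[of 1] tin[of 0] d w0(1)[of "t 0"] w0(1)[of "t 1"] t(4)[of 1] \<kappa>
        by (intro first_direction_annulus) auto
    qed
    have wz: "w (t i) = 0" "w' (t i) \<noteq> 0" if "1 \<le> i" "i \<le> d" for i
      using w0 tin[OF that(2)] t(4)[OF that] by auto
    show ?thesis
    proof (rule negative_directions[OF d t(2) t(1) t(3) wz first])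
      fix \<alpha>' \<beta>' S E E' \<epsilon>
      assume E: "lo < \<alpha>'" "\<alpha>' < \<beta>'" "\<beta>' < hi" "0 < \<epsilon>"
        "\<And>j. j < d \<Longrightarrow> admissible \<alpha>' \<beta>' S (E j) (E' j)"
        "\<And>i j. i < d \<Longrightarrow> j < d \<Longrightarrow> \<bar>b (E i) (E' i) (E j) (E' j) + (if i = j then 2 * \<epsilon> else 0)\<bar> \<le> \<epsilon> / (2 * real d)"
      show ?thesis
      proof (rule smooth_negative_directions[OF d E])
        fix \<alpha> \<beta> and q pp :: "nat \<Rightarrow> real \<Rightarrow> real"
        assume A: "lo < \<alpha>" "\<alpha> < \<beta>" "\<beta> < hi"
          "\<And>j. j < d \<Longrightarrow> real_polynomial_function (q j)" "\<And>j r. j < d \<Longrightarrow> (q j has_real_derivative pp j r) (at r)"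
          "\<And>j. j < d \<Longrightarrow> continuous_on UNIV (pp j)"
          "\<And>c. \<exists>j<d. c j \<noteq> 0 \<Longrightarrow> qform CARD('n) B (\<lambda>r. \<Sum>j<d. c j * (cutoff \<alpha> \<beta> r * q j r))
            (\<lambda>r. \<Sum>j<d. c j * (cutoff' \<alpha> \<beta> r * q j r + cutoff \<alpha> \<beta> r * pp j r)) < 0"
        show ?thesis
          using morse_lower_bound[OF refl N2 dom(1,4) pot A] by (simp add: d_def)
      qed
    qed
  qed
qed

end
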